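(* (The Collapse Lemma.) Let $d,d',s$ be fixed, let $K$ be a homogeneous $s$-dimensional Calderón–Zygmund kernel with Hölder parameter $\alpha$, and let $\Lambda>0$. There exist $\beta>0$, depending only on $s$ and $\alpha$, and a constant $c_9>0$, depending only on $d,s,\alpha,\|K\|_*,\Lambda$, such that the following holds for every non-trivial $\Lambda$-nice reflectionless measure $\mu$, every $\varepsilon\in(0,\tfrac12)$, every unit vector $\mathbf e\in\mathbb C^{d'}$, every $x_0\in\mathbb R^d$, every $r>0$ and every $\varkappa>0$ with $\varkappa\le c_9\varepsilon^{\beta}$: if the set $E(\mathbf e,\varepsilon,r)$ is $\varkappa r$-dense in $B(x_0,2r)$, then $\mu(B(x_0,r))=0$.
   Context: Fix integers $d\ge2$, $d'\ge1$ and $s\in(0,d)$. $B(x,r)$ is the open ball in $\mathbb R^d$; a measure is a non-negative locally finite Borel measure on $\mathbb R^d$. $\mathrm{Lip}_0(\mathbb R^d)$ is the set of compactly supported (complex-valued) Lipschitz functions, $\mathrm{Lip}_B(\mathbb R^d)$ the set of bounded Lipschitz functions. Kernel. A homogeneous $s$-dimensional Calderón–Zygmund kernel is $K:\mathbb R^d\setminus\{0\}\to\mathbb C^{d'}$ with (i) $|K(x)|\le|x|^{-s}$; (ii) $K(-x)=-K(x)$; (iii) for some $\alpha\in(0,1]$ the $\alpha$-Hölder seminorm on $\mathbb R^d$, denoted $\|K\|_*$, of $x\mapsto K(x)|x|^{s+\alpha}$ (set to $0$ at $0$) is finite; (iv) $K(\lambda x)=\lambda^{-s}K(x)$ for $\lambda>0$,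 $x\ne0$. For $\delta>0$ let $K_\delta(x)=K(x)\big(\tfrac{|x|}{\max(\delta,|x|)}\big)^{s+\alpha}$, $K_\delta(0)=0$, and $K^\delta=K-K_\delta$ on $\mathbb R^d\setminus\{0\}$ (supported in $\overline{B(0,\delta)}$). Measures. $\mu$ is diffuse if $(x,y)\mapsto|x-y|^{1-s}$ is locally integrable with respect to $\mu\times\mu$; $\mu$ has restricted growth at infinity if $\int_{|x|\ge1}|x|^{-s-\alpha}d\mu(x)<\infty$; $\mu$ is $\Lambda$-nice if $\mu(B(x,r))\le\Lambda r^s$ for all $x\in\mathbb R^d$, $r>0$ (nice measures are diffuse with restricted growth). Forms. Let $H_{f,\varphi}(x,y)=\tfrac12[f(y)\varphi(x)-f(x)\varphi(y)]$. For $\mu$ diffuse and $f,\varphi\in\mathrm{Lip}_0(\mathbb R^d)$, $\langle T(f\mu),\varphi\rangle_\mu=\iint K(x-y)H_{f,\varphi}(x,y)\,d\mu(x)d\mu(y)$ (integrand read as $0$ on the diagonal). For $f\in\mathrm{Lip}_0$, $\varphi\in\mathrm{Lip}_B$, $\langle T^\delta(f\mu),\varphi\rangle_\mu=\iint K^\delta(x-y)H_{f,\varphi}(x,y)\,d\mu(x)d\mu(y)$. If $\mu$ also has restricted growth, $f\in\mathrm{Lip}_0$, $\int f\,d\mu=0$ and $\varphi\in\mathrm{Lip}_B$, then $\langle T(f\mu),\varphi\rangle_\mu=\langle T(f\mu),\psi\varphi\rangle_\mu+\int T(f\mu)(x)[1-\psi(x)]\varphi(x)d\mu(x)$, where $\psi\in\mathrm{Lip}_0$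 equals $1$ on a neighbourhood of $\mathrm{supp} f$ and $T(f\mu)(x)=\int K(x-y)f(y)d\mu(y)$; this does not depend on $\psi$. Reflectionless. A diffuse measure $\mu$ with restricted growth at infinity is reflectionless if $\langle T(f\mu),1\rangle_\mu=0$ for all $f\in\mathrm{Lip}_0(\mathbb R^d)$ with $\int f\,d\mu=0$. Potential. For non-trivial diffuse $\mu$ with restricted growth, fix $\eta\in\mathrm{Lip}_0(\mathbb R^d)$, $\eta\ge0$, $\int\eta\,d\mu=1$. For $\varphi\in\mathrm{Lip}_B$, $\delta>0$, $x\in\mathbb R^d$, $$\overline T_{\mu,\delta}(\varphi)(x)=\iint[K_\delta(y-x)-K_\delta(y-z)]\varphi(y)\eta(z)\,d\mu(y)d\mu(z)-\langle T^\delta(\eta\mu),\varphi\rangle_\mu .$$ It is continuous in $x$, and for reflectionless $\mu$ and $\varphi\equiv1$ it does not depend on $\eta$. For a unit vector $\mathbf e\in\mathbb C^{d'}$, $\varepsilon>0$, $r>0$: $E(\mathbf e,\varepsilon,r)=\{x\in\mathbb R^d:\Re[\mathbf e\cdot\overline T_{\mu,\delta}(1)(x)]>\varepsilon\text{ for all }\delta\in(0,r)\}$, where $\mathbf e\cdot v=\sum_j e_jv_j$. A set $E$ is $\rho$-dense in a ball $B$ if for every $x\in B$ there is $x'\in E$ with $|x-x'|\le\rho$. *)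

theory Defs
  imports "HOL-Analysis.Analysis" "HOL-Library.Function_Algebras"
begin

text \<open>
  The constants below have to be uniform in the dimensions: one exponent serves all dimensions
  \<^term>\<open>d\<close> of the space, one constant serves all dimensions \<^term>\<open>d'\<close> of the target of the
  kernel. Both dimensions are therefore natural numbers that can be quantified over inside a
  formula. A point of the \<^term>\<open>d\<close>-dimensional space is a sequence of reals that vanishes from
  index \<^term>\<open>d\<close> on; sums, differences and negatives of points are the pointwise ones. For
  values in the \<^term>\<open>d'\<close>-dimensional complex space only the components with index below
  \<^term>\<open>d'\<close> matter.
\<close>

type_synonym point = "nat \<Rightarrow> real"

definition Rd :: "nat \<Rightarrow> point set" where
  "Rd d = {x. \<forall>i\<ge>d. x i = 0}"

definition vnorm :: "nat \<Rightarrow> point \<Rightarrow> real" where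
  "vnorm d x = L2_set x {..<d}"

definition cnorm :: "nat \<Rightarrow> (nat \<Rightarrow> complex) \<Rightarrow> real" where
  "cnorm d' v = L2_set (\<lambda>j. cmod (v j)) {..<d'}"

definition rball :: "nat \<Rightarrow> point \<Rightarrow> real \<Rightarrow> point set" where
  "rball d x r = {y \<in> Rd d. vnorm d (y - x) < r}"

text \<open>
  The type of sequences carries the product topology. On \<^term>\<open>Rd d\<close> it induces the Euclidean
  topology, so the library's \<^const>\<open>open\<close>, \<^const>\<open>closure\<close>, \<^const>\<open>compact\<close> and
  \<^const>\<open>borel\<close> have their usual meaning for subsets of \<^term>\<open>Rd d\<close>, a closed set.
\<close>

lemma continuous_on_vnorm: "continuous_on A (\<lambda>y. vnorm d (y - x))"
  unfolding vnorm_def L2_set_def fun_diff_def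
  by (intro continuous_intros continuous_on_subset[OF continuous_on_product_coordinates]) auto

lemma closed_Rd: "closed (Rd d)"
proof -
  have "Rd d = (\<Inter>i\<in>{d..}. {x. x i = 0})"
    by (auto simp: Rd_def)
  moreover have "closed {x :: point. x i = 0}" for i
    by (intro closed_Collect_eq continuous_intros) auto
  ultimately show ?thesis
    by auto
qed

lemma openin_Rd_iff:
  "openin (top_of_set (Rd d)) U \<longleftrightarrow> U \<subseteq> Rd d \<and> (\<forall>x\<in>U. \<exists>r>0. rball d x r \<subseteq> U)"
proof
  assume "openin (top_of_set (Rd d)) U"
  then obtain V where V: "open V" "U = Rd d \<inter> V"
    by (auto simp: openin_open)
  show "U \<subseteq> Rd d \<and> (\<forall>x\<in>U. \<exists>r>0. rball d x r \<subseteq> U)"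
  proof (intro conjI ballI)
    fix x assume x: "x \<in> U"
    have "openin (product_topology (\<lambda>i. euclidean) UNIV) V"
      using V(1) by (simp add: open_fun_def)
    from product_topology_open_contains_basis[OF this, of x] x V(2)
    obtain X where X: "x \<in> Pi\<^sub>E UNIV X" "\<And>i. open (X i)" "Pi\<^sub>E UNIV X \<subseteq> V"
      by auto
    have "\<exists>e>0. ball (x i) e \<subseteq> X i" for i
      using X(1,2) by (meson PiE_mem UNIV_I open_contains_ball)
    then obtain e where e: "\<And>i. e i > 0" "\<And>i. ball (x i) (e i) \<subseteq> X i"
      by metis
    define r where "r = Min (insert 1 (e ` {..<d}))"
    have r: "r > 0" "\<And>i. i < d \<Longrightarrow> r \<le> e i"
      using e(1) by (auto simp: r_def)
    have "y \<in> V" if y: "y \<in> rball d x r" for y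
    proof -
      have "y i \<in> X i" for i
      proof (cases "i < d")
        case True
        have "\<bar>y i - x i\<bar> \<le> L2_set (\<lambda>i. \<bar>y i - x i\<bar>) {..<d}"
          using True by (intro member_le_L2_set) auto
        also have "\<dots> = vnorm d (y - x)"
          by (simp add: vnorm_def L2_set_def fun_diff_def)
        also have "\<dots> < e i"
          using y r(2)[OF True] by (simp add: rball_def)
        finally show ?thesis
          using e(2)[of i] by (auto simp: dist_real_def)
      next
        case False
        then have "y i = x i"
          using x y V(2) by (simp add: rball_def Rd_def)
        then show ?thesis
          using X(1) by (auto simp: PiE_iff)
      qed
      then show ?thesis
        using X(3) by (auto simp: PiE_iff)
    qed
    then show "\<exists>r>0. rball d x r \<subseteq> U"
      using r(1) V(2) by (auto simp: rball_def)
  qed (use V in auto)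
next
  assume U: "U \<subseteq> Rd d \<and> (\<forall>x\<in>U. \<exists>r>0. rball d x r \<subseteq> U)"
  have "openin (top_of_set (Rd d)) (rball d x r)" for x r
  proof -
    have "rball d x r = Rd d \<inter> {y. vnorm d (y - x) < r}"
      by (auto simp: rball_def)
    moreover have "open {y. vnorm d (y - x) < r}"
      by (intro open_Collect_less continuous_on_vnorm continuous_intros)
    ultimately show ?thesis
      by (auto simp: openin_open)
  qed
  moreover have "x \<in> rball d x r" if "x \<in> U" "r > 0" for x r
    using that U by (auto simp: rball_def vnorm_def L2_set_def)
  ultimately show "openin (top_of_set (Rd d)) U"
    using U by (subst openin_subopen) meson
qed


subsection \<open>Lipschitz functions\<close>

definition lipschitz :: "nat \<Rightarrow> (point \<Rightarrow> complex) \<Rightarrow> bool" where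
  "lipschitz d f \<longleftrightarrow> (\<exists>L. \<forall>x\<in>Rd d. \<forall>y\<in>Rd d. cmod (f x - f y) \<le> L * vnorm d (x - y))"

definition supp :: "nat \<Rightarrow> (point \<Rightarrow> complex) \<Rightarrow> point set" where
  "supp d f = closure {x \<in> Rd d. f x \<noteq> 0}"

definition Lip0 :: "nat \<Rightarrow> (point \<Rightarrow> complex) set" where
  "Lip0 d = {f. lipschitz d f \<and> compact (supp d f)}"


subsection \<open>Calderon-Zygmund kernels\<close>

text \<open>
  A kernel is a total function in the logic, but it only matters away from \<^term>\<open>0\<close>.
\<close>

type_synonym kernel = "point \<Rightarrow> nat \<Rightarrow> complex"

definition kernel_seminorm :: "nat \<Rightarrow> nat \<Rightarrow> real \<Rightarrow> real \<Rightarrow> kernel \<Rightarrow> ennreal" where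
  "kernel_seminorm d d' s \<alpha> K =
     (let F = (\<lambda>x j. if x = 0 then 0 else K x j * complex_of_real (vnorm d x powr (s + \<alpha>)))
      in SUP (x, y) \<in> {(x, y). x \<in> Rd d \<and> y \<in> Rd d \<and> x \<noteq> y}.
           ennreal (cnorm d' (F x - F y) / vnorm d (x - y) powr \<alpha>))"

definition cz_kernel :: "nat \<Rightarrow> nat \<Rightarrow> real \<Rightarrow> real \<Rightarrow> kernel \<Rightarrow> bool" where
  "cz_kernel d d' s \<alpha> K \<longleftrightarrow>
     0 < \<alpha> \<and> \<alpha> \<le> 1 \<and>
     (\<forall>x\<in>Rd d - {0}. cnorm d' (K x) \<le> vnorm d x powr (- s)) \<and>
     (\<forall>x\<in>Rd d - {0}. \<forall>j<d'. K (- x) j = - K x j) \<and>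
     kernel_seminorm d d' s \<alpha> K < \<infinity> \<and>
     (\<forall>x\<in>Rd d - {0}. \<forall>t>0. \<forall>j<d'. K (\<lambda>i. t * x i) j = complex_of_real (t powr (- s)) * K x j)"

definition K_reg :: "nat \<Rightarrow> real \<Rightarrow> real \<Rightarrow> kernel \<Rightarrow> real \<Rightarrow> kernel" where
  "K_reg d s \<alpha> K \<delta> x j =
     (if x = 0 then 0
      else K x j * complex_of_real ((vnorm d x / max \<delta> (vnorm d x)) powr (s + \<alpha>)))"

definition K_loc :: "nat \<Rightarrow> real \<Rightarrow> real \<Rightarrow> kernel \<Rightarrow> real \<Rightarrow> kernel" where
  "K_loc d s \<alpha> K \<delta> x j = K x j - K_reg d s \<alpha> K \<delta> x j"


subsection \<open>Measures\<close>

definition rd_measure :: "nat \<Rightarrow> point measure \<Rightarrow> bool" where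
  "rd_measure d \<mu> \<longleftrightarrow>
     sets \<mu> = sets (restrict_space borel (Rd d)) \<and>
     (\<forall>x\<in>Rd d. \<exists>r>0. emeasure \<mu> (rball d x r) < \<infinity>)"

text \<open>
  \<open>dist_pow\<close> is the extended-valued function $|x-y|^{1-s}$. On the diagonal the library's
  convention \<^term>\<open>(0::real) powr a = 0\<close> would give the wrong value unless $s < 1$; for $s > 1$
  the value there is infinite.
\<close>

definition dist_pow :: "nat \<Rightarrow> real \<Rightarrow> point \<Rightarrow> point \<Rightarrow> ennreal" where
  "dist_pow d s x y =
     (if x \<noteq> y then ennreal (vnorm d (x - y) powr (1 - s))
      else if s < 1 then 0 else if s = 1 then 1 else \<infinity>)"

definition diffuse :: "nat \<Rightarrow> real \<Rightarrow> point measure \<Rightarrow> bool" where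
  "diffuse d s \<mu> \<longleftrightarrow>
     (\<forall>C. compact C \<and> C \<subseteq> Rd d \<times> Rd d \<longrightarrow>
        (\<integral>\<^sup>+p\<in>C. dist_pow d s (fst p) (snd p) \<partial>(\<mu> \<Otimes>\<^sub>M \<mu>)) < \<infinity>)"

definition restricted_growth :: "nat \<Rightarrow> real \<Rightarrow> real \<Rightarrow> point measure \<Rightarrow> bool" where
  "restricted_growth d s \<alpha> \<mu> \<longleftrightarrow>
     (\<integral>\<^sup>+x\<in>{x. vnorm d x \<ge> 1}. ennreal (vnorm d x powr (- s - \<alpha>)) \<partial>\<mu>) < \<infinity>"

definition nice :: "nat \<Rightarrow> real \<Rightarrow> real \<Rightarrow> point measure \<Rightarrow> bool" where
  "nice d s \<Lambda> \<mu> \<longleftrightarrow>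
     (\<forall>x\<in>Rd d. \<forall>r>0. emeasure \<mu> (rball d x r) \<le> ennreal (\<Lambda> * r powr s))"

definition nontrivial :: "point measure \<Rightarrow> bool" where
  "nontrivial \<mu> \<longleftrightarrow> emeasure \<mu> (space \<mu>) \<noteq> 0"


subsection \<open>Bilinear forms\<close>

definition H_form :: "(point \<Rightarrow> complex) \<Rightarrow> (point \<Rightarrow> complex) \<Rightarrow> point \<Rightarrow> point \<Rightarrow> complex" where
  "H_form f \<phi> x y = (f y * \<phi> x - f x * \<phi> y) / 2"

text \<open>
  The \<^term>\<open>j\<close>-th component of the form with kernel \<^term>\<open>k\<close>. No case distinction is needed on
  the diagonal, where \<^const>\<open>H_form\<close> vanishes. With \<^term>\<open>k = K\<close> this is
  $\langle T(f\mu),\varphi\rangle_\mu$ for two compactly supported functions, with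
  \<^term>\<open>k = K_loc d s \<alpha> K \<delta>\<close> it is $\langle T^\delta(f\mu),\varphi\rangle_\mu$.
\<close>

definition form :: "point measure \<Rightarrow> kernel \<Rightarrow> (point \<Rightarrow> complex) \<Rightarrow> (point \<Rightarrow> complex) \<Rightarrow> nat \<Rightarrow> complex"
  where "form \<mu> k f \<phi> j =
     (LINT p | (\<mu> \<Otimes>\<^sub>M \<mu>). k (fst p - snd p) j * H_form f \<phi> (fst p) (snd p))"

definition T_op :: "point measure \<Rightarrow> kernel \<Rightarrow> (point \<Rightarrow> complex) \<Rightarrow> point \<Rightarrow> nat \<Rightarrow> complex" where
  "T_op \<mu> K f x j = (LINT y | \<mu>. K (x - y) j * f y)"

definition cutoff :: "nat \<Rightarrow> (point \<Rightarrow> complex) \<Rightarrow> (point \<Rightarrow> complex) \<Rightarrow> bool" where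
  "cutoff d f \<psi> \<longleftrightarrow>
     \<psi> \<in> Lip0 d \<and> (\<exists>U. open U \<and> supp d f \<subseteq> U \<and> (\<forall>x\<in>U \<inter> Rd d. \<psi> x = 1))"

text \<open>
  $\langle T(f\mu),\varphi\rangle_\mu$ for $f$ with mean zero and $\varphi$ bounded. The value does
  not depend on the cutoff, so an arbitrary one is chosen.
\<close>

definition form_ext ::
    "nat \<Rightarrow> point measure \<Rightarrow> kernel \<Rightarrow> (point \<Rightarrow> complex) \<Rightarrow> (point \<Rightarrow> complex) \<Rightarrow> nat \<Rightarrow> complex" where
  "form_ext d \<mu> K f \<phi> j =
     (let \<psi> = (SOME \<psi>. cutoff d f \<psi>)
      in form \<mu> K f (\<lambda>x. \<psi> x * \<phi> x) j + (LINT x | \<mu>. T_op \<mu> K f x j * (1 - \<psi> x) * \<phi> x))"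

definition reflectionless ::
    "nat \<Rightarrow> nat \<Rightarrow> real \<Rightarrow> real \<Rightarrow> kernel \<Rightarrow> point measure \<Rightarrow> bool" where
  "reflectionless d d' s \<alpha> K \<mu> \<longleftrightarrow>
     diffuse d s \<mu> \<and> restricted_growth d s \<alpha> \<mu> \<and>
     (\<forall>f\<in>Lip0 d. (LINT x | \<mu>. f x) = 0 \<longrightarrow> (\<forall>j<d'. form_ext d \<mu> K f (\<lambda>_. 1) j = 0))"


subsection \<open>The potential\<close>

definition normalizer :: "nat \<Rightarrow> point measure \<Rightarrow> (point \<Rightarrow> real) \<Rightarrow> bool" where
  "normalizer d \<mu> \<eta> \<longleftrightarrow>
     (\<lambda>x. complex_of_real (\<eta> x)) \<in> Lip0 d \<and> (\<forall>x\<in>Rd d. \<eta> x \<ge> 0) \<and> (LINT x | \<mu>. \<eta> x) = 1"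

definition T_bar ::
    "nat \<Rightarrow> real \<Rightarrow> real \<Rightarrow> kernel \<Rightarrow> point measure \<Rightarrow> (point \<Rightarrow> real) \<Rightarrow> real \<Rightarrow>
     (point \<Rightarrow> complex) \<Rightarrow> point \<Rightarrow> nat \<Rightarrow> complex" where
  "T_bar d s \<alpha> K \<mu> \<eta> \<delta> \<phi> x j =
     (LINT (y, z) | (\<mu> \<Otimes>\<^sub>M \<mu>).
        (K_reg d s \<alpha> K \<delta> (y - x) j - K_reg d s \<alpha> K \<delta> (y - z) j) * \<phi> y * complex_of_real (\<eta> z))
     - form \<mu> (K_loc d s \<alpha> K \<delta>) (\<lambda>x. complex_of_real (\<eta> x)) \<phi> j"

definition E_set ::
    "nat \<Rightarrow> nat \<Rightarrow> real \<Rightarrow> real \<Rightarrow> kernel \<Rightarrow> point measure \<Rightarrow> (point \<Rightarrow> real) \<Rightarrow>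
     (nat \<Rightarrow> complex) \<Rightarrow> real \<Rightarrow> real \<Rightarrow> point set" where
  "E_set d d' s \<alpha> K \<mu> \<eta> e \<epsilon> r =
     {x \<in> Rd d. \<forall>\<delta>\<in>{0<..<r}. Re (\<Sum>j<d'. e j * T_bar d s \<alpha> K \<mu> \<eta> \<delta> (\<lambda>_. 1) x j) > \<epsilon>}"

definition dense_in :: "nat \<Rightarrow> real \<Rightarrow> point set \<Rightarrow> point set \<Rightarrow> bool" where
  "dense_in d \<rho> E B \<longleftrightarrow> (\<forall>x\<in>B. \<exists>x'\<in>E. vnorm d (x - x') \<le> \<rho>)"

end

theory Submission
  imports Defs
begin

text \<open>
  Write $V_\delta$ for the scalar product of the potential with the unit vector. For a reflectionless
  measure and a compactly supported Lipschitz function $f$, subtracting a multiple of $\eta$ from $f$ turns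
  reflectionlessness into the identity $\int V_\delta f\,d\mu = -\langle T^\delta(f\mu), 1\rangle$, and the
  right-hand side only sees pairs at distance less than $\delta$. If $\Re V_\delta \ge \varepsilon/2$ on
  the support of a bump function of width $g$, this gives
  $\varepsilon\,\mu(B(\rho)) \le C\,(\delta/g)\,\mu(B(\rho + 2g))$ for concentric balls.

  Since $V_\delta$ is Hoelder continuous at scale $\delta$, density of the set $E$ allows one such step
  with $\delta$ comparable to $\varepsilon^{s+2} r$, after which the measure of a smaller ball is a small
  multiple of $\varepsilon^{s+1} r^s$. From then on the steps are iterated in the manner of De Giorgi along
  the radii $r_n = r(1 + 2^{-n-1})$ with $\delta_n$ comparable to $\varepsilon 2^{-n} r$. That
  $\Re V_{\delta_n}$ stays above $\varepsilon/2$, although $\delta_n$ drops below the scale of density,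
  is due to the smallness of $\mu$ on the balls $B(r_j)$ found before: the shells between them contribute little to the
  oscillation of $V_{\delta_n}$, and outside $B(r_0)$ the kernel is Hoelder at scale $r$. Each step gains a
  factor $2^{-(s+1)}$, so the limit ball $B(r)$ is null.
\<close>

subsection \<open>Points and Lipschitz functions\<close>

text \<open>The exponent s + 2 + 1/\<alpha> results from a balance. In the iteration \<delta> is a
  multiple of \<epsilon> times the width of the current layer, which makes the gain per step
  independent of n. The kernel then has size about (\<epsilon> r 2^{-j})^{-s} on layer j, so the
  layers disturb the potential by less than \<epsilon> only if the starting ball has measure below
  about \<epsilon>^{s+1} r^s. Niceness gives no small factor; the preliminary step has to supply it.
  That step gains \<delta>/(\<epsilon> r), hence \<delta> of order \<epsilon>^{s+2} r, and Hoelder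
  continuity at this scale over the distance \<kappa> r asks for \<kappa> of order \<epsilon>^{s+2}
  \<epsilon>^{1/\<alpha>}.

  The gain 2^{-(s+1)} is dictated by the layers too: it has to beat the growth 2^s of the kernel
  from one layer to the next, and the remaining 1/2 makes the sum geometric. Since membership in E
  concerns all \<delta> below r, the same set E serves every step although \<delta> tends to 0. The
  potential enters only through its differences and its integrals against test functions; \<eta>
  affects neither, so no constant depends on it.\<close>

lemma vnorm_nonneg [simp]: "0 \<le> vnorm d x"
  by (simp add: vnorm_def)

lemma vnorm_zero [simp]: "vnorm d 0 = 0"
  by (simp add: vnorm_def L2_set_def)

lemma vnorm_eq_0_iff: "x \<in> Rd d \<Longrightarrow> vnorm d x = 0 \<longleftrightarrow> x = 0"
  by (auto simp: vnorm_def L2_set_eq_0_iff Rd_def fun_eq_iff) (metis lessThan_iff not_le)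

lemma vnorm_pos: "x \<in> Rd d \<Longrightarrow> x \<noteq> 0 \<Longrightarrow> 0 < vnorm d x"
  using vnorm_eq_0_iff[of x d] vnorm_nonneg[of d x] by linarith

lemma vnorm_minus [simp]: "vnorm d (- x) = vnorm d x"
  by (simp add: vnorm_def L2_set_def)

lemma vnorm_scale: "vnorm d (\<lambda>i. t * x i) = \<bar>t\<bar> * vnorm d x"
  by (simp add: vnorm_def L2_set_def power_mult_distrib sum_distrib_left[symmetric] real_sqrt_mult)

lemma vnorm_commute: "vnorm d (x - y) = vnorm d (y - x)"
  using vnorm_minus[of d "x - y"] by simp

lemma vnorm_triangle: "vnorm d (x + y) \<le> vnorm d x + vnorm d y"
  using L2_set_triangle_ineq[of x y "{..<d}"] by (simp add: vnorm_def plus_fun_def)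

lemma vnorm_triangle_sub: "vnorm d (x - z) \<le> vnorm d (x - y) + vnorm d (y - z)"
  using vnorm_triangle[of d "x - y" "y - z"] by simp

lemma vnorm_diff_abs: "\<bar>vnorm d x - vnorm d y\<bar> \<le> vnorm d (x - y)"
  using vnorm_triangle[of d "x - y" y] vnorm_triangle[of d "y - x" x] vnorm_commute[of d x y]
  by auto

lemma Rd_zero [simp]: "0 \<in> Rd d"
  by (simp add: Rd_def)

lemma Rd_diff [intro, simp]: "x \<in> Rd d \<Longrightarrow> y \<in> Rd d \<Longrightarrow> x - y \<in> Rd d"
  and Rd_scale [intro, simp]: "x \<in> Rd d \<Longrightarrow> (\<lambda>i. t * x i) \<in> Rd d"
  by (auto simp: Rd_def)

lemma rball_subset_Rd: "rball d x r \<subseteq> Rd d"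
  by (auto simp: rball_def)

lemma rball_mono: "r \<le> r' \<Longrightarrow> rball d x r \<subseteq> rball d x r'"
  by (auto simp: rball_def)

text \<open>A box whose factors are compact intervals below index \<open>d\<close> and {0} from
  \<open>d\<close> on is compact by Tychonoff, and the ball is a closed subset of such a
  box.\<close>

lemma compact_closed_ball: "compact {x \<in> Rd d. vnorm d (x - c) \<le> R}"
proof -
  define B where "B = {x \<in> Rd d. vnorm d (x - c) \<le> R}"
  define S where "S = (\<lambda>i. if i < d then {c i - R..c i + R} else {0::real})"
  have "compactin (product_topology (\<lambda>i. euclidean) UNIV) (PiE UNIV S)"
    by (rule iffD2[OF compactin_PiE]) (simp add: S_def)
  then have P: "compact (PiE UNIV S)"
    by (simp add: euclidean_product_topology)
  have sub: "B \<subseteq> PiE UNIV S"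
  proof
    fix x assume "x \<in> B"
    then have x: "x \<in> Rd d" "vnorm d (x - c) \<le> R" by (auto simp: B_def)
    have le: "\<bar>x i - c i\<bar> \<le> R" if "i < d" for i
    proof -
      have "\<bar>x i - c i\<bar> \<le> L2_set (\<lambda>i. \<bar>x i - c i\<bar>) {..<d}"
        using that by (intro member_le_L2_set) auto
      also have "\<dots> = vnorm d (x - c)"
        by (simp add: vnorm_def L2_set_def fun_diff_def)
      finally show ?thesis using x by linarith
    qed
    have "x i \<in> S i" for i
    proof (cases "i < d")
      case True
      then show ?thesis using le[OF True] by (simp add: S_def abs_le_iff)
    next
      case False
      then show ?thesis using x(1) by (simp add: S_def Rd_def)
    qed
    then show "x \<in> PiE UNIV S"
      by (simp add: PiE_iff)
  qed
  have "B = Rd d \<inter> {x. vnorm d (x - c) \<le> R}"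
    by (auto simp: B_def)
  then have "closed B"
    using closed_Int[OF closed_Rd closed_Collect_le[OF continuous_on_vnorm continuous_on_const]] by simp
  then have "compact B"
    using compact_Int_closed[OF P, of B] sub by (simp add: Int_absorb1)
  then show ?thesis by (simp add: B_def)
qed

lemma continuous_on_vnorm0: "continuous_on A (vnorm d)"
  using continuous_on_vnorm[of A d 0] by simp

lemma holder_continuous_on:
  fixes f :: "point \<Rightarrow> complex"
  assumes "0 < a" and "\<And>x y. x \<in> Rd d \<Longrightarrow> y \<in> Rd d \<Longrightarrow> cmod (f x - f y) \<le> L * vnorm d (x - y) powr a"
  shows "continuous_on (Rd d) f"
  unfolding continuous_on_def
proof
  fix x assume x: "x \<in> Rd d"
  have "((\<lambda>y. vnorm d (y - x)) \<longlongrightarrow> vnorm d (x - x)) (at x within Rd d)"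
    using continuous_on_vnorm[of "Rd d" d x] x unfolding continuous_on_def by blast
  then have "((\<lambda>y. vnorm d (y - x)) \<longlongrightarrow> 0) (at x within Rd d)"
    using vnorm_zero[of d] by simp
  then have "((\<lambda>y. L * vnorm d (y - x) powr a) \<longlongrightarrow> L * 0 powr a) (at x within Rd d)"
    using assms(1) by (intro tendsto_intros tendsto_powr') auto
  then have *: "((\<lambda>y. L * vnorm d (y - x) powr a) \<longlongrightarrow> 0) (at x within Rd d)"
    by simp
  have "\<forall>\<^sub>F y in at x within Rd d. cmod (f y - f x) \<le> L * vnorm d (y - x) powr a"
    unfolding eventually_at_filter using assms(2) x by (intro always_eventually) blast
  then have "((\<lambda>y. f y - f x) \<longlongrightarrow> 0) (at x within Rd d)"
    by (rule Lim_null_comparison[OF _ *])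
  then show "(f \<longlongrightarrow> f x) (at x within Rd d)"
    by (simp add: LIM_zero_iff)
qed

text \<open>The test function of the growth step: 1 up to radius \<rho>, 0 from radius \<rho> + g on
  and linear in the radius between, hence with Lipschitz constant 1/g.\<close>

definition bump :: "nat \<Rightarrow> point \<Rightarrow> real \<Rightarrow> real \<Rightarrow> point \<Rightarrow> real" where
  "bump d c \<rho> g x = max 0 (min 1 ((\<rho> + g - vnorm d (x - c)) / g))"

lemma bump_bounds [simp]: "0 \<le> bump d c \<rho> g x" "bump d c \<rho> g x \<le> 1"
  by (auto simp: bump_def)

lemma bump_eq_1: "0 < g \<Longrightarrow> vnorm d (x - c) \<le> \<rho> \<Longrightarrow> bump d c \<rho> g x = 1"
  by (auto simp: bump_def field_simps min_def max_def)

lemma bump_eq_0: "0 < g \<Longrightarrow> \<rho> + g \<le> vnorm d (x - c) \<Longrightarrow> bump d c \<rho> g x = 0"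
  by (auto simp: bump_def field_simps min_def max_def)

lemma bump_lipschitz:
  assumes "0 < g"
  shows "\<bar>bump d c \<rho> g x - bump d c \<rho> g y\<bar> \<le> (1 / g) * vnorm d (x - y)"
proof -
  have 1: "\<bar>max 0 (min 1 a) - max 0 (min 1 b)\<bar> \<le> \<bar>a - b\<bar>" for a b :: real
    by (auto simp: max_def min_def)
  have "\<bar>bump d c \<rho> g x - bump d c \<rho> g y\<bar>
      \<le> \<bar>(\<rho> + g - vnorm d (x - c)) / g - (\<rho> + g - vnorm d (y - c)) / g\<bar>"
    unfolding bump_def by (rule 1)
  also have "\<dots> = \<bar>vnorm d (x - c) - vnorm d (y - c)\<bar> / g"
    using assms by (simp add: diff_divide_distrib[symmetric] abs_minus_commute)
  also have "\<dots> \<le> vnorm d (x - y) / g"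
    using assms vnorm_diff_abs[of d "x - c" "y - c"] by (intro divide_right_mono) auto
  finally show ?thesis by simp
qed

lemma bump_in_Lip0:
  assumes "0 < g"
  shows "(\<lambda>x. complex_of_real (bump d c \<rho> g x)) \<in> Lip0 d"
proof -
  have "lipschitz d (\<lambda>x. complex_of_real (bump d c \<rho> g x))"
    unfolding lipschitz_def of_real_diff[symmetric] norm_of_real
    by (intro exI[of _ "1 / g"] ballI bump_lipschitz assms)
  moreover have "compact (supp d (\<lambda>x. complex_of_real (bump d c \<rho> g x)))"
  proof -
    have sub: "{x \<in> Rd d. complex_of_real (bump d c \<rho> g x) \<noteq> 0} \<subseteq> {x \<in> Rd d. vnorm d (x - c) \<le> \<rho> + g}"
    proof
      fix x assume "x \<in> {x \<in> Rd d. complex_of_real (bump d c \<rho> g x) \<noteq> 0}"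
      then show "x \<in> {x \<in> Rd d. vnorm d (x - c) \<le> \<rho> + g}"
        using bump_eq_0[OF assms, of \<rho> d x c] by fastforce
    qed
    have "supp d (\<lambda>x. complex_of_real (bump d c \<rho> g x)) \<subseteq> {x \<in> Rd d. vnorm d (x - c) \<le> \<rho> + g}"
      unfolding supp_def by (intro closure_minimal sub compact_imp_closed compact_closed_ball)
    then show ?thesis
      using compact_Int_closed[OF compact_closed_ball[of d c "\<rho> + g"], of "supp d (\<lambda>x. complex_of_real (bump d c \<rho> g x))"]
      unfolding supp_def by (simp add: Int_absorb1)
  qed
  ultimately show ?thesis by (simp add: Lip0_def)
qed

lemma supp_bounded:
  assumes "f \<in> Lip0 d"
  obtains R where "0 < R" "\<And>x. x \<in> supp d f \<Longrightarrow> vnorm d x < R"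
proof -
  have "compact (vnorm d ` supp d f)"
    using assms by (intro compact_continuous_image continuous_on_vnorm0) (simp add: Lip0_def)
  then have "bounded (vnorm d ` supp d f)" by (rule compact_imp_bounded)
  then obtain a where "\<forall>x\<in>supp d f. norm (vnorm d x) \<le> a"
    by (auto simp: bounded_iff)
  then show ?thesis
    by (intro that[of "\<bar>a\<bar> + 1"]) (fastforce simp: abs_le_iff)+
qed

lemma in_supp: "x \<in> Rd d \<Longrightarrow> f x \<noteq> 0 \<Longrightarrow> x \<in> supp d f"
  unfolding supp_def by (rule subsetD[OF closure_subset]) simp

lemma Lip0E:
  assumes "f \<in> Lip0 d"
  obtains L M R where "0 \<le> L" "0 \<le> M" "0 < R"
    "\<And>x y. x \<in> Rd d \<Longrightarrow> y \<in> Rd d \<Longrightarrow> cmod (f x - f y) \<le> L * vnorm d (x - y)"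
    "\<And>x. x \<in> Rd d \<Longrightarrow> cmod (f x) \<le> M"
    "\<And>x. x \<in> Rd d \<Longrightarrow> x \<notin> rball d 0 R \<Longrightarrow> f x = 0"
proof -
  obtain R where R: "0 < R" "\<And>x. x \<in> supp d f \<Longrightarrow> vnorm d x < R"
    using supp_bounded[OF assms] by blast
  obtain L where L: "\<And>x y. x \<in> Rd d \<Longrightarrow> y \<in> Rd d \<Longrightarrow> cmod (f x - f y) \<le> L * vnorm d (x - y)"
    using assms by (auto simp: Lip0_def lipschitz_def)
  have L': "cmod (f x - f y) \<le> \<bar>L\<bar> * vnorm d (x - y)" if "x \<in> Rd d" "y \<in> Rd d" for x y
    using L[OF that] by (smt (verit) mult_right_mono vnorm_nonneg)
  have f0: "f x = 0" if "x \<in> Rd d" "x \<notin> rball d 0 R" for x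
    using R(2) in_supp[of x d f] that by (auto simp: rball_def)
  have "cmod (f x) \<le> cmod (f 0) + \<bar>L\<bar> * R" if x: "x \<in> Rd d" for x
  proof (cases "x \<in> rball d 0 R")
    case True
    then have "\<bar>L\<bar> * vnorm d x \<le> \<bar>L\<bar> * R"
      by (intro mult_left_mono) (auto simp: rball_def)
    moreover have "cmod (f x - f 0) \<le> \<bar>L\<bar> * vnorm d x"
      using L'[OF x Rd_zero] by simp
    ultimately show ?thesis
      using norm_triangle_sub[of "f x" "f 0"] by linarith
  next
    case False
    then show ?thesis using f0[OF x] R(1) by simp
  qed
  with L' f0 R(1) show ?thesis
    by (intro that[of "\<bar>L\<bar>" "cmod (f 0) + \<bar>L\<bar> * R" R]) auto
qed

lemma lipschitz_continuous_on:
  assumes "lipschitz d f" shows "continuous_on (Rd d) f"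
proof -
  obtain L where L: "\<And>x y. x \<in> Rd d \<Longrightarrow> y \<in> Rd d \<Longrightarrow> cmod (f x - f y) \<le> L * vnorm d (x - y)"
    using assms by (auto simp: lipschitz_def)
  show ?thesis
    by (rule holder_continuous_on[of 1 d f L]) (use L in auto)
qed

lemma Lip0_diff_scale:
  assumes "f \<in> Lip0 d" "h \<in> Lip0 d"
  shows "(\<lambda>x. f x - c * h x) \<in> Lip0 d"
proof -
  obtain L where f: "\<And>x y. x \<in> Rd d \<Longrightarrow> y \<in> Rd d \<Longrightarrow> cmod (f x - f y) \<le> L * vnorm d (x - y)"
    using assms(1) by (auto simp: Lip0_def lipschitz_def)
  obtain L' where h: "\<And>x y. x \<in> Rd d \<Longrightarrow> y \<in> Rd d \<Longrightarrow> cmod (h x - h y) \<le> L' * vnorm d (x - y)"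
    using assms(2) by (auto simp: Lip0_def lipschitz_def)
  have "cmod ((f x - c * h x) - (f y - c * h y)) \<le> (L + cmod c * L') * vnorm d (x - y)"
    if "x \<in> Rd d" "y \<in> Rd d" for x y
  proof -
    have "(f x - c * h x) - (f y - c * h y) = (f x - f y) - c * (h x - h y)"
      by (simp add: algebra_simps)
    then have "cmod ((f x - c * h x) - (f y - c * h y)) \<le> cmod (f x - f y) + cmod (c * (h x - h y))"
      by (metis norm_triangle_ineq4)
    also have "\<dots> \<le> L * vnorm d (x - y) + cmod c * (L' * vnorm d (x - y))"
      using f h that by (intro add_mono) (auto simp: norm_mult intro!: mult_left_mono)
    finally show ?thesis by (simp add: algebra_simps)
  qed
  then have "lipschitz d (\<lambda>x. f x - c * h x)"
    unfolding lipschitz_def by blast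
  moreover have "compact (supp d (\<lambda>x. f x - c * h x))"
  proof -
    have "supp d (\<lambda>x. f x - c * h x) \<subseteq> supp d f \<union> supp d h"
      unfolding supp_def closure_Un[symmetric] by (intro closure_mono) auto
    moreover have "closed (supp d (\<lambda>x. f x - c * h x))" "compact (supp d f \<union> supp d h)"
      using assms by (auto simp: Lip0_def supp_def intro: compact_Un)
    ultimately show ?thesis
      using compact_Int_closed[of "supp d f \<union> supp d h" "supp d (\<lambda>x. f x - c * h x)"]
      by (simp add: Int_absorb1)
  qed
  ultimately show ?thesis by (simp add: Lip0_def)
qed

text \<open>\<open>form_ext\<close> selects its cutoff with SOME; existence makes the selected
  function a genuine one. The strict bound on the norm over the support leaves room for an open set
  on which the bump is 1.\<close>

lemma cutoff_exists:
  assumes "f \<in> Lip0 d"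
  shows "\<exists>\<psi>. cutoff d f \<psi>"
proof -
  obtain R where R: "0 < R" "\<And>x. x \<in> supp d f \<Longrightarrow> vnorm d x < R"
    using supp_bounded[OF assms] by blast
  have "open {x. vnorm d x < R}"
    by (intro open_Collect_less continuous_on_vnorm0 continuous_intros)
  moreover have "bump d 0 R 1 x = 1" if "vnorm d x < R" for x
    using that by (intro bump_eq_1) auto
  ultimately have "cutoff d f (\<lambda>x. complex_of_real (bump d 0 R 1 x))"
    unfolding cutoff_def using R
    by (intro conjI bump_in_Lip0 exI[of _ "{x. vnorm d x < R}"]) auto
  then show ?thesis by blast
qed

subsection \<open>Regularised kernels\<close>

text \<open>Scaling by \<open>a\<close> reduces the claim to 1 - (1+u)^{-p} \<le> (1+p) u^\<alpha>.
  For u \<ge> 1 the left side is at most 1; for u < 1 it is at most p ln(1+u) \<le> p u \<le> p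
  u^\<alpha>.\<close>

lemma powr_increment_bound:
  fixes a b p \<alpha> :: real
  assumes "0 < a" "a \<le> b" "0 < p" "0 < \<alpha>" "\<alpha> \<le> 1"
  shows "a powr \<alpha> * (a powr (- p) - b powr (- p)) \<le> (1 + p) * (b - a) powr \<alpha> * a powr (- p)"
proof -
  define u where "u = (b - a) / a"
  have u: "0 \<le> u" using assms by (simp add: u_def)
  have b: "b = a * (1 + u)" and ba: "b - a = a * u"
    using assms by (auto simp: u_def field_simps)
  have key: "1 - (1 + u) powr (- p) \<le> (1 + p) * u powr \<alpha>"
  proof (cases "u \<ge> 1")
    case True
    have "1 \<le> u powr \<alpha>" using True assms by (simp add: ge_one_powr_ge_zero)
    also have "\<dots> \<le> (1 + p) * u powr \<alpha>" using assms by (simp add: distrib_right)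
    finally show ?thesis using powr_ge_zero[of "1 + u" "- p"] by linarith
  next
    case False
    have "1 + (- p * ln (1 + u)) \<le> exp (- p * ln (1 + u))" by (rule exp_ge_add_one_self)
    also have "\<dots> = (1 + u) powr (- p)" using u by (simp add: powr_def)
    finally have "1 - (1 + u) powr (- p) \<le> p * ln (1 + u)" by simp
    also have "\<dots> \<le> p * u" using assms u ln_add_one_self_le_self[of u] by (intro mult_left_mono) auto
    also have "u \<le> u powr \<alpha>"
    proof (cases "u = 0")
      case False
      then have "u powr 1 \<le> u powr \<alpha>" using u \<open>\<not> 1 \<le> u\<close> assms by (intro powr_mono') auto
      then show ?thesis using u by simp
    qed simp
    then have "p * u \<le> p * u powr \<alpha>" using assms by (intro mult_left_mono) auto
    also have "\<dots> \<le> (1 + p) * u powr \<alpha>" by (simp add: distrib_right)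
    finally show ?thesis .
  qed
  have "a powr \<alpha> * (a powr (- p) - b powr (- p)) = a powr \<alpha> * a powr (- p) * (1 - (1 + u) powr (- p))"
    unfolding b by (subst powr_mult) (simp add: algebra_simps)
  also have "\<dots> \<le> a powr \<alpha> * a powr (- p) * ((1 + p) * u powr \<alpha>)"
    using key by (intro mult_left_mono) auto
  also have "\<dots> = (1 + p) * (b - a) powr \<alpha> * a powr (- p)"
    unfolding ba powr_mult by simp
  finally show ?thesis .
qed

text \<open>Scalar kernels, so that one theory serves both the components of a vector-valued kernel
  and its product with a unit vector. The number \<open>B\<close> bounds the Hoelder seminorm of the
  function named \<open>F\<close> below.\<close>

locale holder_kernel =
  fixes d :: nat and s \<alpha> B :: real and k :: "point \<Rightarrow> complex"
  assumes s_pos: "0 < s" and \<alpha>_pos: "0 < \<alpha>" and \<alpha>_le_1: "\<alpha> \<le> 1" and B_nonneg: "0 \<le> B"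
    and k_bound: "\<And>x. x \<in> Rd d \<Longrightarrow> x \<noteq> 0 \<Longrightarrow> cmod (k x) \<le> vnorm d x powr (- s)"
    and k_odd: "\<And>x. x \<in> Rd d \<Longrightarrow> x \<noteq> 0 \<Longrightarrow> k (- x) = - k x"
    and k_holder: "\<And>x y. x \<in> Rd d \<Longrightarrow> y \<in> Rd d \<Longrightarrow>
      cmod ((if x = 0 then 0 else k x * complex_of_real (vnorm d x powr (s + \<alpha>)))
        - (if y = 0 then 0 else k y * complex_of_real (vnorm d y powr (s + \<alpha>))))
      \<le> B * vnorm d (x - y) powr \<alpha>"
begin

text \<open>
  \<open>kr\<close> and \<open>kl\<close> are $K_\delta$ and $K^\delta$ for a scalar kernel, and
  $K_\delta(x) = F(x) \max(\delta,|x|)^{-s-\alpha}$.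
\<close>

definition F :: "point \<Rightarrow> complex" where
  "F x = (if x = 0 then 0 else k x * complex_of_real (vnorm d x powr (s + \<alpha>)))"

definition kr :: "real \<Rightarrow> point \<Rightarrow> complex" where
  "kr \<delta> x = (if x = 0 then 0
     else k x * complex_of_real ((vnorm d x / max \<delta> (vnorm d x)) powr (s + \<alpha>)))"

definition kl :: "real \<Rightarrow> point \<Rightarrow> complex" where
  "kl \<delta> x = k x - kr \<delta> x"

lemma F_holder: "x \<in> Rd d \<Longrightarrow> y \<in> Rd d \<Longrightarrow> cmod (F x - F y) \<le> B * vnorm d (x - y) powr \<alpha>"
  using k_holder[of x y] unfolding F_def .

lemma F_bound: "x \<in> Rd d \<Longrightarrow> cmod (F x) \<le> vnorm d x powr \<alpha>"
proof (cases "x = 0")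
  case False
  assume x: "x \<in> Rd d"
  have "cmod (F x) = cmod (k x) * vnorm d x powr (s + \<alpha>)"
    using False by (simp add: F_def norm_mult)
  also have "\<dots> \<le> vnorm d x powr (- s) * vnorm d x powr (s + \<alpha>)"
    using k_bound[OF x False] by (intro mult_right_mono) auto
  also have "\<dots> = vnorm d x powr \<alpha>"
    by (simp add: powr_add[symmetric])
  finally show ?thesis .
qed (simp add: F_def)

lemma kr_eq_F: "kr \<delta> x = F x * complex_of_real (max \<delta> (vnorm d x) powr (- (s + \<alpha>)))"
  unfolding kr_def F_def powr_divide powr_minus_divide by simp

lemma F_continuous: "continuous_on (Rd d) F"
  by (rule holder_continuous_on[OF \<alpha>_pos F_holder])

lemma kr_continuous:
  assumes "0 < \<delta>" shows "continuous_on (Rd d) (kr \<delta>)"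
proof -
  have "continuous_on (Rd d) (\<lambda>x. F x * complex_of_real (max \<delta> (vnorm d x) powr (- (s + \<alpha>))))"
    using assms by (intro continuous_intros F_continuous continuous_on_vnorm0) (auto simp: max_def)
  then show ?thesis using kr_eq_F by simp
qed

lemma kr_odd: "x \<in> Rd d \<Longrightarrow> kr \<delta> (- x) = - kr \<delta> x"
  by (simp add: kr_def k_odd)

lemma kl_odd: "x \<in> Rd d \<Longrightarrow> x \<noteq> 0 \<Longrightarrow> kl \<delta> (- x) = - kl \<delta> x"
  by (simp add: kl_def kr_odd k_odd)

lemma kr_bound:
  assumes "0 < \<delta>" "x \<in> Rd d"
  shows "cmod (kr \<delta> x) \<le> max \<delta> (vnorm d x) powr (- s)"
proof -
  let ?m = "max \<delta> (vnorm d x)"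
  have "cmod (kr \<delta> x) = cmod (F x) * ?m powr (- (s + \<alpha>))"
    using assms by (simp add: kr_eq_F norm_mult)
  also have "\<dots> \<le> ?m powr \<alpha> * ?m powr (- (s + \<alpha>))"
    using F_bound[OF assms(2)] \<alpha>_pos powr_mono2[of \<alpha> "vnorm d x" ?m]
    by (intro mult_right_mono) auto
  also have "\<dots> = ?m powr (- s)" by (simp add: powr_add[symmetric])
  finally show ?thesis .
qed

lemma kr_bound':
  assumes "0 < \<delta>" "x \<in> Rd d" "0 < t" "t \<le> max \<delta> (vnorm d x)"
  shows "cmod (kr \<delta> x) \<le> t powr (- s)"
  using kr_bound[OF assms(1,2)] powr_mono2'[of "- s" t "max \<delta> (vnorm d x)"] assms s_pos by linarith

text \<open>A product estimate for \<open>F\<close> times the power of m = max(\<delta>, norm),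
  based at the point with the smaller m: the increment of \<open>F\<close> contributes B, the
  increment of the power contributes 1 + (s + \<alpha>) by \<open>powr_increment_bound\<close>. The
  sum over both points on the right spares later users the question which m is smaller.\<close>

lemma kr_holder:
  assumes \<delta>: "0 < \<delta>" and x: "x \<in> Rd d" and y: "y \<in> Rd d"
  shows "cmod (kr \<delta> x - kr \<delta> y) \<le> (B + 1 + (s + \<alpha>)) * vnorm d (x - y) powr \<alpha> *
    (max \<delta> (vnorm d x) powr (- (s + \<alpha>)) + max \<delta> (vnorm d y) powr (- (s + \<alpha>)))"
proof -
  define m where "m x = max \<delta> (vnorm d x)" for x
  let ?p = "s + \<alpha>"
  have p: "0 < ?p" using s_pos \<alpha>_pos by simp
  have le: "cmod (kr \<delta> x - kr \<delta> y) \<le> (B + 1 + ?p) * vnorm d (x - y) powr \<alpha> * m x powr (- ?p)"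
    if x: "x \<in> Rd d" and y: "y \<in> Rd d" and mm: "m x \<le> m y" for x y
  proof -
    have mx: "0 < m x" "vnorm d x \<le> m x" using \<delta> by (auto simp: m_def)
    have "kr \<delta> x - kr \<delta> y = (F x - F y) * complex_of_real (m y powr (- ?p))
       + F x * complex_of_real (m x powr (- ?p) - m y powr (- ?p))"
      using \<delta> by (simp add: kr_eq_F m_def algebra_simps)
    then have "cmod (kr \<delta> x - kr \<delta> y) \<le> cmod ((F x - F y) * complex_of_real (m y powr (- ?p)))
       + cmod (F x * complex_of_real (m x powr (- ?p) - m y powr (- ?p)))"
      by (metis norm_triangle_ineq)
    also have "\<dots> = cmod (F x - F y) * m y powr (- ?p) + cmod (F x) * (m x powr (- ?p) - m y powr (- ?p))"
      using powr_mono2'[of "- ?p" "m x" "m y"] p mm mx by (simp add: norm_mult del: of_real_diff)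
    also have "\<dots> \<le> (B * vnorm d (x - y) powr \<alpha>) * m x powr (- ?p) + m x powr \<alpha> * (m x powr (- ?p) - m y powr (- ?p))"
    proof (intro add_mono mult_mono)
      show "cmod (F x) \<le> m x powr \<alpha>"
        using F_bound[OF x] powr_mono2[of \<alpha> "vnorm d x" "m x"] \<alpha>_pos mx by simp
      show *: "m y powr (- ?p) \<le> m x powr (- ?p)" using powr_mono2'[of "- ?p" "m x" "m y"] p mm mx by simp
      show "0 \<le> m x powr (- ?p) - m y powr (- ?p)" using * by simp
    qed (use F_holder[OF x y] B_nonneg in auto)
    finally have le1: "cmod (kr \<delta> x - kr \<delta> y) \<le> (B * vnorm d (x - y) powr \<alpha>) * m x powr (- ?p)
      + m x powr \<alpha> * (m x powr (- ?p) - m y powr (- ?p))" .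
    have "m x powr \<alpha> * (m x powr (- ?p) - m y powr (- ?p)) \<le> (1 + ?p) * (m y - m x) powr \<alpha> * m x powr (- ?p)"
      using p \<alpha>_pos \<alpha>_le_1 mm mx by (intro powr_increment_bound) auto
    also have "\<dots> \<le> (1 + ?p) * vnorm d (x - y) powr \<alpha> * m x powr (- ?p)"
    proof (intro mult_right_mono mult_left_mono powr_mono2)
      show "m y - m x \<le> vnorm d (x - y)"
        using vnorm_diff_abs[of d x y] by (auto simp: m_def max_def)
    qed (use p \<alpha>_pos mm in auto)
    finally show ?thesis using le1 by (simp only: distrib_right mult.assoc mult_1)
  qed
  let ?C = "(B + 1 + ?p) * vnorm d (x - y) powr \<alpha>"
  have C: "0 \<le> ?C" using B_nonneg p by simp
  have "cmod (kr \<delta> x - kr \<delta> y) \<le> ?C * (m x powr (- ?p) + m y powr (- ?p))"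
  proof (cases "m x \<le> m y")
    case True
    have "?C * m x powr (- ?p) \<le> ?C * (m x powr (- ?p) + m y powr (- ?p))"
      by (intro mult_left_mono C) auto
    then show ?thesis using le[OF x y True] by linarith
  next
    case False
    have "cmod (kr \<delta> x - kr \<delta> y) \<le> ?C * m y powr (- ?p)"
      using le[OF y x] False by (simp add: norm_minus_commute vnorm_commute)
    also have "\<dots> \<le> ?C * (m x powr (- ?p) + m y powr (- ?p))"
      by (intro mult_left_mono C) auto
    finally show ?thesis .
  qed
  then show ?thesis by (simp add: m_def)
qed

lemma kl_bound:
  assumes "0 < \<delta>" "x \<in> Rd d" "x \<noteq> 0"
  shows "cmod (kl \<delta> x) \<le> (if vnorm d x < \<delta> then vnorm d x powr (- s) else 0)"
proof -
  let ?t = "(vnorm d x / max \<delta> (vnorm d x)) powr (s + \<alpha>)"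
  have "kl \<delta> x = k x * complex_of_real (1 - ?t)"
    using assms by (simp add: kl_def kr_def algebra_simps)
  then have eq: "cmod (kl \<delta> x) = cmod (k x) * \<bar>1 - ?t\<bar>" by (simp add: norm_mult del: of_real_diff)
  show ?thesis
  proof (cases "vnorm d x < \<delta>")
    case True
    have "?t \<le> 1 powr (s + \<alpha>)"
      using s_pos \<alpha>_pos assms True by (intro powr_mono2) (auto simp: field_simps max_def)
    then have "\<bar>1 - ?t\<bar> \<le> 1" by (simp add: abs_le_iff)
    then have "cmod (k x) * \<bar>1 - ?t\<bar> \<le> cmod (k x)" by (simp add: mult_left_le)
    then show ?thesis using eq True k_bound[OF assms(2,3)] by simp
  next
    case False
    then have "?t = 1" using vnorm_pos[OF assms(2,3)] by (simp add: max_def)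
    then show ?thesis using eq False by simp
  qed
qed

end

subsection \<open>Nice measures\<close>

locale nice_measure =
  fixes d :: nat and s \<Lambda> :: real and \<mu> :: "point measure"
  assumes exponent_pos: "0 < s" and \<Lambda>_pos: "0 < \<Lambda>"
    and rd: "rd_measure d \<mu>" and nice: "nice d s \<Lambda> \<mu>"
begin

lemma sets_\<mu>: "sets \<mu> = sets (restrict_space borel (Rd d))"
  using rd by (simp add: rd_measure_def)

lemma space_\<mu>: "space \<mu> = Rd d"
  using sets_eq_imp_space_eq[OF sets_\<mu>] by (simp add: space_restrict_space)

lemma measurable_\<mu>: "measurable \<mu> N = measurable (restrict_space borel (Rd d)) N"
  by (intro measurable_cong_sets sets_\<mu> refl)

lemma continuous_measurable:
  fixes f :: "point \<Rightarrow> 'b::topological_space"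
  shows "continuous_on (Rd d) f \<Longrightarrow> f \<in> borel_measurable \<mu>"
  unfolding measurable_\<mu> by (rule borel_measurable_continuous_on_restrict)

lemma rball_sets [measurable]: "rball d x r \<in> sets \<mu>"
proof -
  have "open {y. vnorm d (y - x) < r}"
    by (intro open_Collect_less continuous_on_vnorm continuous_on_const)
  then have "Rd d \<inter> {y. vnorm d (y - x) < r} \<in> sets (restrict_space borel (Rd d))"
    unfolding sets_restrict_space by (intro imageI borel_open)
  moreover have "rball d x r = Rd d \<inter> {y. vnorm d (y - x) < r}"
    by (auto simp: rball_def)
  ultimately show ?thesis by (simp add: sets_\<mu>)
qed

lemma id_measurable: "(\<lambda>x. x) \<in> borel_measurable \<mu>"
  by (intro continuous_measurable continuous_on_id)

text \<open>The difference is measurable into \<open>\<mu>\<close> and not merely into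
  \<open>borel\<close>, so that functions known to be measurable on \<open>Rd d\<close> only, such
  as the kernels, can be composed with it.\<close>

lemma diff_measurable [measurable (raw)]:
  assumes "f \<in> measurable N \<mu>" "g \<in> measurable N \<mu>"
  shows "(\<lambda>x. f x - g x :: point) \<in> measurable N \<mu>"
proof -
  have f: "f \<in> borel_measurable N" "g \<in> borel_measurable N"
    using measurable_compose[OF assms(1) id_measurable] measurable_compose[OF assms(2) id_measurable] by auto
  have "(\<lambda>x. f x - g x) \<in> borel_measurable N"
  proof (rule measurable_coordinatewise_then_product)
    fix i
    show "(\<lambda>x. (f x - g x) i) \<in> borel_measurable N"
      using measurable_product_then_coordinatewise[OF f(1), of i] measurable_product_then_coordinatewise[OF f(2), of i]
      by simp
  qed
  moreover have "(\<lambda>x. f x - g x) \<in> space N \<rightarrow> Rd d"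
    using measurable_space[OF assms(1)] measurable_space[OF assms(2)] by (auto simp: space_\<mu>)
  ultimately have "(\<lambda>x. f x - g x) \<in> measurable N (restrict_space borel (Rd d))"
    by (intro measurable_restrict_space2)
  then show ?thesis
    using measurable_cong_sets[OF refl sets_\<mu>] by blast
qed

lemma vnorm_measurable [measurable]: "vnorm d \<in> borel_measurable \<mu>"
  by (intro continuous_measurable continuous_on_vnorm0)

lemma emeasure_rball:
  assumes "x \<in> Rd d" "0 < r" shows "emeasure \<mu> (rball d x r) \<le> ennreal (\<Lambda> * r powr s)"
  using nice assms by (simp add: nice_def)

lemma emeasure_rball_finite [simp]:
  assumes "x \<in> Rd d" shows "emeasure \<mu> (rball d x r) < \<infinity>"
proof -
  have "emeasure \<mu> (rball d x r) \<le> emeasure \<mu> (rball d x (max r 1))"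
    by (intro emeasure_mono rball_mono) auto
  also have "\<dots> \<le> ennreal (\<Lambda> * max r 1 powr s)"
    using assms by (intro emeasure_rball) auto
  finally show ?thesis by (simp add: le_less_trans)
qed

lemma measure_rball:
  assumes "x \<in> Rd d" "0 < r" shows "measure \<mu> (rball d x r) \<le> \<Lambda> * r powr s"
  using emeasure_rball[OF assms] \<Lambda>_pos emeasure_rball_finite[OF assms(1), of r]
  by (simp add: emeasure_eq_ennreal_measure)

lemma sigma_finite: "sigma_finite_measure \<mu>"
proof
  have "(\<Union>n. rball d 0 (real n)) = Rd d"
    using reals_Archimedean2 by (auto simp: rball_def)
  then show "\<exists>A. countable A \<and> A \<subseteq> sets \<mu> \<and> \<Union>A = space \<mu> \<and> (\<forall>a\<in>A. emeasure \<mu> a \<noteq> \<infinity>)"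
    using emeasure_rball_finite[OF Rd_zero] rball_sets
    by (intro exI[of _ "range (\<lambda>n. rball d 0 (real n))"]) (auto simp: space_\<mu> less_top[symmetric])
qed

sublocale pair_sigma_finite \<mu> \<mu>
  unfolding pair_sigma_finite_def using sigma_finite by simp

text \<open>The common frame of the dyadic estimates. Pointwise \<open>w\<close> is at most the sum
  of all \<open>c k\<close> times the indicator of \<open>A k\<close>, whatever the overlaps, and
  the integrated sum is dominated by a geometric series.\<close>

lemma nn_integral_shells:
  fixes w :: "point \<Rightarrow> ennreal" and c :: "nat \<Rightarrow> real"
  assumes A: "\<And>k. A k \<in> sets \<mu>"
    and w: "\<And>y. y \<in> Rd d \<Longrightarrow> w y = 0 \<or> (\<exists>k. y \<in> A k \<and> w y \<le> ennreal (c k))"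
    and c: "\<And>k. ennreal (c k) * emeasure \<mu> (A k) \<le> ennreal (C * q ^ k)"
    and "0 \<le> q" "q < 1" "0 \<le> C"
  shows "(\<integral>\<^sup>+y. w y \<partial>\<mu>) \<le> ennreal (C / (1 - q))"
proof -
  have "(\<integral>\<^sup>+y. w y \<partial>\<mu>) \<le> (\<integral>\<^sup>+y. (\<Sum>k. ennreal (c k) * indicator (A k) y) \<partial>\<mu>)"
  proof (rule nn_integral_mono)
    fix y assume "y \<in> space \<mu>"
    then consider "w y = 0" | j where "y \<in> A j" "w y \<le> ennreal (c j)"
      using w[of y] by (auto simp: space_\<mu>)
    then show "w y \<le> (\<Sum>k. ennreal (c k) * indicator (A k) y)"
    proof cases
      case (2 j)
      have "w y \<le> (\<Sum>k\<in>{j}. ennreal (c k) * indicator (A k) y)" using 2 by simp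
      also have "\<dots> \<le> (\<Sum>k. ennreal (c k) * indicator (A k) y)"
        by (intro sum_le_suminf) auto
      finally show ?thesis .
    qed simp
  qed
  also have "\<dots> = (\<Sum>k. ennreal (c k) * emeasure \<mu> (A k))"
    using A by (simp add: nn_integral_suminf nn_integral_cmult_indicator)
  also have "\<dots> \<le> (\<Sum>k. ennreal (C * q ^ k))"
    by (intro suminf_le c) auto
  also have "\<dots> = ennreal (\<Sum>k. C * q ^ k)"
    using assms by (intro suminf_ennreal2 summable_mult summable_geometric) auto
  also have "(\<Sum>k. C * q ^ k) = C / (1 - q)"
    using assms by (simp add: suminf_mult suminf_geometric summable_geometric)
  finally show ?thesis .
qed

lemma near_integral:
  assumes x: "x \<in> Rd d" and \<delta>: "0 < \<delta>"
  shows "(\<integral>\<^sup>+y. ennreal (if vnorm d (y - x) < \<delta> then vnorm d (y - x) powr (1 - s) else 0) \<partial>\<mu>)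
    \<le> ennreal (2 powr (s + 1) * \<Lambda> * \<delta>)"
proof -
  \<comment> \<open>On a dyadic shell t^{1-s} = t t^{-s} is bounded by the outer radius in the first
    factor and the inner radius in the second, which avoids distinguishing s < 1 from s > 1.\<close>
  define c where "c k = (\<delta> / 2 ^ k) * (\<delta> / 2 ^ Suc k) powr (- s)" for k :: nat
  have "(\<integral>\<^sup>+y. ennreal (if vnorm d (y - x) < \<delta> then vnorm d (y - x) powr (1 - s) else 0) \<partial>\<mu>)
    \<le> ennreal (2 powr s * \<Lambda> * \<delta> / (1 - 1 / 2))"
  proof (rule nn_integral_shells[where A = "\<lambda>k. rball d x (\<delta> / 2 ^ k)" and c = c])
    fix y assume y: "y \<in> Rd d"
    let ?t = "vnorm d (y - x)"
    show "ennreal (if ?t < \<delta> then ?t powr (1 - s) else 0) = 0 \<or>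
      (\<exists>k. y \<in> rball d x (\<delta> / 2 ^ k) \<and> ennreal (if ?t < \<delta> then ?t powr (1 - s) else 0) \<le> ennreal (c k))"
    proof (cases "0 < ?t \<and> ?t < \<delta>")
      case True
      have "\<exists>n. \<delta> / 2 ^ n \<le> ?t"
      proof -
        obtain n where "\<delta> / ?t < 2 ^ n" using real_arch_pow[of 2 "\<delta> / ?t"] by auto
        then show ?thesis using True by (intro exI[of _ n]) (simp add: field_simps)
      qed
      then obtain n where n: "\<delta> / 2 ^ n \<le> ?t" "\<And>m. m < n \<Longrightarrow> \<not> \<delta> / 2 ^ m \<le> ?t"
        using exists_least_iff[of "\<lambda>n. \<delta> / 2 ^ n \<le> ?t"] by auto
      then obtain k where k: "n = Suc k" using True by (cases n) auto
      have lt: "?t < \<delta> / 2 ^ k" using n(2)[of k] k by simp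
      have "?t powr (1 - s) = ?t * ?t powr (- s)"
        using True powr_add[of ?t 1 "- s"] by simp
      also have "\<dots> \<le> c k"
        unfolding c_def using True lt n(1) k exponent_pos \<delta>
        by (intro mult_mono powr_mono2') auto
      finally show ?thesis using lt y by (intro disjI2 exI[of _ k]) (auto simp: rball_def ennreal_leI)
    next
      case False
      \<comment> \<open>The point y = x lies in no shell; there the weight is 0 by the convention
        \<open>0 powr a = 0\<close>.\<close>
      then have "?t = 0 \<or> \<not> ?t < \<delta>" using vnorm_nonneg[of d "y - x"] by linarith
      then show ?thesis by auto
    qed
  next
    fix k :: nat
    have pos: "0 < \<delta> / 2 ^ k" using \<delta> by simp
    have "ennreal (c k) * emeasure \<mu> (rball d x (\<delta> / 2 ^ k)) \<le> ennreal (c k) * ennreal (\<Lambda> * (\<delta> / 2 ^ k) powr s)"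
      by (intro mult_left_mono emeasure_rball x pos) auto
    also have "\<dots> = ennreal (c k * (\<Lambda> * (\<delta> / 2 ^ k) powr s))"
      using \<delta> \<Lambda>_pos by (subst ennreal_mult) (auto simp: c_def)
    also have "c k * (\<Lambda> * (\<delta> / 2 ^ k) powr s) = 2 powr s * \<Lambda> * \<delta> * (1 / 2) ^ k"
    proof -
      have "(\<delta> / 2 ^ Suc k) powr (- s) = (\<delta> / 2 ^ k) powr (- s) * 2 powr s"
        using pos powr_divide[of "\<delta> / 2 ^ k" 2 "- s"] by (simp add: powr_minus field_simps)
      moreover have "(\<delta> / 2 ^ k) powr (- s) * (\<delta> / 2 ^ k) powr s = 1"
        using pos \<delta> by (simp add: powr_add[symmetric])
      ultimately show ?thesis unfolding c_def by (simp add: field_simps)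
    qed
    finally show "ennreal (c k) * emeasure \<mu> (rball d x (\<delta> / 2 ^ k)) \<le> ennreal (2 powr s * \<Lambda> * \<delta> * (1 / 2) ^ k)" .
  qed (use \<delta> \<Lambda>_pos in auto)
  also have "2 powr s * \<Lambda> * \<delta> / (1 - 1 / 2) = 2 powr (s + 1) * \<Lambda> * \<delta>"
    by (simp add: powr_add)
  finally show ?thesis .
qed

text \<open>The shell of radius 2^k \<delta> carries a weight of order (2^k \<delta>)^{-s-\<alpha>}
  and a measure of at most \<Lambda> (2^k \<delta>)^s; what remains, (2^k \<delta>)^{-\<alpha>}, is
  summable. For k = 0 the shell is the full ball, where the maximum supplies the lower bound
  \<delta>.\<close>

lemma far_integral:
  assumes x: "x \<in> Rd d" and \<delta>: "0 < \<delta>" and \<alpha>: "0 < \<alpha>"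
  shows "(\<integral>\<^sup>+y. ennreal (max \<delta> (vnorm d (y - x)) powr (- (s + \<alpha>))) \<partial>\<mu>)
    \<le> ennreal (2 powr (s + \<alpha>) / (1 - 2 powr (- \<alpha>)) * \<Lambda> * \<delta> powr (- \<alpha>))"
proof -
  let ?p = "s + \<alpha>"
  define c where "c k = (2 ^ k * \<delta> / 2) powr (- ?p)" for k :: nat
  have "(\<integral>\<^sup>+y. ennreal (max \<delta> (vnorm d (y - x)) powr (- ?p)) \<partial>\<mu>)
    \<le> ennreal (2 powr ?p * \<Lambda> * \<delta> powr (- \<alpha>) / (1 - 2 powr (- \<alpha>)))"
  proof (rule nn_integral_shells[where A = "\<lambda>k. rball d x (2 ^ k * \<delta>)" and c = c])
    fix y assume y: "y \<in> Rd d"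
    let ?t = "vnorm d (y - x)"
    have "\<exists>n. ?t < 2 ^ n * \<delta>"
    proof -
      obtain n where "?t / \<delta> < 2 ^ n" using real_arch_pow[of 2 "?t / \<delta>"] by auto
      then show ?thesis using \<delta> by (intro exI[of _ n]) (simp add: field_simps)
    qed
    then obtain n where n: "?t < 2 ^ n * \<delta>" "\<And>m. m < n \<Longrightarrow> \<not> ?t < 2 ^ m * \<delta>"
      using exists_least_iff[of "\<lambda>n. ?t < 2 ^ n * \<delta>"] by auto
    have "2 ^ n * \<delta> / 2 \<le> max \<delta> ?t"
    proof (cases n)
      case (Suc m)
      then show ?thesis using n(2)[of m] by simp
    qed (use \<delta> in simp)
    then have "max \<delta> ?t powr (- ?p) \<le> c n"
      unfolding c_def using \<delta> \<alpha> exponent_pos by (intro powr_mono2') auto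
    then show "ennreal (max \<delta> ?t powr (- ?p)) = 0 \<or>
      (\<exists>k. y \<in> rball d x (2 ^ k * \<delta>) \<and> ennreal (max \<delta> ?t powr (- ?p)) \<le> ennreal (c k))"
      using n y by (intro disjI2 exI[of _ n]) (auto simp: rball_def ennreal_leI)
  next
    fix k :: nat
    have pos: "0 < 2 ^ k * \<delta>" using \<delta> by simp
    have "ennreal (c k) * emeasure \<mu> (rball d x (2 ^ k * \<delta>)) \<le> ennreal (c k) * ennreal (\<Lambda> * (2 ^ k * \<delta>) powr s)"
      by (intro mult_left_mono emeasure_rball x pos) auto
    also have "\<dots> = ennreal (c k * (\<Lambda> * (2 ^ k * \<delta>) powr s))"
      using \<delta> \<Lambda>_pos by (subst ennreal_mult) (auto simp: c_def)
    also have "c k * (\<Lambda> * (2 ^ k * \<delta>) powr s) = 2 powr ?p * \<Lambda> * \<delta> powr (- \<alpha>) * (2 powr (- \<alpha>)) ^ k"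
    proof -
      have "c k = (2 ^ k * \<delta>) powr (- ?p) / 2 powr (- ?p)"
        unfolding c_def by (rule powr_divide)
      also have "\<dots> = (2 ^ k * \<delta>) powr (- ?p) * 2 powr ?p"
        by (simp only: powr_minus divide_inverse inverse_inverse_eq)
      finally have "c k = (2 ^ k * \<delta>) powr (- ?p) * 2 powr ?p" .
      then have "c k * (\<Lambda> * (2 ^ k * \<delta>) powr s) = 2 powr ?p * \<Lambda> * ((2 ^ k * \<delta>) powr (- ?p) * (2 ^ k * \<delta>) powr s)"
        by simp
      also have "(2 ^ k * \<delta>) powr (- ?p) * (2 ^ k * \<delta>) powr s = (2 ^ k * \<delta>) powr (- \<alpha>)"
        by (simp add: powr_add[symmetric])
      also have "\<dots> = (2 powr (- \<alpha>)) ^ k * \<delta> powr (- \<alpha>)"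
        by (subst powr_mult) (simp add: powr_realpow[symmetric] powr_powr mult.commute)
      finally show ?thesis by (simp only: ac_simps)
    qed
    finally show "ennreal (c k) * emeasure \<mu> (rball d x (2 ^ k * \<delta>))
      \<le> ennreal (2 powr ?p * \<Lambda> * \<delta> powr (- \<alpha>) * (2 powr (- \<alpha>)) ^ k)" .
  qed (use \<Lambda>_pos \<alpha> in \<open>auto simp: powr_less_one\<close>)
  then show ?thesis by (simp add: algebra_simps)
qed

section \<open>Integrability of test functions and of functions of pairs\<close>

lemma Lip0_measurable: "f \<in> Lip0 d \<Longrightarrow> f \<in> borel_measurable \<mu>"
  by (intro continuous_measurable lipschitz_continuous_on) (simp add: Lip0_def)

lemma Lip0_integrable:
  assumes f: "f \<in> Lip0 d" shows "integrable \<mu> f"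
proof -
  obtain L M R where *: "0 \<le> M" "\<And>x. x \<in> Rd d \<Longrightarrow> cmod (f x) \<le> M"
    "\<And>x. x \<in> Rd d \<Longrightarrow> x \<notin> rball d 0 R \<Longrightarrow> f x = 0"
    by (rule Lip0E[OF f]) (rule that)
  have "integrable \<mu> (\<lambda>x. M * indicator (rball d 0 R) x :: real)"
    using emeasure_rball_finite[OF Rd_zero, of R] by (intro integrable_mult_right integrable_real_indicator) auto
  then show ?thesis
    by (rule Bochner_Integration.integrable_bound[OF _ Lip0_measurable[OF f]])
      (use * in \<open>auto simp: space_\<mu> indicator_def\<close>)
qed

text \<open>Tonelli with the inner integral bounded uniformly over a ball and vanishing outside it.
  The bound keeps the measure of the ball instead of estimating it by niceness: the iteration lives
  on comparing the measures of concentric balls.\<close>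

lemma pair_integrable:
  fixes h :: "point \<times> point \<Rightarrow> complex"
  assumes h [measurable]: "h \<in> borel_measurable (\<mu> \<Otimes>\<^sub>M \<mu>)" and c: "c \<in> Rd d" and C: "0 \<le> C"
    and le: "\<And>y. y \<in> Rd d \<Longrightarrow> (\<integral>\<^sup>+x. ennreal (cmod (h (x, y))) \<partial>\<mu>) \<le> ennreal C * indicator (rball d c R) y"
  shows "integrable (\<mu> \<Otimes>\<^sub>M \<mu>) h" and "cmod (integral\<^sup>L (\<mu> \<Otimes>\<^sub>M \<mu>) h) \<le> C * measure \<mu> (rball d c R)"
proof -
  have "(\<integral>\<^sup>+p. ennreal (cmod (h p)) \<partial>(\<mu> \<Otimes>\<^sub>M \<mu>)) = (\<integral>\<^sup>+y. (\<integral>\<^sup>+x. ennreal (cmod (h (x, y))) \<partial>\<mu>) \<partial>\<mu>)"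
    by (subst nn_integral_snd) auto
  also have "\<dots> \<le> (\<integral>\<^sup>+y. ennreal C * indicator (rball d c R) y \<partial>\<mu>)"
    by (intro nn_integral_mono le) (simp add: space_\<mu>)
  also have "\<dots> = ennreal C * emeasure \<mu> (rball d c R)"
    by (simp add: nn_integral_cmult_indicator)
  also have "\<dots> = ennreal (C * measure \<mu> (rball d c R))"
    using C emeasure_rball_finite[OF c, of R] by (simp add: emeasure_eq_ennreal_measure ennreal_mult)
  finally have le': "(\<integral>\<^sup>+p. ennreal (cmod (h p)) \<partial>(\<mu> \<Otimes>\<^sub>M \<mu>)) \<le> ennreal (C * measure \<mu> (rball d c R))" .
  show int: "integrable (\<mu> \<Otimes>\<^sub>M \<mu>) h"
    by (rule integrableI_bounded[OF h]) (use le' in \<open>simp add: le_less_trans\<close>)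
  have "ennreal (cmod (integral\<^sup>L (\<mu> \<Otimes>\<^sub>M \<mu>) h)) \<le> (\<integral>\<^sup>+p. ennreal (cmod (h p)) \<partial>(\<mu> \<Otimes>\<^sub>M \<mu>))"
    by (rule integral_norm_bound_ennreal[OF int])
  then have "ennreal (cmod (integral\<^sup>L (\<mu> \<Otimes>\<^sub>M \<mu>) h)) \<le> ennreal (C * measure \<mu> (rball d c R))"
    using le' by (rule order_trans)
  then show "cmod (integral\<^sup>L (\<mu> \<Otimes>\<^sub>M \<mu>) h) \<le> C * measure \<mu> (rball d c R)"
    using C by (subst (asm) ennreal_le_iff) auto
qed

end

subsection \<open>Kernels against nice measures\<close>

locale kernel_measure = nice_measure d s \<Lambda> \<mu> + holder_kernel d s \<alpha> B k
  for d s \<Lambda> \<mu> \<alpha> B k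
begin

text \<open>Together with \<open>C_far\<close> this is all that the final constant sees of kernel
  and measure. \<open>C_near\<close> is the constant of \<open>near_integral\<close>;
  \<open>C_far\<close> is the constant of \<open>kr_holder\<close> times that of
  \<open>far_integral\<close>.\<close>

definition C_near :: real where "C_near = 2 powr (s + 1) * \<Lambda>"

definition C_far :: real where
  "C_far = (B + 1 + (s + \<alpha>)) * (2 powr (s + \<alpha>) / (1 - 2 powr (- \<alpha>))) * \<Lambda>"

lemma C_near_pos: "0 < C_near"
  using \<Lambda>_pos by (simp add: C_near_def)

lemma C_far_pos: "0 < C_far"
  using \<Lambda>_pos B_nonneg s_pos \<alpha>_pos powr_less_one[of 2 "- \<alpha>"] by (simp add: C_far_def)

lemma kr_measurable [measurable]: "0 < \<delta> \<Longrightarrow> kr \<delta> \<in> borel_measurable \<mu>"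
  by (intro continuous_measurable kr_continuous)

text \<open>Away from 0 the kernel is recovered from the continuous function \<open>F\<close> by
  dividing out the power of the norm; the arbitrary value \<open>k 0\<close> is put in by
  hand.\<close>

lemma k_measurable [measurable]: "k \<in> borel_measurable \<mu>"
proof -
  have [measurable]: "F \<in> borel_measurable \<mu>"
    by (intro continuous_measurable F_continuous)
  have "(\<lambda>x. if vnorm d x = 0 then k 0 else F x * complex_of_real (vnorm d x powr (- (s + \<alpha>)))) \<in> borel_measurable \<mu>"
    by measurable
  also have "?this \<longleftrightarrow> ?thesis"
  proof (rule measurable_cong)
    fix x assume "x \<in> space \<mu>"
    then have "x \<in> Rd d" by (simp add: space_\<mu>)
    then show "(if vnorm d x = 0 then k 0 else F x * complex_of_real (vnorm d x powr (- (s + \<alpha>)))) = k x"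
      using vnorm_eq_0_iff[of x d] vnorm_pos[of x d]
      by (auto simp: F_def of_real_mult[symmetric] powr_add[symmetric] simp del: of_real_mult)
  qed
  finally show ?thesis .
qed

lemma kl_measurable [measurable]: "0 < \<delta> \<Longrightarrow> kl \<delta> \<in> borel_measurable \<mu>"
  unfolding kl_def[abs_def] by measurable

text \<open>Where both truncated distances are at least \<open>t\<close>, the Hoelder bound for
  \<open>kr\<close> holds with max(t, .) in place of max(\<delta>, .), and
  \<open>far_integral\<close> can be used at scale \<open>t\<close>. The gain is a modulus of
  continuity at scale \<open>t\<close> however small \<delta> is, provided that the vicinity of the
  two points is left out of \<open>A\<close>.\<close>

lemma kr_diff_bound_outside:
  assumes \<delta>: "0 < \<delta>" and t: "0 < t" and x: "x \<in> Rd d" and z: "z \<in> Rd d"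
    and A: "\<And>y. y \<in> A \<Longrightarrow> y \<in> Rd d \<and> t \<le> max \<delta> (vnorm d (y - x)) \<and> t \<le> max \<delta> (vnorm d (y - z))"
  shows "(\<integral>\<^sup>+y. ennreal (cmod (kr \<delta> (y - x) - kr \<delta> (y - z))) * indicator A y \<partial>\<mu>)
    \<le> ennreal (2 * C_far * (vnorm d (x - z) / t) powr \<alpha>)"
proof -
  let ?p = "s + \<alpha>" and ?C = "2 powr (s + \<alpha>) / (1 - 2 powr (- \<alpha>)) * \<Lambda>"
  let ?H = "(B + 1 + (s + \<alpha>)) * vnorm d (x - z) powr \<alpha>"
  have H: "0 \<le> ?H" using B_nonneg s_pos \<alpha>_pos by simp
  have C: "0 \<le> ?C" using \<Lambda>_pos \<alpha>_pos powr_less_one[of 2 "- \<alpha>"] by simp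
  have p: "0 < ?p" using s_pos \<alpha>_pos by simp
  have mono: "max \<delta> (vnorm d (y - x)) powr (- ?p) \<le> max t (vnorm d (y - x)) powr (- ?p)"
    if "t \<le> max \<delta> (vnorm d (y - x))" for x y
    using that t p \<delta> by (intro powr_mono2') auto
  have "(\<integral>\<^sup>+y. ennreal (cmod (kr \<delta> (y - x) - kr \<delta> (y - z))) * indicator A y \<partial>\<mu>)
     \<le> (\<integral>\<^sup>+y. ennreal ?H * (ennreal (max t (vnorm d (y - x)) powr (- ?p)) + ennreal (max t (vnorm d (y - z)) powr (- ?p))) \<partial>\<mu>)"
  proof (rule nn_integral_mono)
    fix y assume "y \<in> space \<mu>"
    then have y: "y \<in> Rd d" by (simp add: space_\<mu>)
    show "ennreal (cmod (kr \<delta> (y - x) - kr \<delta> (y - z))) * indicator A y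
      \<le> ennreal ?H * (ennreal (max t (vnorm d (y - x)) powr (- ?p)) + ennreal (max t (vnorm d (y - z)) powr (- ?p)))"
    proof (cases "y \<in> A")
      case True
      have eq: "vnorm d ((y - x) - (y - z)) = vnorm d (x - z)"
        using vnorm_commute[of d z x] by simp
      have "cmod (kr \<delta> (y - x) - kr \<delta> (y - z)) \<le> ?H *
        (max \<delta> (vnorm d (y - x)) powr (- ?p) + max \<delta> (vnorm d (y - z)) powr (- ?p))"
        using kr_holder[OF \<delta> Rd_diff[OF y x] Rd_diff[OF y z]] unfolding eq .
      also have "?H * (max \<delta> (vnorm d (y - x)) powr (- ?p) + max \<delta> (vnorm d (y - z)) powr (- ?p))
        \<le> ?H * (max t (vnorm d (y - x)) powr (- ?p) + max t (vnorm d (y - z)) powr (- ?p))"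
        using A[OF True] H by (intro mult_left_mono add_mono mono) auto
      finally show ?thesis
        using True H by (simp add: ennreal_mult[symmetric] ennreal_plus[symmetric] ennreal_leI del: ennreal_plus)
    qed simp
  qed
  also have "\<dots> = ennreal ?H * ((\<integral>\<^sup>+y. ennreal (max t (vnorm d (y - x)) powr (- ?p)) \<partial>\<mu>)
      + (\<integral>\<^sup>+y. ennreal (max t (vnorm d (y - z)) powr (- ?p)) \<partial>\<mu>))"
  proof -
    have meas: "(\<lambda>y. ennreal (max t (vnorm d (y - x)) powr (- ?p))) \<in> borel_measurable \<mu>"
      if "x \<in> Rd d" for x
    proof -
      have [measurable]: "x \<in> space \<mu>" using that by (simp add: space_\<mu>)
      show ?thesis by measurable
    qed
    show ?thesis
      by (simp only: nn_integral_cmult[OF borel_measurable_add[OF meas[OF x] meas[OF z]]]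
          nn_integral_add[OF meas[OF x] meas[OF z]])
  qed
  also have "\<dots> \<le> ennreal ?H * (ennreal (?C * t powr (- \<alpha>)) + ennreal (?C * t powr (- \<alpha>)))"
    by (intro mult_left_mono add_mono far_integral x z t \<alpha>_pos) auto
  also have "\<dots> = ennreal (?H * (?C * t powr (- \<alpha>) + ?C * t powr (- \<alpha>)))"
    using C H mult_nonneg_nonneg[OF C powr_ge_zero[of t "- \<alpha>"]]
    by (simp only: ennreal_plus[symmetric] ennreal_mult[symmetric] add_nonneg_nonneg)
  also have "?H * (?C * t powr (- \<alpha>) + ?C * t powr (- \<alpha>)) = 2 * C_far * (vnorm d (x - z) / t) powr \<alpha>"
    unfolding C_far_def powr_divide powr_minus_divide[of t] by (simp add: ac_simps)
  finally show ?thesis .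
qed

lemma kr_diff_bound:
  assumes \<delta>: "0 < \<delta>" and x: "x \<in> Rd d" and z: "z \<in> Rd d"
  shows "(\<integral>\<^sup>+y. ennreal (cmod (kr \<delta> (y - x) - kr \<delta> (y - z))) \<partial>\<mu>)
    \<le> ennreal (2 * C_far * (vnorm d (x - z) / \<delta>) powr \<alpha>)"
proof -
  have "(\<integral>\<^sup>+y. ennreal (cmod (kr \<delta> (y - x) - kr \<delta> (y - z))) \<partial>\<mu>)
    = (\<integral>\<^sup>+y. ennreal (cmod (kr \<delta> (y - x) - kr \<delta> (y - z))) * indicator (Rd d) y \<partial>\<mu>)"
    by (intro nn_integral_cong) (simp add: space_\<mu>)
  also have "\<dots> \<le> ennreal (2 * C_far * (vnorm d (x - z) / \<delta>) powr \<alpha>)"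
    by (intro kr_diff_bound_outside assms) auto
  finally show ?thesis .
qed

lemma kr_diff_integrable:
  assumes \<delta>: "0 < \<delta>" and x: "x \<in> Rd d" and z: "z \<in> Rd d"
  shows "integrable \<mu> (\<lambda>y. kr \<delta> (y - x) - kr \<delta> (y - z))"
proof (rule integrableI_bounded)
  have x' [measurable]: "x \<in> space \<mu>" "z \<in> space \<mu>" using x z by (auto simp: space_\<mu>)
  show "(\<lambda>y. kr \<delta> (y - x) - kr \<delta> (y - z)) \<in> borel_measurable \<mu>"
    using \<delta> by measurable
  show "(\<integral>\<^sup>+y. ennreal (cmod (kr \<delta> (y - x) - kr \<delta> (y - z))) \<partial>\<mu>) < \<infinity>"
    using kr_diff_bound[OF assms] by (simp add: le_less_trans)
qed

text \<open>
  The potential without its normalisation: the base point is \<^term>\<open>0\<close> instead of an average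
  with weight $\eta$.
\<close>

definition D :: "real \<Rightarrow> point \<Rightarrow> complex" where
  "D \<delta> x = (LINT y | \<mu>. kr \<delta> (y - x) - kr \<delta> y)"

lemma kr_diff_pair_integrable:
  assumes \<delta>: "0 < \<delta>" and g: "g \<in> Lip0 d"
  shows "integrable (\<mu> \<Otimes>\<^sub>M \<mu>) (\<lambda>(y, z). (kr \<delta> (y - z) - kr \<delta> y) * g z)"
proof -
  obtain L M R where *: "0 \<le> M" "0 < R" "\<And>x. x \<in> Rd d \<Longrightarrow> cmod (g x) \<le> M"
    "\<And>x. x \<in> Rd d \<Longrightarrow> x \<notin> rball d 0 R \<Longrightarrow> g x = 0"
    by (rule Lip0E[OF g]) (rule that)
  note [measurable] = Lip0_measurable[OF g]
  let ?C = "2 * C_far * (R / \<delta>) powr \<alpha>"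
  show ?thesis
  proof (rule pair_integrable(1)[OF _ Rd_zero, where C = "?C * M" and R = R])
    show "(\<lambda>(y, z). (kr \<delta> (y - z) - kr \<delta> y) * g z) \<in> borel_measurable (\<mu> \<Otimes>\<^sub>M \<mu>)"
      using \<delta> by measurable
    show "0 \<le> ?C * M" using C_far_pos * by simp
    fix z assume z: "z \<in> Rd d"
    have [measurable]: "z \<in> space \<mu>" using z by (simp add: space_\<mu>)
    have "(\<integral>\<^sup>+y. ennreal (cmod (case (y, z) of (y, z) \<Rightarrow> (kr \<delta> (y - z) - kr \<delta> y) * g z)) \<partial>\<mu>)
      = (\<integral>\<^sup>+y. ennreal (cmod (g z)) * ennreal (cmod (kr \<delta> (y - z) - kr \<delta> (y - 0))) \<partial>\<mu>)"
      by (simp add: norm_mult ennreal_mult mult.commute)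
    also have "\<dots> = ennreal (cmod (g z)) * (\<integral>\<^sup>+y. ennreal (cmod (kr \<delta> (y - z) - kr \<delta> (y - 0))) \<partial>\<mu>)"
      using \<delta> by (intro nn_integral_cmult) simp
    also have "\<dots> \<le> ennreal (?C * M) * indicator (rball d 0 R) z"
    proof (cases "z \<in> rball d 0 R")
      case True
      then have zR: "vnorm d (z - 0) \<le> R" by (simp add: rball_def)
      have "(\<integral>\<^sup>+y. ennreal (cmod (kr \<delta> (y - z) - kr \<delta> (y - 0))) \<partial>\<mu>) \<le> ennreal (2 * C_far * (vnorm d (z - 0) / \<delta>) powr \<alpha>)"
        by (intro kr_diff_bound \<delta> z Rd_zero)
      also have "\<dots> \<le> ennreal ?C"
        using C_far_pos \<delta> zR \<alpha>_pos by (intro ennreal_leI mult_left_mono powr_mono2 divide_right_mono) auto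
      finally have "ennreal (cmod (g z)) * (\<integral>\<^sup>+y. ennreal (cmod (kr \<delta> (y - z) - kr \<delta> (y - 0))) \<partial>\<mu>) \<le> ennreal M * ennreal ?C"
        using *(3)[OF z] by (intro mult_mono ennreal_leI) auto
      then show ?thesis using True * C_far_pos by (simp add: ennreal_mult[symmetric] mult.commute)
    qed (use *(4)[OF z] in simp)
    finally show "(\<integral>\<^sup>+y. ennreal (cmod (case (y, z) of (y, z) \<Rightarrow> (kr \<delta> (y - z) - kr \<delta> y) * g z)) \<partial>\<mu>)
      \<le> ennreal (?C * M) * indicator (rball d 0 R) z" .
  qed
qed

lemma D_Lip0:
  assumes \<delta>: "0 < \<delta>" and g: "g \<in> Lip0 d"
  shows "integrable \<mu> (\<lambda>z. D \<delta> z * g z)"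
    and "(LINT z | \<mu>. D \<delta> z * g z) = (LINT (y, z) | (\<mu> \<Otimes>\<^sub>M \<mu>). (kr \<delta> (y - z) - kr \<delta> y) * g z)"
  using integrable_snd[OF kr_diff_pair_integrable[OF assms]] integral_snd[OF kr_diff_pair_integrable[OF assms]]
  by (simp_all add: D_def)

text \<open>The linear vanishing of \<open>h\<close> on the diagonal turns the singularity of order
  -s into one of order 1 - s, which \<open>near_integral\<close> handles. As \<open>kl\<close> lives
  on distances below \<delta>, the support of \<open>h\<close> needs control for such pairs
  only.\<close>

lemma kl_pair_integrable:
  fixes h :: "point \<times> point \<Rightarrow> complex"
  assumes \<delta>: "0 < \<delta>" and h [measurable]: "h \<in> borel_measurable (\<mu> \<Otimes>\<^sub>M \<mu>)" and c: "c \<in> Rd d" and L: "0 \<le> L"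
    and le: "\<And>x y. x \<in> Rd d \<Longrightarrow> y \<in> Rd d \<Longrightarrow> cmod (h (x, y)) \<le> L * vnorm d (x - y)"
    and zero: "\<And>x y. x \<in> Rd d \<Longrightarrow> y \<in> Rd d \<Longrightarrow> vnorm d (x - y) < \<delta> \<Longrightarrow> y \<notin> rball d c R \<Longrightarrow> h (x, y) = 0"
  shows "integrable (\<mu> \<Otimes>\<^sub>M \<mu>) (\<lambda>p. kl \<delta> (fst p - snd p) * h p)" (is "integrable _ ?h")
    and "cmod (LINT p | (\<mu> \<Otimes>\<^sub>M \<mu>). kl \<delta> (fst p - snd p) * h p) \<le> L * C_near * \<delta> * measure \<mu> (rball d c R)"
proof -
  have meas: "?h \<in> borel_measurable (\<mu> \<Otimes>\<^sub>M \<mu>)" using \<delta> by measurable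
  have C: "0 \<le> L * C_near * \<delta>" using L C_near_pos \<delta> by simp
  have bound: "(\<integral>\<^sup>+x. ennreal (cmod (?h (x, y))) \<partial>\<mu>) \<le> ennreal (L * C_near * \<delta>) * indicator (rball d c R) y"
    if y: "y \<in> Rd d" for y
  proof -
    let ?w = "\<lambda>x. if vnorm d (x - y) < \<delta> then vnorm d (x - y) powr (1 - s) else 0"
    have [measurable]: "y \<in> space \<mu>" using y by (simp add: space_\<mu>)
    have "(\<integral>\<^sup>+x. ennreal (cmod (?h (x, y))) \<partial>\<mu>)
      \<le> (\<integral>\<^sup>+x. (ennreal L * indicator (rball d c R) y) * ennreal (?w x) \<partial>\<mu>)"
    proof (rule nn_integral_mono)
      fix x assume "x \<in> space \<mu>"
      then have x: "x \<in> Rd d" by (simp add: space_\<mu>)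
      show "ennreal (cmod (?h (x, y))) \<le> (ennreal L * indicator (rball d c R) y) * ennreal (?w x)"
      proof (cases "x = y \<or> \<not> vnorm d (x - y) < \<delta> \<or> y \<notin> rball d c R")
        \<comment> \<open>On the diagonal \<open>kl \<delta> 0\<close> is the arbitrary value
          \<open>k 0\<close>, but \<open>h\<close> is 0 there by \<open>le\<close>.\<close>
        case True
        have "?h (x, y) = 0"
        proof (cases "x = y")
          case True
          then show ?thesis using le[OF x y] by simp
        next
          case False
          then have "x - y \<noteq> 0" by simp
          then show ?thesis using True False kl_bound[OF \<delta> Rd_diff[OF x y]] zero[OF x y]
            by (cases "vnorm d (x - y) < \<delta>") auto
        qed
        then have "ennreal (cmod (?h (x, y))) = 0" by (simp only: norm_zero ennreal_0)
        then show ?thesis by (simp only: zero_le)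
      next
        case False
        then have ne: "x - y \<noteq> 0" by simp
        have pos: "0 < vnorm d (x - y)" using vnorm_pos[OF Rd_diff[OF x y] ne] .
        have "cmod (?h (x, y)) \<le> vnorm d (x - y) powr (- s) * (L * vnorm d (x - y))"
          using kl_bound[OF \<delta> Rd_diff[OF x y] ne] le[OF x y] False
          by (simp add: norm_mult) (intro mult_mono, auto)
        also have "\<dots> = L * vnorm d (x - y) powr (1 - s)"
          using pos powr_add[of "vnorm d (x - y)" 1 "- s"] by simp
        finally show ?thesis using False L by (simp add: ennreal_mult[symmetric] ennreal_leI)
      qed
    qed
    also have "\<dots> = (ennreal L * indicator (rball d c R) y) * (\<integral>\<^sup>+x. ennreal (?w x) \<partial>\<mu>)"
      by (intro nn_integral_cmult) measurable
    also have "\<dots> \<le> (ennreal L * indicator (rball d c R) y) * ennreal (C_near * \<delta>)"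
      unfolding C_near_def by (intro mult_left_mono near_integral y \<delta>) auto
    also have "\<dots> = ennreal (L * C_near * \<delta>) * indicator (rball d c R) y"
      using L C_near_pos \<delta> by (auto simp: indicator_def ennreal_mult[symmetric] mult.assoc)
    finally show ?thesis .
  qed
  show "integrable (\<mu> \<Otimes>\<^sub>M \<mu>) ?h"
    by (rule pair_integrable(1)[OF meas c C bound])
  show "cmod (integral\<^sup>L (\<mu> \<Otimes>\<^sub>M \<mu>) ?h) \<le> L * C_near * \<delta> * measure \<mu> (rball d c R)"
    by (rule pair_integrable(2)[OF meas c C bound])
qed

end

subsection \<open>The identity for the potential\<close>

context kernel_measure
begin

text \<open>The scalar kernel as a vector-valued one with equal components, so that
  \<open>form\<close>, \<open>form_ext\<close> and \<open>T_bar\<close> apply to it.\<close>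

abbreviation Kc :: kernel where "Kc \<equiv> (\<lambda>u _. k u)"

lemma K_reg_Kc: "K_reg d s \<alpha> Kc \<delta> u j = kr \<delta> u"
  by (simp add: K_reg_def kr_def)

lemma form_loc_Kc:
  "form \<mu> (K_loc d s \<alpha> Kc \<delta>) f \<phi> j = (LINT p | (\<mu> \<Otimes>\<^sub>M \<mu>). kl \<delta> (fst p - snd p) * H_form f \<phi> (fst p) (snd p))"
  by (simp add: form_def K_loc_def kl_def K_reg_Kc)

lemma H_form_measurable [measurable]:
  assumes [measurable]: "f \<in> borel_measurable \<mu>" "\<phi> \<in> borel_measurable \<mu>"
  shows "(\<lambda>p. H_form f \<phi> (fst p) (snd p)) \<in> borel_measurable (\<mu> \<Otimes>\<^sub>M \<mu>)"
  unfolding H_form_def by measurable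

text \<open>\<open>2 * H_form f \<phi> x y\<close> equals f(y)(\<phi>(x) - \<phi>(y)) +
  \<phi>(y)(f(y) - f(x)), hence is bounded by a multiple of the distance. At distance below \<delta>
  it vanishes unless y is within \<delta> of a ball carrying f, so \<phi> itself may have unbounded
  support.\<close>

lemma form_loc_integrable:
  assumes \<delta>: "0 < \<delta>" and f: "f \<in> Lip0 d"
    and \<phi>: "\<And>x y. x \<in> Rd d \<Longrightarrow> y \<in> Rd d \<Longrightarrow> cmod (\<phi> x - \<phi> y) \<le> L' * vnorm d (x - y)"
      "\<And>x. x \<in> Rd d \<Longrightarrow> cmod (\<phi> x) \<le> M'"
  shows "integrable (\<mu> \<Otimes>\<^sub>M \<mu>) (\<lambda>p. kl \<delta> (fst p - snd p) * H_form f \<phi> (fst p) (snd p))"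
proof -
  obtain L M R where *: "0 \<le> L" "0 \<le> M" "0 < R"
    "\<And>x y. x \<in> Rd d \<Longrightarrow> y \<in> Rd d \<Longrightarrow> cmod (f x - f y) \<le> L * vnorm d (x - y)"
    "\<And>x. x \<in> Rd d \<Longrightarrow> cmod (f x) \<le> M"
    "\<And>x. x \<in> Rd d \<Longrightarrow> x \<notin> rball d 0 R \<Longrightarrow> f x = 0"
    by (rule Lip0E[OF f]) (rule that)
  have lip: "lipschitz d \<phi>" using \<phi>(1) unfolding lipschitz_def by blast
  note [measurable] = Lip0_measurable[OF f] continuous_measurable[OF lipschitz_continuous_on[OF lip]]
  have M': "0 \<le> M'" using order_trans[OF norm_ge_zero \<phi>(2)[OF Rd_zero]] .
  define h where "h = (\<lambda>p. H_form f \<phi> (fst p) (snd p))"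
  have hm: "h \<in> borel_measurable (\<mu> \<Otimes>\<^sub>M \<mu>)" unfolding h_def by measurable
  have hL: "cmod (h (x, y)) \<le> (M * \<bar>L'\<bar> + M' * L) * vnorm d (x - y)" if x: "x \<in> Rd d" and y: "y \<in> Rd d" for x y
  proof -
    have "h (x, y) = (f y * (\<phi> x - \<phi> y) + \<phi> y * (f y - f x)) / 2"
      by (simp add: h_def H_form_def algebra_simps)
    then have "cmod (h (x, y)) = cmod (f y * (\<phi> x - \<phi> y) + \<phi> y * (f y - f x)) / 2"
      by (simp only: norm_divide norm_numeral)
    then have "cmod (h (x, y)) \<le> cmod (f y * (\<phi> x - \<phi> y)) / 2 + cmod (\<phi> y * (f y - f x)) / 2"
      using norm_triangle_ineq[of "f y * (\<phi> x - \<phi> y)" "\<phi> y * (f y - f x)"] by linarith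
    also have "\<dots> \<le> cmod (f y * (\<phi> x - \<phi> y)) + cmod (\<phi> y * (f y - f x))"
      using norm_ge_zero[of "f y * (\<phi> x - \<phi> y)"] norm_ge_zero[of "\<phi> y * (f y - f x)"] by linarith
    also have "\<dots> \<le> M * (\<bar>L'\<bar> * vnorm d (x - y)) + M' * (L * vnorm d (x - y))"
    proof -
      have "L' * vnorm d (x - y) \<le> \<bar>L'\<bar> * vnorm d (x - y)" by (intro mult_right_mono) auto
      then have "cmod (\<phi> x - \<phi> y) \<le> \<bar>L'\<bar> * vnorm d (x - y)" using \<phi>(1)[OF x y] by linarith
      moreover have "cmod (f y - f x) \<le> L * vnorm d (x - y)"
        using *(4)[OF x y] by (simp add: norm_minus_commute)
      ultimately show ?thesis
        unfolding norm_mult using *(5)[OF y] \<phi>(2)[OF y] *(2) M' by (intro add_mono mult_mono) auto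
    qed
    finally show ?thesis by (simp only: distrib_right mult.assoc)
  qed
  have h0: "h (x, y) = 0" if x: "x \<in> Rd d" and y: "y \<in> Rd d" and xy: "vnorm d (x - y) < \<delta>" "y \<notin> rball d 0 (R + \<delta>)" for x y
  proof -
    have "R + \<delta> \<le> vnorm d y" using xy y by (simp add: rball_def)
    then have "y \<notin> rball d 0 R" "x \<notin> rball d 0 R"
      using xy \<delta> vnorm_diff_abs[of d x y] by (auto simp: rball_def)
    then show ?thesis using *(6) x y by (simp add: h_def H_form_def)
  qed
  have L2: "0 \<le> M * \<bar>L'\<bar> + M' * L" using * M' by simp
  show ?thesis
    by (rule kl_pair_integrable(1)[OF \<delta> hm Rd_zero L2 hL h0, unfolded h_def])
qed

text \<open>
  Split $K = K_\delta + K^\delta$. The kernel $K^\delta$ is local and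
  $|g(y)(1 - \psi(x))| = |g(y)(\psi(y) - \psi(x))| \le C|x-y|$, so its share may be integrated over
  pairs and the cutoff disappears by antisymmetry. For $K_\delta$ the mean value of $g$ allows to replace
  $K_\delta(x-y)$ by $K_\delta(x-y) - K_\delta(x)$, which is integrable over pairs.
\<close>

lemma reflection_identity:
  assumes \<delta>: "0 < \<delta>" and g: "g \<in> Lip0 d" and mean: "(LINT x | \<mu>. g x) = 0"
    and form0: "form_ext d \<mu> Kc g (\<lambda>_. 1) j = 0"
  shows "form \<mu> (K_loc d s \<alpha> Kc \<delta>) g (\<lambda>_. 1) j + (LINT x | \<mu>. D \<delta> x * g x) = 0"
proof -
  obtain L M R where g': "0 \<le> L" "0 \<le> M" "0 < R"
    "\<And>x y. x \<in> Rd d \<Longrightarrow> y \<in> Rd d \<Longrightarrow> cmod (g x - g y) \<le> L * vnorm d (x - y)"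
    "\<And>x. x \<in> Rd d \<Longrightarrow> cmod (g x) \<le> M"
    "\<And>x. x \<in> Rd d \<Longrightarrow> x \<notin> rball d 0 R \<Longrightarrow> g x = 0"
    by (rule Lip0E[OF g]) (rule that)
  \<comment> \<open>Literally the choice made in \<open>form_ext\<close>; only the properties of a
    cutoff are used of it.\<close>
  define \<psi> where "\<psi> = (SOME \<psi>. cutoff d g \<psi>)"
  have cut: "cutoff d g \<psi>"
    unfolding \<psi>_def by (rule someI_ex[OF cutoff_exists[OF g]])
  then have \<psi>: "\<psi> \<in> Lip0 d" by (simp add: cutoff_def)
  have \<psi>1: "g y * (1 - \<psi> y) = 0" if "y \<in> Rd d" for y
    using cut in_supp[OF that, of g] that by (auto simp: cutoff_def)
  obtain L' M' R' where \<psi>': "0 \<le> L'" "0 \<le> M'" "0 < R'"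
    "\<And>x y. x \<in> Rd d \<Longrightarrow> y \<in> Rd d \<Longrightarrow> cmod (\<psi> x - \<psi> y) \<le> L' * vnorm d (x - y)"
    "\<And>x. x \<in> Rd d \<Longrightarrow> cmod (\<psi> x) \<le> M'"
    "\<And>x. x \<in> Rd d \<Longrightarrow> x \<notin> rball d 0 R' \<Longrightarrow> \<psi> x = 0"
    by (rule Lip0E[OF \<psi>]) (rule that)
  note [measurable] = Lip0_measurable[OF g] Lip0_measurable[OF \<psi>]
  define T\<delta> where "T\<delta> x = (LINT y | \<mu>. kr \<delta> (x - y) * g y)" for x

  have inner_int: "integrable \<mu> (\<lambda>y. kr \<delta> (x - y) * g y)" if x: "x \<in> Rd d" for x
  proof (rule Bochner_Integration.integrable_bound)
    have [measurable]: "x \<in> space \<mu>" using x by (simp add: space_\<mu>)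
    show "(\<lambda>y. kr \<delta> (x - y) * g y) \<in> borel_measurable \<mu>" using \<delta> by measurable
    show "integrable \<mu> (\<lambda>y. complex_of_real (\<delta> powr (- s)) * g y)"
      by (intro integrable_mult_right Lip0_integrable g)
    show "AE y in \<mu>. cmod (kr \<delta> (x - y) * g y) \<le> cmod (complex_of_real (\<delta> powr (- s)) * g y)"
    proof (rule AE_I2)
      fix y assume "y \<in> space \<mu>"
      then have "cmod (kr \<delta> (x - y)) \<le> \<delta> powr (- s)"
        using x \<delta> by (intro kr_bound') (auto simp: space_\<mu>)
      then show "cmod (kr \<delta> (x - y) * g y) \<le> cmod (complex_of_real (\<delta> powr (- s)) * g y)"
        by (simp add: norm_mult mult_right_mono)
    qed
  qed
  have T\<delta>_eq: "T\<delta> x = (LINT y | \<mu>. (kr \<delta> (x - y) - kr \<delta> x) * g y)" if x: "x \<in> Rd d" for x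
  proof -
    have "(LINT y | \<mu>. (kr \<delta> (x - y) - kr \<delta> x) * g y) = (LINT y | \<mu>. kr \<delta> (x - y) * g y - kr \<delta> x * g y)"
      by (simp add: left_diff_distrib)
    also have "\<dots> = T\<delta> x - (LINT y | \<mu>. kr \<delta> x * g y)"
      unfolding T\<delta>_def by (intro Bochner_Integration.integral_diff inner_int[OF x] integrable_mult_right Lip0_integrable g)
    also have "\<dots> = T\<delta> x" using mean by simp
    finally show ?thesis by simp
  qed
  note P = kr_diff_pair_integrable[OF \<delta> g]
  have T\<delta>_int: "integrable \<mu> T\<delta>"
    using integrable_fst[OF P] T\<delta>_eq
    by (subst Bochner_Integration.integrable_cong[OF refl, where g = "\<lambda>x. LINT y | \<mu>. (kr \<delta> (x - y) - kr \<delta> x) * g y"]) (auto simp: space_\<mu>)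
  have T\<delta>_D: "(LINT x | \<mu>. T\<delta> x) = (LINT x | \<mu>. D \<delta> x * g x)"
  proof -
    have "(LINT x | \<mu>. T\<delta> x) = (LINT x | \<mu>. LINT y | \<mu>. (kr \<delta> (x - y) - kr \<delta> x) * g y)"
      by (intro Bochner_Integration.integral_cong refl T\<delta>_eq) (simp add: space_\<mu>)
    also have "\<dots> = (LINT (x, y) | (\<mu> \<Otimes>\<^sub>M \<mu>). (kr \<delta> (x - y) - kr \<delta> x) * g y)"
      by (rule integral_fst[OF P])
    also have "\<dots> = (LINT x | \<mu>. D \<delta> x * g x)"
      by (rule D_Lip0(2)[OF \<delta> g, symmetric])
    finally show ?thesis .
  qed
  have [measurable]: "T\<delta> \<in> borel_measurable \<mu>" using T\<delta>_int by simp

  \<comment> \<open>As \<open>kr\<close> is odd, the share of $K_\<delta>$ in the form with \<psi>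
    is the mean of \<open>G\<close> and its transpose. Both are integrable separately because g and
    \<psi> live on balls and \<open>kr\<close> is bounded.\<close>
  define G where "G = (\<lambda>(x, y). kr \<delta> (x - y) * g y * \<psi> x)"
  have G_meas: "G \<in> borel_measurable (\<mu> \<Otimes>\<^sub>M \<mu>)" unfolding G_def using \<delta> by measurable
  have G_int: "integrable (\<mu> \<Otimes>\<^sub>M \<mu>) G"
  proof (rule pair_integrable(1)[OF G_meas Rd_zero, where C = "\<delta> powr (- s) * M * M' * measure \<mu> (rball d 0 R')" and R = R])
    show "0 \<le> \<delta> powr (- s) * M * M' * measure \<mu> (rball d 0 R')" using g' \<psi>' by simp
    fix y assume y: "y \<in> Rd d"
    have "(\<integral>\<^sup>+x. ennreal (cmod (G (x, y))) \<partial>\<mu>)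
      \<le> (\<integral>\<^sup>+x. (ennreal (\<delta> powr (- s) * M * M') * indicator (rball d 0 R) y) * indicator (rball d 0 R') x \<partial>\<mu>)"
    proof (rule nn_integral_mono)
      fix x assume "x \<in> space \<mu>"
      then have x: "x \<in> Rd d" by (simp add: space_\<mu>)
      show "ennreal (cmod (G (x, y))) \<le> (ennreal (\<delta> powr (- s) * M * M') * indicator (rball d 0 R) y) * indicator (rball d 0 R') x"
      proof (cases "y \<in> rball d 0 R \<and> x \<in> rball d 0 R'")
        case True
        have "cmod (G (x, y)) \<le> \<delta> powr (- s) * M * M'"
          unfolding G_def using g'(2) g'(5)[OF y] \<psi>'(2) \<psi>'(5)[OF x] kr_bound'[OF \<delta> Rd_diff[OF x y] \<delta>]
          by (auto simp: norm_mult intro!: mult_mono)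
        then show ?thesis using True by (simp add: ennreal_leI)
      next
        case False
        then have "G (x, y) = 0" using g'(6)[OF y] \<psi>'(6)[OF x] by (auto simp: G_def)
        then show ?thesis by simp
      qed
    qed
    also have "\<dots> = (ennreal (\<delta> powr (- s) * M * M') * indicator (rball d 0 R) y) * emeasure \<mu> (rball d 0 R')"
      by (intro nn_integral_cmult_indicator) simp
    also have "\<dots> = ennreal (\<delta> powr (- s) * M * M' * measure \<mu> (rball d 0 R')) * indicator (rball d 0 R) y"
      using emeasure_rball_finite[OF Rd_zero, of R'] g' \<psi>'
      by (simp add: emeasure_eq_ennreal_measure ennreal_mult indicator_def)
    finally show "(\<integral>\<^sup>+x. ennreal (cmod (G (x, y))) \<partial>\<mu>)
      \<le> ennreal (\<delta> powr (- s) * M * M' * measure \<mu> (rball d 0 R')) * indicator (rball d 0 R) y" .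
  qed
  have G_swap_int: "integrable (\<mu> \<Otimes>\<^sub>M \<mu>) (\<lambda>(x, y). G (y, x))"
    by (rule integrable_product_swap[OF G_int])
  have G_swap: "(LINT (x, y) | (\<mu> \<Otimes>\<^sub>M \<mu>). G (y, x)) = integral\<^sup>L (\<mu> \<Otimes>\<^sub>M \<mu>) G"
    by (rule integral_product_swap[OF G_meas])
  have G_val: "integral\<^sup>L (\<mu> \<Otimes>\<^sub>M \<mu>) G = (LINT x | \<mu>. T\<delta> x * \<psi> x)"
  proof -
    have "integral\<^sup>L (\<mu> \<Otimes>\<^sub>M \<mu>) G = (LINT x | \<mu>. LINT y | \<mu>. G (x, y))"
      by (rule integral_fst'[OF G_int, symmetric])
    also have "\<dots> = (LINT x | \<mu>. T\<delta> x * \<psi> x)"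
      unfolding G_def T\<delta>_def by simp
    finally show ?thesis .
  qed

  \<comment> \<open>This measures the passage from \<psi> to 1:
    \<open>H_form g (\<lambda>_. 1)\<close> minus \<open>H_form g \<psi>\<close> is half the
    antisymmetrisation of \<open>h\<close>. Multiplied by the odd \<open>kl\<close> it becomes the
    mean of \<open>Q\<close> and its transpose.\<close>
  define h where "h = (\<lambda>p. g (snd p) * (1 - \<psi> (fst p)))"
  define Q where "Q = (\<lambda>p. kl \<delta> (fst p - snd p) * h p)"
  have h_meas: "h \<in> borel_measurable (\<mu> \<Otimes>\<^sub>M \<mu>)" unfolding h_def by measurable
  have hL: "cmod (h (x, y)) \<le> (M * L') * vnorm d (x - y)" if x: "x \<in> Rd d" and y: "y \<in> Rd d" for x y
  proof -
    have "h (x, y) = g y * (\<psi> y - \<psi> x)"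
      using \<psi>1[OF y] by (simp add: h_def algebra_simps)
    moreover have "cmod (\<psi> y - \<psi> x) \<le> L' * vnorm d (x - y)"
      using \<psi>'(4)[OF x y] by (simp add: norm_minus_commute)
    ultimately have "cmod (h (x, y)) \<le> M * (L' * vnorm d (x - y))"
      using g'(5)[OF y] g'(2) by (simp add: norm_mult mult_mono)
    then show ?thesis by (simp add: mult.assoc)
  qed
  have h0: "h (x, y) = 0" if "x \<in> Rd d" "y \<in> Rd d" "vnorm d (x - y) < \<delta>" "y \<notin> rball d 0 R" for x y
    using g'(6) that by (simp add: h_def)
  have hML: "0 \<le> M * L'" using g' \<psi>' by simp
  have Q_int: "integrable (\<mu> \<Otimes>\<^sub>M \<mu>) Q"
    unfolding Q_def by (rule kl_pair_integrable(1)[OF \<delta> h_meas Rd_zero hML hL h0])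
  then have Q_meas: "Q \<in> borel_measurable (\<mu> \<Otimes>\<^sub>M \<mu>)" by simp
  have Q_swap_int: "integrable (\<mu> \<Otimes>\<^sub>M \<mu>) (\<lambda>(x, y). Q (y, x))"
    by (rule integrable_product_swap[OF Q_int])
  have Q_swap: "(LINT (x, y) | (\<mu> \<Otimes>\<^sub>M \<mu>). Q (y, x)) = integral\<^sup>L (\<mu> \<Otimes>\<^sub>M \<mu>) Q"
    by (rule integral_product_swap[OF Q_meas])

  let ?HL = "\<lambda>p. kl \<delta> (fst p - snd p) * H_form g \<psi> (fst p) (snd p)"
  have H\<psi>_int: "integrable (\<mu> \<Otimes>\<^sub>M \<mu>) ?HL"
    by (rule form_loc_integrable[OF \<delta> g \<psi>'(4,5)])

  have form_\<psi>: "form \<mu> Kc g \<psi> j = integral\<^sup>L (\<mu> \<Otimes>\<^sub>M \<mu>) ?HL + integral\<^sup>L (\<mu> \<Otimes>\<^sub>M \<mu>) G"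
  proof -
    have "form \<mu> Kc g \<psi> j = (LINT p | (\<mu> \<Otimes>\<^sub>M \<mu>). ?HL p + (G p / 2 + (case p of (x, y) \<Rightarrow> G (y, x)) / 2))"
      unfolding form_def
    proof (intro Bochner_Integration.integral_cong refl)
      fix p assume "p \<in> space (\<mu> \<Otimes>\<^sub>M \<mu>)"
      then obtain x y where p: "p = (x, y)" "x \<in> Rd d" "y \<in> Rd d"
        by (cases p) (auto simp: space_pair_measure space_\<mu>)
      have "kr \<delta> (y - x) = - kr \<delta> (x - y)"
        using kr_odd[OF Rd_diff[OF p(2,3)], of \<delta>] by simp
      then show "k (fst p - snd p) * H_form g \<psi> (fst p) (snd p) = ?HL p + (G p / 2 + (case p of (x, y) \<Rightarrow> G (y, x)) / 2)"
        unfolding p(1) by (simp add: G_def H_form_def kl_def field_simps)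
    qed
    also have "\<dots> = integral\<^sup>L (\<mu> \<Otimes>\<^sub>M \<mu>) ?HL +
      (integral\<^sup>L (\<mu> \<Otimes>\<^sub>M \<mu>) G / 2 + (LINT (x, y) | (\<mu> \<Otimes>\<^sub>M \<mu>). G (y, x)) / 2)"
      using H\<psi>_int G_int G_swap_int by simp
    finally show ?thesis unfolding G_swap by simp
  qed

  have form_1: "form \<mu> (K_loc d s \<alpha> Kc \<delta>) g (\<lambda>_. 1) j = integral\<^sup>L (\<mu> \<Otimes>\<^sub>M \<mu>) ?HL + integral\<^sup>L (\<mu> \<Otimes>\<^sub>M \<mu>) Q"
  proof -
    have "form \<mu> (K_loc d s \<alpha> Kc \<delta>) g (\<lambda>_. 1) j
      = (LINT p | (\<mu> \<Otimes>\<^sub>M \<mu>). ?HL p + (Q p / 2 + (case p of (x, y) \<Rightarrow> Q (y, x)) / 2))"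
      unfolding form_loc_Kc
    proof (intro Bochner_Integration.integral_cong refl)
      fix p assume "p \<in> space (\<mu> \<Otimes>\<^sub>M \<mu>)"
      then obtain x y where p: "p = (x, y)" "x \<in> Rd d" "y \<in> Rd d"
        by (cases p) (auto simp: space_pair_measure space_\<mu>)
      show "kl \<delta> (fst p - snd p) * H_form g (\<lambda>_. 1) (fst p) (snd p) = ?HL p + (Q p / 2 + (case p of (x, y) \<Rightarrow> Q (y, x)) / 2)"
      \<comment> \<open>Oddness of \<open>kl\<close> is available only off the diagonal, since
        \<open>k 0\<close> is arbitrary; on the diagonal all terms vanish because g (1 - \<psi>)
        does.\<close>
      proof (cases "x = y")
        case True
        then show ?thesis using \<psi>1[OF p(3)] unfolding p(1) by (auto simp: Q_def h_def H_form_def)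
      next
        case False
        then have "kl \<delta> (y - x) = - kl \<delta> (x - y)"
          using kl_odd[OF Rd_diff[OF p(2,3)], of \<delta>] by simp
        then show ?thesis unfolding p(1) by (simp add: Q_def h_def H_form_def field_simps)
      qed
    qed
    also have "\<dots> = integral\<^sup>L (\<mu> \<Otimes>\<^sub>M \<mu>) ?HL +
      (integral\<^sup>L (\<mu> \<Otimes>\<^sub>M \<mu>) Q / 2 + (LINT (x, y) | (\<mu> \<Otimes>\<^sub>M \<mu>). Q (y, x)) / 2)"
      using H\<psi>_int Q_int Q_swap_int by simp
    finally show ?thesis unfolding Q_swap by simp
  qed

  have T\<psi>_int: "integrable \<mu> (\<lambda>x. T\<delta> x * \<psi> x)"
  proof (rule Bochner_Integration.integrable_bound[where f = "\<lambda>x. complex_of_real M' * T\<delta> x"])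
    show "AE x in \<mu>. cmod (T\<delta> x * \<psi> x) \<le> cmod (complex_of_real M' * T\<delta> x)"
    proof (rule AE_I2)
      fix x assume "x \<in> space \<mu>"
      then have "cmod (T\<delta> x) * cmod (\<psi> x) \<le> cmod (T\<delta> x) * M'"
        using \<psi>'(5)[of x] by (intro mult_left_mono) (auto simp: space_\<mu>)
      then show "cmod (T\<delta> x * \<psi> x) \<le> cmod (complex_of_real M' * T\<delta> x)"
        using \<psi>'(2) by (simp add: norm_mult mult.commute)
    qed
  qed (use T\<delta>_int in auto)
  have outer: "(LINT x | \<mu>. T_op \<mu> Kc g x j * (1 - \<psi> x)) = integral\<^sup>L (\<mu> \<Otimes>\<^sub>M \<mu>) Q + (LINT x | \<mu>. T\<delta> x - T\<delta> x * \<psi> x)"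
  proof -
    \<comment> \<open>Splitting the inner integral requires the section of \<open>Q\<close> to be
      integrable, which Fubini grants for almost every x.\<close>
    have ae: "AE x in \<mu>. T_op \<mu> Kc g x j * (1 - \<psi> x) = (LINT y | \<mu>. Q (x, y)) + (T\<delta> x - T\<delta> x * \<psi> x)"
      using AE_integrable_fst'[OF Q_int] AE_space
    proof eventually_elim
      case (elim x)
      then have x: "x \<in> Rd d" by (simp add: space_\<mu>)
      have "T_op \<mu> Kc g x j * (1 - \<psi> x) = (LINT y | \<mu>. k (x - y) * g y * (1 - \<psi> x))"
        by (simp add: T_op_def)
      also have "\<dots> = (LINT y | \<mu>. Q (x, y) + kr \<delta> (x - y) * g y * (1 - \<psi> x))"
        by (simp add: Q_def h_def kl_def algebra_simps)
      also have "\<dots> = (LINT y | \<mu>. Q (x, y)) + (LINT y | \<mu>. kr \<delta> (x - y) * g y * (1 - \<psi> x))"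
        using elim(1) inner_int[OF x] by (intro Bochner_Integration.integral_add integrable_mult_left) auto
      also have "(LINT y | \<mu>. kr \<delta> (x - y) * g y * (1 - \<psi> x)) = T\<delta> x * (1 - \<psi> x)"
        by (simp add: T\<delta>_def)
      finally show ?case by (simp add: algebra_simps)
    qed
    have "(LINT x | \<mu>. T_op \<mu> Kc g x j * (1 - \<psi> x)) = (LINT x | \<mu>. (LINT y | \<mu>. Q (x, y)) + (T\<delta> x - T\<delta> x * \<psi> x))"
    proof (rule integral_cong_AE)
      show "(\<lambda>x. T_op \<mu> Kc g x j * (1 - \<psi> x)) \<in> borel_measurable \<mu>"
        unfolding T_op_def by measurable
      show "(\<lambda>x. (LINT y | \<mu>. Q (x, y)) + (T\<delta> x - T\<delta> x * \<psi> x)) \<in> borel_measurable \<mu>"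
        using integrable_fst'[OF Q_int] by measurable
    qed (rule ae)
    also have "\<dots> = (LINT x | \<mu>. LINT y | \<mu>. Q (x, y)) + (LINT x | \<mu>. T\<delta> x - T\<delta> x * \<psi> x)"
      using integrable_fst'[OF Q_int] T\<delta>_int T\<psi>_int by (intro Bochner_Integration.integral_add) auto
    finally show ?thesis by (simp only: integral_fst'[OF Q_int])
  qed

  have "0 = form \<mu> Kc g \<psi> j + (LINT x | \<mu>. T_op \<mu> Kc g x j * (1 - \<psi> x))"
    using form0 by (simp add: form_ext_def \<psi>_def[symmetric] Let_def)
  \<comment> \<open>The integral of \<open>Q\<close> from the outer part completes the local form
    from \<psi> to 1, and the integral of \<open>G\<close> cancels the \<psi>-weighted part of
    \<open>T\<delta>\<close>.\<close>
  also have "\<dots> = form \<mu> (K_loc d s \<alpha> Kc \<delta>) g (\<lambda>_. 1) j + (LINT x | \<mu>. T\<delta> x)"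
    unfolding form_\<psi> outer form_1 G_val using T\<delta>_int T\<psi>_int by simp
  finally show ?thesis unfolding T\<delta>_D by simp
qed

text \<open>Adding and subtracting $K_\<delta>(y)$ separates x from z in the defining double
  integral. The potential is thus \<open>D\<close> up to a constant in x, and everything depending
  on \<eta> sits in that constant.\<close>

lemma T_bar_eq:
  assumes \<delta>: "0 < \<delta>" and \<eta>: "normalizer d \<mu> \<eta>" and x: "x \<in> Rd d"
  shows "T_bar d s \<alpha> Kc \<mu> \<eta> \<delta> (\<lambda>_. 1) x j = D \<delta> x - (LINT z | \<mu>. D \<delta> z * complex_of_real (\<eta> z))
    - form \<mu> (K_loc d s \<alpha> Kc \<delta>) (\<lambda>x. complex_of_real (\<eta> x)) (\<lambda>_. 1) j"
proof -
  let ?\<eta> = "\<lambda>x. complex_of_real (\<eta> x)"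
  have \<eta>L: "?\<eta> \<in> Lip0 d" and int\<eta>: "(LINT x | \<mu>. ?\<eta> x) = 1"
    using \<eta> by (auto simp: normalizer_def)
  obtain L M R where *: "0 \<le> M" "0 < R" "\<And>x. x \<in> Rd d \<Longrightarrow> cmod (?\<eta> x) \<le> M"
    "\<And>x. x \<in> Rd d \<Longrightarrow> x \<notin> rball d 0 R \<Longrightarrow> ?\<eta> x = 0"
    by (rule Lip0E[OF \<eta>L]) (rule that)
  have [measurable]: "x \<in> space \<mu>" using x by (simp add: space_\<mu>)
  note [measurable] = Lip0_measurable[OF \<eta>L]
  let ?P = "\<lambda>(y, z). (kr \<delta> (y - x) - kr \<delta> y) * ?\<eta> z"
  let ?C = "2 * C_far * (vnorm d (x - 0) / \<delta>) powr \<alpha>"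
  have P_int: "integrable (\<mu> \<Otimes>\<^sub>M \<mu>) ?P"
  proof (rule pair_integrable(1)[OF _ Rd_zero, where C = "?C * M" and R = R])
    show "?P \<in> borel_measurable (\<mu> \<Otimes>\<^sub>M \<mu>)" using \<delta> by measurable
    show "0 \<le> ?C * M" using C_far_pos * by simp
    fix z assume z: "z \<in> Rd d"
    have "(\<integral>\<^sup>+y. ennreal (cmod (?P (y, z))) \<partial>\<mu>)
      = (\<integral>\<^sup>+y. ennreal (cmod (?\<eta> z)) * ennreal (cmod (kr \<delta> (y - x) - kr \<delta> (y - 0))) \<partial>\<mu>)"
      by (simp add: norm_mult ennreal_mult mult.commute)
    also have "\<dots> = ennreal (cmod (?\<eta> z)) * (\<integral>\<^sup>+y. ennreal (cmod (kr \<delta> (y - x) - kr \<delta> (y - 0))) \<partial>\<mu>)"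
      using \<delta> by (intro nn_integral_cmult) simp
    also have "\<dots> \<le> ennreal (cmod (?\<eta> z)) * ennreal ?C"
      by (intro mult_left_mono kr_diff_bound \<delta> x Rd_zero) auto
    also have "\<dots> \<le> ennreal (?C * M) * indicator (rball d 0 R) z"
    proof (cases "z \<in> rball d 0 R")
      case True
      have "ennreal (cmod (?\<eta> z)) * ennreal ?C \<le> ennreal M * ennreal ?C"
        using *(3)[OF z] by (intro mult_right_mono ennreal_leI) auto
      then show ?thesis using True * C_far_pos by (simp add: ennreal_mult[symmetric] mult.commute)
    qed (use *(4)[OF z] in simp)
    finally show "(\<integral>\<^sup>+y. ennreal (cmod (?P (y, z))) \<partial>\<mu>) \<le> ennreal (?C * M) * indicator (rball d 0 R) z" .
  qed
  have P_val: "(LINT p | (\<mu> \<Otimes>\<^sub>M \<mu>). ?P p) = D \<delta> x"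
    unfolding integral_snd[OF P_int, symmetric] using int\<eta> by (simp add: D_def)
  note P2 = kr_diff_pair_integrable[OF \<delta> \<eta>L]
  have "(LINT (y, z) | (\<mu> \<Otimes>\<^sub>M \<mu>). (kr \<delta> (y - x) - kr \<delta> (y - z)) * 1 * ?\<eta> z)
    = (LINT p | (\<mu> \<Otimes>\<^sub>M \<mu>). ?P p - (case p of (y, z) \<Rightarrow> (kr \<delta> (y - z) - kr \<delta> y) * ?\<eta> z))"
    by (intro Bochner_Integration.integral_cong refl) (auto simp: algebra_simps)
  also have "\<dots> = D \<delta> x - (LINT z | \<mu>. D \<delta> z * ?\<eta> z)"
    unfolding Bochner_Integration.integral_diff[OF P_int P2] P_val D_Lip0(2)[OF \<delta> \<eta>L] ..
  finally show ?thesis unfolding T_bar_def K_reg_Kc by simp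
qed

lemma T_bar_diff:
  assumes \<delta>: "0 < \<delta>" and \<eta>: "normalizer d \<mu> \<eta>" and x: "x \<in> Rd d" and z: "z \<in> Rd d"
  shows "T_bar d s \<alpha> Kc \<mu> \<eta> \<delta> (\<lambda>_. 1) x j - T_bar d s \<alpha> Kc \<mu> \<eta> \<delta> (\<lambda>_. 1) z j
    = (LINT y | \<mu>. kr \<delta> (y - x) - kr \<delta> (y - z))"
proof -
  have int: "integrable \<mu> (\<lambda>y. kr \<delta> (y - w) - kr \<delta> y)" if "w \<in> Rd d" for w
    using kr_diff_integrable[OF \<delta> that Rd_zero] by simp
  have "D \<delta> x - D \<delta> z = (LINT y | \<mu>. (kr \<delta> (y - x) - kr \<delta> y) - (kr \<delta> (y - z) - kr \<delta> y))"
    unfolding D_def by (rule Bochner_Integration.integral_diff[symmetric, OF int[OF x] int[OF z]])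
  then show ?thesis
    unfolding T_bar_eq[OF \<delta> \<eta> x] T_bar_eq[OF \<delta> \<eta> z] by simp
qed

lemma form_loc_one_integrable:
  assumes \<delta>: "0 < \<delta>" and f: "f \<in> Lip0 d"
  shows "integrable (\<mu> \<Otimes>\<^sub>M \<mu>) (\<lambda>p. kl \<delta> (fst p - snd p) * H_form f (\<lambda>_. 1) (fst p) (snd p))"
  by (rule form_loc_integrable[OF assms, where L' = 0 and M' = 1]) auto

lemma potential_identity:
  assumes \<delta>: "0 < \<delta>" and \<eta>: "normalizer d \<mu> \<eta>" and f: "f \<in> Lip0 d"
    and form0: "\<And>g. g \<in> Lip0 d \<Longrightarrow> (LINT x | \<mu>. g x) = 0 \<Longrightarrow> form_ext d \<mu> Kc g (\<lambda>_. 1) j = 0"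
  shows "integrable \<mu> (\<lambda>x. T_bar d s \<alpha> Kc \<mu> \<eta> \<delta> (\<lambda>_. 1) x j * f x)"
    and "(LINT x | \<mu>. T_bar d s \<alpha> Kc \<mu> \<eta> \<delta> (\<lambda>_. 1) x j * f x) = - form \<mu> (K_loc d s \<alpha> Kc \<delta>) f (\<lambda>_. 1) j"
proof -
  let ?\<eta> = "\<lambda>x. complex_of_real (\<eta> x)"
  let ?form = "\<lambda>f. form \<mu> (K_loc d s \<alpha> Kc \<delta>) f (\<lambda>_. 1) j"
  have \<eta>L: "?\<eta> \<in> Lip0 d" and int\<eta>: "(LINT x | \<mu>. ?\<eta> x) = 1"
    using \<eta> by (auto simp: normalizer_def)
  define a where "a = (LINT x | \<mu>. f x)"
  \<comment> \<open>The constant by which the potential falls short of \<open>D\<close>. The terms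
    with a factor \<open>a\<close> in the identity for \<open>g\<close> add up to exactly
    \<open>a * b\<close>.\<close>
  define b where "b = (LINT z | \<mu>. D \<delta> z * ?\<eta> z) + ?form ?\<eta>"
  define g where "g x = f x - a * ?\<eta> x" for x
  have g: "g \<in> Lip0 d" unfolding g_def by (rule Lip0_diff_scale[OF f \<eta>L])
  have "(LINT x | \<mu>. g x) = 0"
    unfolding g_def using Lip0_integrable[OF f] Lip0_integrable[OF \<eta>L] int\<eta> by (simp add: a_def)
  from reflection_identity[OF \<delta> g this form0[OF g this]]
  have id: "?form g + (LINT x | \<mu>. D \<delta> x * g x) = 0" .
  have form_g: "?form g = ?form f - a * ?form ?\<eta>"
  proof -
    have "?form g = (LINT p | (\<mu> \<Otimes>\<^sub>M \<mu>). kl \<delta> (fst p - snd p) * H_form f (\<lambda>_. 1) (fst p) (snd p)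
      - a * (kl \<delta> (fst p - snd p) * H_form ?\<eta> (\<lambda>_. 1) (fst p) (snd p)))"
      unfolding form_loc_Kc
      by (intro Bochner_Integration.integral_cong refl) (simp add: H_form_def g_def field_simps)
    also have "\<dots> = ?form f - a * ?form ?\<eta>"
      unfolding form_loc_Kc
      using form_loc_one_integrable[OF \<delta> f] form_loc_one_integrable[OF \<delta> \<eta>L] by simp
    finally show ?thesis .
  qed
  have D_g: "(LINT x | \<mu>. D \<delta> x * g x) = (LINT x | \<mu>. D \<delta> x * f x) - a * (LINT x | \<mu>. D \<delta> x * ?\<eta> x)"
  proof -
    have "(LINT x | \<mu>. D \<delta> x * g x) = (LINT x | \<mu>. D \<delta> x * f x - a * (D \<delta> x * ?\<eta> x))"
      by (simp add: g_def algebra_simps)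
    also have "\<dots> = (LINT x | \<mu>. D \<delta> x * f x) - a * (LINT x | \<mu>. D \<delta> x * ?\<eta> x)"
      using D_Lip0(1)[OF \<delta> f] D_Lip0(1)[OF \<delta> \<eta>L] by simp
    finally show ?thesis .
  qed
  have T: "T_bar d s \<alpha> Kc \<mu> \<eta> \<delta> (\<lambda>_. 1) x j * f x = D \<delta> x * f x - b * f x" if "x \<in> space \<mu>" for x
  proof -
    have "T_bar d s \<alpha> Kc \<mu> \<eta> \<delta> (\<lambda>_. 1) x j = D \<delta> x - b"
      using T_bar_eq[OF \<delta> \<eta>, of x j] that by (simp add: space_\<mu> b_def)
    then show ?thesis by (simp only: left_diff_distrib)
  qed
  have int: "integrable \<mu> (\<lambda>x. D \<delta> x * f x - b * f x)"
    using D_Lip0(1)[OF \<delta> f] Lip0_integrable[OF f] by simp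
  show "integrable \<mu> (\<lambda>x. T_bar d s \<alpha> Kc \<mu> \<eta> \<delta> (\<lambda>_. 1) x j * f x)"
    by (rule iffD2[OF Bochner_Integration.integrable_cong[OF refl T] int])
  have "(LINT x | \<mu>. T_bar d s \<alpha> Kc \<mu> \<eta> \<delta> (\<lambda>_. 1) x j * f x) = (LINT x | \<mu>. D \<delta> x * f x - b * f x)"
    by (rule Bochner_Integration.integral_cong[OF refl T])
  also have "\<dots> = (LINT x | \<mu>. D \<delta> x * f x) - b * a"
    using D_Lip0(1)[OF \<delta> f] Lip0_integrable[OF f] by (simp add: a_def)
  also have "\<dots> = - ?form f"
    using id unfolding form_g D_g b_def by (simp add: algebra_simps add_eq_0_iff)
  finally show "(LINT x | \<mu>. T_bar d s \<alpha> Kc \<mu> \<eta> \<delta> (\<lambda>_. 1) x j * f x) = - ?form f" .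
qed

end

section \<open>From scalar kernels to vector-valued kernels\<close>

lemma cnorm_Cauchy_Schwarz: "cmod (\<Sum>j<d'. e j * v j) \<le> cnorm d' e * cnorm d' v"
proof -
  have "cmod (\<Sum>j<d'. e j * v j) \<le> (\<Sum>j<d'. \<bar>cmod (e j)\<bar> * \<bar>cmod (v j)\<bar>)"
    by (rule order_trans[OF norm_sum]) (simp add: norm_mult)
  also have "\<dots> \<le> cnorm d' e * cnorm d' v"
    unfolding cnorm_def by (rule L2_set_mult_ineq)
  finally show ?thesis .
qed

lemma holder_kernel_combination:
  assumes s: "0 < s" and K: "cz_kernel d d' s \<alpha> K" and e: "cnorm d' e \<le> 1"
  shows "holder_kernel d s \<alpha> (enn2real (kernel_seminorm d d' s \<alpha> K)) (\<lambda>x. \<Sum>j<d'. e j * K x j)"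
proof
  let ?N = "kernel_seminorm d d' s \<alpha> K"
  have CS: "cmod (\<Sum>j<d'. e j * v j) \<le> cnorm d' v" for v
    using cnorm_Cauchy_Schwarz[of e v d'] mult_right_mono[OF e, of "cnorm d' v"]
    by (simp add: cnorm_def)
  show "0 < s" "0 < \<alpha>" "\<alpha> \<le> 1" using s K by (auto simp: cz_kernel_def)
  show "0 \<le> enn2real ?N" by simp
  fix x assume x: "x \<in> Rd d"
  show "cmod (\<Sum>j<d'. e j * K x j) \<le> vnorm d x powr (- s)" if "x \<noteq> 0"
    using CS[of "K x"] K x that unfolding cz_kernel_def by (meson DiffI order_trans singletonD)
  show "(\<Sum>j<d'. e j * K (- x) j) = - (\<Sum>j<d'. e j * K x j)" if "x \<noteq> 0"
    using K x that by (simp add: cz_kernel_def sum_negf)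
  fix y assume y: "y \<in> Rd d"
  define G where "G x j = (if x = 0 then 0 else K x j * complex_of_real (vnorm d x powr (s + \<alpha>)))" for x :: point and j
  have G_sum: "(if x = 0 then 0 else (\<Sum>j<d'. e j * K x j) * complex_of_real (vnorm d x powr (s + \<alpha>)))
      = (\<Sum>j<d'. e j * G x j)" for x
    by (simp add: G_def sum_distrib_right mult.assoc)
  have "(if x = 0 then 0 else (\<Sum>j<d'. e j * K x j) * complex_of_real (vnorm d x powr (s + \<alpha>)))
    - (if y = 0 then 0 else (\<Sum>j<d'. e j * K y j) * complex_of_real (vnorm d y powr (s + \<alpha>)))
    = (\<Sum>j<d'. e j * (G x - G y) j)"
    unfolding G_sum by (simp add: sum_subtractf right_diff_distrib)
  also have "cmod \<dots> \<le> cnorm d' (G x - G y)" by (rule CS)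
  also have "\<dots> \<le> enn2real ?N * vnorm d (x - y) powr \<alpha>"
  proof (cases "x = y")
    case True
    then show ?thesis by (simp add: cnorm_def L2_set_def)
  next
    case False
    then have "x - y \<noteq> 0" by simp
    then have pos: "0 < vnorm d (x - y) powr \<alpha>" using vnorm_pos[OF Rd_diff[OF x y]] by simp
    have "ennreal (cnorm d' (G x - G y) / vnorm d (x - y) powr \<alpha>) \<le> ?N"
      unfolding kernel_seminorm_def Let_def G_def[abs_def, symmetric]
      using x y False by (intro SUP_upper2[of "(x, y)"]) auto
    moreover have "?N < \<infinity>" using K by (simp add: cz_kernel_def)
    ultimately have "cnorm d' (G x - G y) / vnorm d (x - y) powr \<alpha> \<le> enn2real ?N"
      by (metis enn2real_nonneg ennreal_enn2real ennreal_le_iff infinity_ennreal_def)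
    then show ?thesis using pos by (simp add: pos_divide_le_eq)
  qed
  finally show "cmod ((if x = 0 then 0 else (\<Sum>j<d'. e j * K x j) * complex_of_real (vnorm d x powr (s + \<alpha>)))
    - (if y = 0 then 0 else (\<Sum>j<d'. e j * K y j) * complex_of_real (vnorm d y powr (s + \<alpha>))))
    \<le> enn2real ?N * vnorm d (x - y) powr \<alpha>" .
qed

text \<open>
  The locale inherits the scalar theory for the kernel $\sum_j e_j K_j$ as a whole, rather than for its
  components, because the constants must not depend on \<^term>\<open>d'\<close>.
\<close>

locale reflectionless_measure = nice_measure d s \<Lambda> \<mu> for d s \<Lambda> \<mu> +
  fixes d' :: nat and \<alpha> :: real and K :: kernel and \<eta> :: "point \<Rightarrow> real" and e :: "nat \<Rightarrow> complex"
  assumes cz: "cz_kernel d d' s \<alpha> K" and reflectionless: "reflectionless d d' s \<alpha> K \<mu>"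
    and normalizer: "normalizer d \<mu> \<eta>" and e_unit: "cnorm d' e = 1"
begin

abbreviation N :: real where "N \<equiv> enn2real (kernel_seminorm d d' s \<alpha> K)"

sublocale kernel_measure d s \<Lambda> \<mu> \<alpha> N "\<lambda>x. \<Sum>j<d'. e j * K x j"
  by (intro kernel_measure.intro nice_measure_axioms holder_kernel_combination[OF exponent_pos cz]) (simp add: e_unit)

text \<open>The case of a coordinate vector. Reflectionlessness and the potential are componentwise
  notions, so identities and integrability are obtained for each component and summed; the estimates
  use the combined kernel.\<close>

lemma component: "j < d' \<Longrightarrow> kernel_measure d s \<Lambda> \<mu> \<alpha> N (\<lambda>x. K x j)"
proof -
  assume j: "j < d'"
  have eq: "(\<lambda>x. \<Sum>i<d'. (if i = j then 1 else 0) * K x i) = (\<lambda>x. K x j)"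
    using j by (simp add: if_distrib[of "\<lambda>a. a * _"] cong: if_cong)
  have "cnorm d' (\<lambda>i. if i = j then 1 else 0) = 1"
    using j unfolding cnorm_def L2_set_def by (simp add: if_distrib[of cmod] if_distrib[of "\<lambda>a. a\<^sup>2"] cong: if_cong)
  then have "holder_kernel d s \<alpha> N (\<lambda>x. \<Sum>i<d'. (if i = j then 1 else 0) * K x i)"
    by (intro holder_kernel_combination[OF exponent_pos cz]) simp
  then show ?thesis
    unfolding eq by (intro kernel_measure.intro nice_measure_axioms)
qed

definition V :: "real \<Rightarrow> point \<Rightarrow> complex" where
  "V \<delta> x = (\<Sum>j<d'. e j * T_bar d s \<alpha> K \<mu> \<eta> \<delta> (\<lambda>_. 1) x j)"

lemma T_bar_component: "T_bar d s \<alpha> K \<mu> \<eta> \<delta> \<phi> x j = T_bar d s \<alpha> (\<lambda>x _. K x j) \<mu> \<eta> \<delta> \<phi> x j"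
  by (simp add: T_bar_def form_def K_reg_def K_loc_def)

lemma form_ext_component: "form_ext d \<mu> K f \<phi> j = form_ext d \<mu> (\<lambda>x _. K x j) f \<phi> j"
  by (simp add: form_ext_def form_def T_op_def)

lemma kr_combination: "kr \<delta> u = (\<Sum>j<d'. e j * K_reg d s \<alpha> (\<lambda>x _. K x j) \<delta> u j)"
  by (simp add: kr_def K_reg_def sum_distrib_right algebra_simps)

lemma kl_combination: "kl \<delta> u = (\<Sum>j<d'. e j * K_loc d s \<alpha> (\<lambda>x _. K x j) \<delta> u j)"
  by (simp add: kl_def kr_combination K_loc_def right_diff_distrib sum_subtractf K_reg_def)

lemma V_diff:
  assumes \<delta>: "0 < \<delta>" and x: "x \<in> Rd d" and z: "z \<in> Rd d"
  shows "V \<delta> x - V \<delta> z = (LINT y | \<mu>. kr \<delta> (y - x) - kr \<delta> (y - z))"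
proof -
  let ?R = "\<lambda>j u. K_reg d s \<alpha> (\<lambda>x _. K x j) \<delta> u j"
  have *: "integrable \<mu> (\<lambda>y. ?R j (y - x) - ?R j (y - z)) \<and>
     T_bar d s \<alpha> K \<mu> \<eta> \<delta> (\<lambda>_. 1) x j - T_bar d s \<alpha> K \<mu> \<eta> \<delta> (\<lambda>_. 1) z j = (LINT y | \<mu>. ?R j (y - x) - ?R j (y - z))"
    if j: "j < d'" for j
  proof -
    interpret Kj: kernel_measure d s \<Lambda> \<mu> \<alpha> N "\<lambda>x. K x j" by (rule component[OF j])
    show ?thesis
      unfolding T_bar_component[of _ _ _ j] Kj.K_reg_Kc
      using Kj.kr_diff_integrable[OF \<delta> x z] Kj.T_bar_diff[OF \<delta> normalizer x z, of j] by simp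
  qed
  have "V \<delta> x - V \<delta> z = (\<Sum>j<d'. e j * (LINT y | \<mu>. ?R j (y - x) - ?R j (y - z)))"
    unfolding V_def sum_subtractf[symmetric] right_diff_distrib[symmetric] using * by (intro sum.cong) auto
  also have "\<dots> = (LINT y | \<mu>. (\<Sum>j<d'. e j * (?R j (y - x) - ?R j (y - z))))"
    using * by (subst Bochner_Integration.integral_sum) auto
  also have "\<dots> = (LINT y | \<mu>. kr \<delta> (y - x) - kr \<delta> (y - z))"
    unfolding kr_combination sum_subtractf[symmetric] right_diff_distrib[symmetric] ..
  finally show ?thesis .
qed

lemma V_identity:
  assumes \<delta>: "0 < \<delta>" and f: "f \<in> Lip0 d"
  shows "integrable \<mu> (\<lambda>x. V \<delta> x * f x)"
    and "(LINT x | \<mu>. V \<delta> x * f x) = - (LINT p | (\<mu> \<Otimes>\<^sub>M \<mu>). kl \<delta> (fst p - snd p) * H_form f (\<lambda>_. 1) (fst p) (snd p))"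
proof -
  let ?T = "\<lambda>j x. T_bar d s \<alpha> K \<mu> \<eta> \<delta> (\<lambda>_. 1) x j"
  let ?L = "\<lambda>j p. K_loc d s \<alpha> (\<lambda>x _. K x j) \<delta> (fst p - snd p) j * H_form f (\<lambda>_. 1) (fst p) (snd p)"
  have *: "integrable \<mu> (\<lambda>x. ?T j x * f x)" "(LINT x | \<mu>. ?T j x * f x) = - (LINT p | (\<mu> \<Otimes>\<^sub>M \<mu>). ?L j p)"
    "integrable (\<mu> \<Otimes>\<^sub>M \<mu>) (?L j)" if j: "j < d'" for j
  proof -
    interpret Kj: kernel_measure d s \<Lambda> \<mu> \<alpha> N "\<lambda>x. K x j" by (rule component[OF j])
    have form0: "form_ext d \<mu> (\<lambda>x _. K x j) g (\<lambda>_. 1) j = 0" if "g \<in> Lip0 d" "(LINT x | \<mu>. g x) = 0" for g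
      using reflectionless that j unfolding reflectionless_def form_ext_component[symmetric] by blast
    show "integrable \<mu> (\<lambda>x. ?T j x * f x)"
      unfolding T_bar_component[of _ _ _ j] by (rule Kj.potential_identity(1)[OF \<delta> normalizer f form0])
    have L: "Kj.kl \<delta> u = K_loc d s \<alpha> (\<lambda>x _. K x j) \<delta> u j" for u
      by (simp add: K_loc_def Kj.kl_def Kj.K_reg_Kc)
    show "integrable (\<mu> \<Otimes>\<^sub>M \<mu>) (?L j)"
      using Kj.form_loc_one_integrable[OF \<delta> f] unfolding L .
    show "(LINT x | \<mu>. ?T j x * f x) = - (LINT p | (\<mu> \<Otimes>\<^sub>M \<mu>). ?L j p)"
    proof -
      have "(LINT x | \<mu>. ?T j x * f x) = (LINT x | \<mu>. T_bar d s \<alpha> (\<lambda>x _. K x j) \<mu> \<eta> \<delta> (\<lambda>_. 1) x j * f x)"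
        by (intro Bochner_Integration.integral_cong refl arg_cong2[where f = "(*)"] T_bar_component)
      also have "\<dots> = - form \<mu> (K_loc d s \<alpha> (\<lambda>x _. K x j) \<delta>) f (\<lambda>_. 1) j"
        by (rule Kj.potential_identity(2)[OF \<delta> normalizer f form0])
      finally show ?thesis unfolding form_def .
    qed
  qed
  have V: "V \<delta> x * f x = (\<Sum>j<d'. e j * (?T j x * f x))" for x
    by (simp add: V_def sum_distrib_right mult.assoc)
  show "integrable \<mu> (\<lambda>x. V \<delta> x * f x)"
    unfolding V using * by (intro Bochner_Integration.integrable_sum integrable_mult_right) auto
  have "(LINT x | \<mu>. V \<delta> x * f x) = (\<Sum>j<d'. e j * (LINT x | \<mu>. ?T j x * f x))"
    unfolding V using * by (subst Bochner_Integration.integral_sum) auto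
  also have "\<dots> = - (\<Sum>j<d'. e j * (LINT p | (\<mu> \<Otimes>\<^sub>M \<mu>). ?L j p))"
    using *(2) by (simp add: sum_negf)
  also have "(\<Sum>j<d'. e j * (LINT p | (\<mu> \<Otimes>\<^sub>M \<mu>). ?L j p)) = (LINT p | (\<mu> \<Otimes>\<^sub>M \<mu>). (\<Sum>j<d'. e j * ?L j p))"
    using *(3) by (subst Bochner_Integration.integral_sum) auto
  also have "\<dots> = (LINT p | (\<mu> \<Otimes>\<^sub>M \<mu>). kl \<delta> (fst p - snd p) * H_form f (\<lambda>_. 1) (fst p) (snd p))"
    by (simp add: kl_combination sum_distrib_right mult.assoc)
  finally show "(LINT x | \<mu>. V \<delta> x * f x) = - (LINT p | (\<mu> \<Otimes>\<^sub>M \<mu>). kl \<delta> (fst p - snd p) * H_form f (\<lambda>_. 1) (fst p) (snd p))" .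
qed

text \<open>The potential is tested with a bump. Its \<open>H_form\<close> against 1 has Lipschitz
  constant 1/(2g), whose factor 1/2 offsets that of \<epsilon>/2. The second \<open>g\<close> in the
  outer radius is room for the interaction: as \<delta> \<le> g, a point beyond \<rho> + 2g
  interacts only with points beyond \<rho> + g, where the bump is 0 as well.\<close>

lemma growth_step:
  assumes \<delta>: "0 < \<delta>" "\<delta> \<le> g" and c: "c \<in> Rd d"
    and V: "\<And>x. x \<in> rball d c (\<rho> + g) \<Longrightarrow> \<epsilon> / 2 \<le> Re (V \<delta> x)" and \<epsilon>: "0 < \<epsilon>"
  shows "\<epsilon> * measure \<mu> (rball d c \<rho>) \<le> C_near * (\<delta> / g) * measure \<mu> (rball d c (\<rho> + 2 * g))"
proof -
  have g: "0 < g" using \<delta> by linarith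
  define f where "f x = complex_of_real (bump d c \<rho> g x)" for x
  have f: "f \<in> Lip0 d" unfolding f_def by (rule bump_in_Lip0[OF g])
  note [measurable] = Lip0_measurable[OF f]
  have outside: "bump d c \<rho> g x = 0" if "x \<in> Rd d" "x \<notin> rball d c (\<rho> + g)" for x
    using that by (intro bump_eq_0 g) (auto simp: rball_def)
  have "\<epsilon> / 2 * measure \<mu> (rball d c \<rho>) = (LINT x | \<mu>. \<epsilon> / 2 * indicator (rball d c \<rho>) x)"
    using rball_subset_Rd[of d c \<rho>] by (simp add: space_\<mu> Int_absorb2)
  also have "\<dots> \<le> (LINT x | \<mu>. Re (V \<delta> x * f x))"
  proof (rule integral_mono)
    show "integrable \<mu> (\<lambda>x. \<epsilon> / 2 * indicator (rball d c \<rho>) x :: real)"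
      using emeasure_rball_finite[OF c, of \<rho>] by (intro integrable_mult_right integrable_real_indicator) auto
    show "integrable \<mu> (\<lambda>x. Re (V \<delta> x * f x))"
      using V_identity(1)[OF \<delta>(1) f] by (rule integrable_Re)
    fix x assume "x \<in> space \<mu>"
    then have x: "x \<in> Rd d" by (simp add: space_\<mu>)
    have re: "Re (V \<delta> x * f x) = Re (V \<delta> x) * bump d c \<rho> g x" by (simp add: f_def)
    show "\<epsilon> / 2 * indicator (rball d c \<rho>) x \<le> Re (V \<delta> x * f x)"
    proof (cases "x \<in> rball d c (\<rho> + g)")
      case True
      have "indicator (rball d c \<rho>) x \<le> bump d c \<rho> g x"
        using bump_eq_1[OF g, of d x c \<rho>] by (auto simp: indicator_def rball_def)
      then have "\<epsilon> / 2 * indicator (rball d c \<rho>) x \<le> \<epsilon> / 2 * bump d c \<rho> g x"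
        using \<epsilon> by (intro mult_left_mono) auto
      also have "\<dots> \<le> Re (V \<delta> x) * bump d c \<rho> g x"
        using V[OF True] by (intro mult_right_mono) auto
      finally show ?thesis unfolding re .
    next
      case False
      then have "x \<notin> rball d c \<rho>" using rball_mono[of \<rho> "\<rho> + g" d c] g by auto
      then show ?thesis using outside[OF x False] unfolding re by simp
    qed
  qed
  also have "\<dots> = Re (LINT x | \<mu>. V \<delta> x * f x)"
    by (rule integral_Re[OF V_identity(1)[OF \<delta>(1) f]])
  also have "\<dots> \<le> cmod (LINT x | \<mu>. V \<delta> x * f x)" by (rule complex_Re_le_cmod)
  also have "\<dots> = cmod (LINT p | (\<mu> \<Otimes>\<^sub>M \<mu>). kl \<delta> (fst p - snd p) * H_form f (\<lambda>_. 1) (fst p) (snd p))"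
    unfolding V_identity(2)[OF \<delta>(1) f] by simp
  also have "\<dots> \<le> (1 / g) / 2 * C_near * \<delta> * measure \<mu> (rball d c (\<rho> + 2 * g))"
  proof (rule kl_pair_integrable(2)[OF \<delta>(1) _ c])
    show "(\<lambda>p. H_form f (\<lambda>_. 1) (fst p) (snd p)) \<in> borel_measurable (\<mu> \<Otimes>\<^sub>M \<mu>)" by measurable
    show "0 \<le> 1 / g / 2" using g by simp
    fix x y assume x: "x \<in> Rd d" and y: "y \<in> Rd d"
    have H: "H_form f (\<lambda>_. 1) x y = complex_of_real (bump d c \<rho> g y - bump d c \<rho> g x) / 2"
      by (simp add: H_form_def f_def)
    show "cmod (H_form f (\<lambda>_. 1) (fst (x, y)) (snd (x, y))) \<le> 1 / g / 2 * vnorm d (x - y)"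
      using bump_lipschitz[OF g, of d c \<rho> y x]
      unfolding fst_conv snd_conv H norm_divide norm_of_real vnorm_commute[of d x y] by simp
    assume xy: "vnorm d (x - y) < \<delta>" and out: "y \<notin> rball d c (\<rho> + 2 * g)"
    have "y \<notin> rball d c (\<rho> + g)" using out rball_mono[of "\<rho> + g" "\<rho> + 2 * g" d c] g by auto
    moreover have "x \<notin> rball d c (\<rho> + g)"
      using out y xy \<delta>(2) vnorm_triangle_sub[of d y c x] vnorm_commute[of d x y] by (auto simp: rball_def)
    ultimately show "H_form f (\<lambda>_. 1) (fst (x, y)) (snd (x, y)) = 0"
      using outside x y by (simp add: H_form_def f_def)
  qed
  finally show ?thesis using g by (simp add: field_simps)
qed

end

subsection \<open>Iteration\<close>

text \<open>
  The nearby point of $E$ must not leave the small balls of the iteration, so density is applied at a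
  point moved towards the centre.
\<close>

lemma dense_inward:
  assumes dense: "dense_in d q E (rball d c (2 * r))" and E: "E \<subseteq> Rd d" and c: "c \<in> Rd d" and q: "0 < q" "q \<le> r"
    and x: "x \<in> rball d c (2 * r)"
  obtains x' where "x' \<in> E" "vnorm d (x - x') \<le> 2 * q" "vnorm d (x' - c) \<le> max (vnorm d (x - c)) q"
proof (cases "vnorm d (x - c) \<le> q")
  case True
  have "c \<in> rball d c (2 * r)" using c q by (simp add: rball_def)
  then obtain x' where x': "x' \<in> E" "vnorm d (c - x') \<le> q" using dense by (auto simp: dense_in_def)
  show ?thesis
    using x' True vnorm_triangle_sub[of d x x' c] vnorm_commute[of d c x'] by (intro that[of x']) auto
next
  case False
  define R where "R = vnorm d (x - c)"
  have R: "q < R" "R < 2 * r" using False x by (auto simp: R_def rball_def)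
  \<comment> \<open>The point \<open>x\<close> moved towards the centre by exactly \<open>q\<close>.
    Density at \<open>w\<close> costs another \<open>q\<close>, so the point found is within 2q of
    \<open>x\<close> and no farther from the centre than \<open>x\<close>.\<close>
  define w where "w = x - (\<lambda>i. q / R * (x - c) i)"
  have xR: "x \<in> Rd d" using x by (simp add: rball_def)
  have wR: "w \<in> Rd d" unfolding w_def by (intro Rd_diff Rd_scale xR c)
  have "x - w = (\<lambda>i. q / R * (x - c) i)" unfolding w_def by simp
  then have "vnorm d (x - w) = \<bar>q / R\<bar> * R" by (simp only: vnorm_scale R_def)
  then have xw: "vnorm d (x - w) = q" using q R by simp
  have "w - c = (\<lambda>i. (1 - q / R) * (x - c) i)"
    unfolding w_def by (rule ext) (simp add: algebra_simps)
  then have "vnorm d (w - c) = \<bar>1 - q / R\<bar> * R" by (simp only: vnorm_scale R_def)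
  also have "\<dots> = R - q" using q R by (simp add: field_simps)
  finally have wc: "vnorm d (w - c) = R - q" .
  then have "w \<in> rball d c (2 * r)" using wR R q by (simp add: rball_def)
  then obtain x' where x': "x' \<in> E" "vnorm d (w - x') \<le> q" using dense by (auto simp: dense_in_def)
  have "vnorm d (x - x') \<le> 2 * q" using vnorm_triangle_sub[of d x x' w] xw x' by simp
  moreover have "vnorm d (x' - c) \<le> R"
    using vnorm_triangle_sub[of d x' c w] wc x'(2) vnorm_commute[of d w x'] by simp
  ultimately show ?thesis using x'(1) by (intro that[of x']) (auto simp: R_def)
qed

context kernel_measure
begin

text \<open>On the j-th layer the kernel is at most (l r 2^{-j})^{-s} and the measure at most \<tau>
  r^s 2^{-(s+1)j}, so the layer contributes \<tau> l^{-s} 2^{-j}. For j < n the kernel bound comes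
  from the distance of \<open>x\<close> to the layer, for j = n from the truncation at
  \<delta>.\<close>

lemma kr_shell_integral:
  fixes n :: nat and r \<tau> l :: real and c :: point
  defines "m \<equiv> \<lambda>j::nat. measure \<mu> (rball d c (r * (1 + 1 / 2 ^ Suc j)))"
  assumes c: "c \<in> Rd d" and r: "0 < r" and l: "0 < l" "l \<le> 1 / 16" and \<tau>: "0 \<le> \<tau>"
    and m: "\<And>j. j \<le> n \<Longrightarrow> m j \<le> \<tau> * r powr s * (2 powr (- (s + 1))) ^ j"
    and x: "x \<in> Rd d" "vnorm d (x - c) < r * (1 + 1 / 2 ^ Suc (Suc n)) + r / 2 ^ (n + 3)"
  shows "(\<integral>\<^sup>+y. ennreal (cmod (kr (l * r / 2 ^ n) (y - x))) * indicator (rball d c (r * (3 / 2))) y \<partial>\<mu>)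
    \<le> ennreal (2 * \<tau> * l powr (- s))"
proof -
  define \<delta> where "\<delta> = l * r / 2 ^ n"
  have \<delta>: "0 < \<delta>" using l r by (simp add: \<delta>_def)
  let ?w = "\<lambda>y. ennreal (cmod (kr \<delta> (y - x))) * indicator (rball d c (r * (3 / 2))) y"
  define A where "A j = (if j \<le> n then rball d c (r * (1 + 1 / 2 ^ Suc j)) else {})" for j
  define a where "a j = (l * r / 2 ^ j) powr (- s)" for j :: nat
  have "(\<integral>\<^sup>+y. ?w y \<partial>\<mu>) \<le> ennreal (\<tau> * l powr (- s) / (1 - 1 / 2))"
  proof (rule nn_integral_shells[where A = A and c = a])
    show "A j \<in> sets \<mu>" for j by (simp add: A_def)
    show "?w y = 0 \<or> (\<exists>j. y \<in> A j \<and> ?w y \<le> ennreal (a j))" if y: "y \<in> Rd d" for y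
    proof (cases "y \<in> rball d c (r * (3 / 2))")
      case True
      \<comment> \<open>The least such index is the layer of \<open>y\<close>; the alternative
        \<open>n \<le> j\<close> puts everything inside the smallest ball into layer n.\<close>
      let ?P = "\<lambda>j. n \<le> j \<or> y \<notin> rball d c (r * (1 + 1 / 2 ^ Suc (Suc j)))"
      have "\<exists>j. ?P j" by blast
      then obtain j where j: "?P j" "\<And>i. i < j \<Longrightarrow> \<not> ?P i"
        using exists_least_iff[of ?P] by blast
      have jn: "j \<le> n" using j(2)[of n] by (meson not_le order_refl)
      have "y \<in> rball d c (r * (1 + 1 / 2 ^ Suc j))"
      proof (cases j)
        case 0
        then show ?thesis using True by simp
      next
        case (Suc i)
        then show ?thesis using j(2)[of i] by simp
      qed
      then have yA: "y \<in> A j" using jn by (simp add: A_def)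
      have "l * r / 2 ^ j \<le> max \<delta> (vnorm d (y - x))"
      proof (cases "j = n")
        case True
        then show ?thesis by (simp add: \<delta>_def)
      next
        case False
        then have lt: "Suc j \<le> n" using jn by simp
        have "(2::real) ^ Suc j \<le> 2 ^ n" using lt by (intro power_increasing) auto
        then have le: "1 / (2::real) ^ n \<le> 1 / 2 ^ j / 2" using frac_le[of 1 1 "2 ^ Suc j" "(2::real) ^ n"] by simp
        have "y \<notin> rball d c (r * (1 + 1 / 2 ^ Suc (Suc j)))" using j(1) lt by simp
        then have "r * (1 + 1 / 2 ^ Suc (Suc j)) \<le> vnorm d (y - c)" using y by (simp add: rball_def)
        moreover have "vnorm d (y - c) \<le> vnorm d (y - x) + vnorm d (x - c)" by (rule vnorm_triangle_sub)
        ultimately have 1: "r * (1 + 1 / 2 ^ Suc (Suc j)) - (r * (1 + 1 / 2 ^ Suc (Suc n)) + r / 2 ^ (n + 3)) \<le> vnorm d (y - x)"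
          using x(2) by linarith
        \<comment> \<open>With 2^{-n} \<le> 2^{-j}/2 the gap is at least (1/4 - 3/16) 2^{-j} r; this
          is where the bound 1/16 on \<open>l\<close> comes from.\<close>
        have "r * (1 + 1 / 2 ^ Suc (Suc j)) - (r * (1 + 1 / 2 ^ Suc (Suc n)) + r / 2 ^ (n + 3))
          = r * ((1 / 2 ^ j) / 4 - (3 / 8) * (1 / 2 ^ n))"
          by (simp add: power_add field_simps)
        also have "\<dots> \<ge> r * ((1 / 2 ^ j) / 16)"
          using r le by (intro mult_left_mono) auto
        finally have "r * ((1 / 2 ^ j) / 16) \<le> vnorm d (y - x)" using 1 by linarith
        moreover have "l * r / 2 ^ j \<le> r * ((1 / 2 ^ j) / 16)"
          using l r mult_right_mono[of l "1/16" "r / 2 ^ j"] by simp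
        ultimately show ?thesis by simp
      qed
      then have "cmod (kr \<delta> (y - x)) \<le> a j"
        unfolding a_def using \<delta> l r x(1) y by (intro kr_bound') auto
      then show ?thesis
        by (intro disjI2 exI[of _ j] conjI yA) (simp only: indicator_simps(1)[OF True] mult_1_right ennreal_leI)
    qed simp
    show "ennreal (a j) * emeasure \<mu> (A j) \<le> ennreal (\<tau> * l powr (- s) * (1 / 2) ^ j)" for j
    proof (cases "j \<le> n")
      case True
      have "ennreal (a j) * emeasure \<mu> (A j) = ennreal (a j * m j)"
        using True emeasure_rball_finite[OF c, of "r * (1 + 1 / 2 ^ Suc j)"]
        by (simp add: A_def m_def emeasure_eq_ennreal_measure ennreal_mult a_def del: power_Suc)
      also have "\<dots> \<le> ennreal (a j * (\<tau> * r powr s * (2 powr (- (s + 1))) ^ j))"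
        using m[OF True] by (intro ennreal_leI mult_left_mono) (auto simp: a_def)
      also have "a j * (\<tau> * r powr s * (2 powr (- (s + 1))) ^ j) = \<tau> * l powr (- s) * (1 / 2) ^ j"
      proof -
        have 1: "a j = l powr (- s) * r powr (- s) * (2 powr s) ^ j"
        proof -
          have "(2 ^ j) powr (- s) = inverse ((2 powr s) ^ j :: real)"
            by (simp add: powr_minus powr_realpow[symmetric] powr_powr mult.commute)
          then show ?thesis unfolding a_def powr_divide powr_mult by (simp add: divide_inverse)
        qed
        have 2: "r powr (- s) * r powr s = 1" using r by (simp add: powr_add[symmetric])
        have 3: "(2 powr s) ^ j * (2 powr (- (s + 1))) ^ j = (1 / 2 :: real) ^ j"
          by (subst power_mult_distrib[symmetric]) (simp add: powr_add[symmetric] powr_minus_divide)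
        have "a j * (\<tau> * r powr s * (2 powr (- (s + 1))) ^ j) = \<tau> * l powr (- s)
          * ((r powr (- s) * r powr s) * ((2 powr s) ^ j * (2 powr (- (s + 1))) ^ j))"
          unfolding 1 by (simp only: ac_simps)
        then show ?thesis unfolding 2 3 by simp
      qed
      finally show ?thesis .
    qed (simp add: A_def)
  qed (use \<tau> in auto)
  also have "\<tau> * l powr (- s) / (1 - 1 / 2) = 2 * \<tau> * l powr (- s)" by simp
  finally show ?thesis unfolding \<delta>_def .
qed

end

section \<open>Oscillation of the potential and the iteration itself\<close>

context reflectionless_measure
begin

lemma V_oscillation:
  assumes \<delta>: "0 < \<delta>" and x: "x \<in> Rd d" and z: "z \<in> Rd d"
    and le: "(\<integral>\<^sup>+y. ennreal (cmod (kr \<delta> (y - x) - kr \<delta> (y - z))) \<partial>\<mu>) \<le> ennreal b" and b: "0 \<le> b"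
  shows "Re (V \<delta> z) - b \<le> Re (V \<delta> x)"
proof -
  have "ennreal (cmod (V \<delta> x - V \<delta> z)) \<le> ennreal b"
    unfolding V_diff[OF \<delta> x z]
    by (rule order_trans[OF integral_norm_bound_ennreal[OF kr_diff_integrable[OF \<delta> x z]] le])
  then have "cmod (V \<delta> x - V \<delta> z) \<le> b" using b by simp
  then show ?thesis using abs_Re_le_cmod[of "V \<delta> x - V \<delta> z"] by simp
qed

text \<open>On \<open>S\<close> the two kernels are too close to their singularities for
  cancellation and are estimated by size, each costing \<open>a\<close>; off \<open>S\<close> their
  difference is Hoelder at scale \<open>t\<close>.\<close>

lemma V_oscillation_outside:
  assumes \<delta>: "0 < \<delta>" and x: "x \<in> Rd d" and z: "z \<in> Rd d" and S [measurable]: "S \<in> sets \<mu>" and t: "0 < t"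
    and far: "\<And>y. y \<in> Rd d - S \<Longrightarrow> t \<le> vnorm d (y - x) \<and> t \<le> vnorm d (y - z)"
    and Sx: "(\<integral>\<^sup>+y. ennreal (cmod (kr \<delta> (y - x))) * indicator S y \<partial>\<mu>) \<le> ennreal a"
    and Sz: "(\<integral>\<^sup>+y. ennreal (cmod (kr \<delta> (y - z))) * indicator S y \<partial>\<mu>) \<le> ennreal a" and a: "0 \<le> a"
  shows "Re (V \<delta> z) - (2 * a + 2 * C_far * (vnorm d (x - z) / t) powr \<alpha>) \<le> Re (V \<delta> x)"
proof (rule V_oscillation[OF \<delta> x z])
  have [measurable]: "x \<in> space \<mu>" "z \<in> space \<mu>" using x z by (auto simp: space_\<mu>)
  note [measurable] = kr_measurable[OF \<delta>]
  let ?f = "\<lambda>w y. ennreal (cmod (kr \<delta> (y - w))) * indicator S y"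
  let ?h = "\<lambda>y. ennreal (cmod (kr \<delta> (y - x) - kr \<delta> (y - z))) * indicator (Rd d - S) y"
  have fm: "?f x \<in> borel_measurable \<mu>" "?f z \<in> borel_measurable \<mu>" by measurable
  have hm: "?h \<in> borel_measurable \<mu>"
  proof -
    have "Rd d - S \<in> sets \<mu>" using sets.compl_sets[OF S] by (simp add: space_\<mu>)
    then show ?thesis by measurable
  qed
  let ?b = "2 * C_far * (vnorm d (x - z) / t) powr \<alpha>"
  have b: "0 \<le> ?b" using C_far_pos by simp
  have "(\<integral>\<^sup>+y. ennreal (cmod (kr \<delta> (y - x) - kr \<delta> (y - z))) \<partial>\<mu>) \<le> (\<integral>\<^sup>+y. (?f x y + ?f z y) + ?h y \<partial>\<mu>)"
  proof (rule nn_integral_mono)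
    fix y assume "y \<in> space \<mu>"
    then show "ennreal (cmod (kr \<delta> (y - x) - kr \<delta> (y - z))) \<le> (?f x y + ?f z y) + ?h y"
      by (cases "y \<in> S") (auto simp: space_\<mu> ennreal_plus[symmetric] norm_triangle_ineq4 simp del: ennreal_plus intro!: ennreal_leI)
  qed
  also have "\<dots> = ((\<integral>\<^sup>+y. ?f x y \<partial>\<mu>) + (\<integral>\<^sup>+y. ?f z y \<partial>\<mu>)) + (\<integral>\<^sup>+y. ?h y \<partial>\<mu>)"
    by (simp only: nn_integral_add[OF fm] nn_integral_add[OF borel_measurable_add[OF fm] hm])
  also have "\<dots> \<le> (ennreal a + ennreal a) + ennreal ?b"
  proof (intro add_mono Sx Sz kr_diff_bound_outside \<delta> t x z)
    fix y assume "y \<in> Rd d - S"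
    then show "y \<in> Rd d \<and> t \<le> max \<delta> (vnorm d (y - x)) \<and> t \<le> max \<delta> (vnorm d (y - z))"
      using far[of y] by auto
  qed
  also have "\<dots> = ennreal (2 * a + ?b)" using a b by (simp add: ennreal_plus[symmetric] del: ennreal_plus)
  finally show "(\<integral>\<^sup>+y. ennreal (cmod (kr \<delta> (y - x) - kr \<delta> (y - z))) \<partial>\<mu>) \<le> ennreal (2 * a + ?b)" .
  show "0 \<le> 2 * a + ?b" using a b by simp
qed

text \<open>Here \<open>l\<close> is \<delta> relative to r 2^{-n}, \<open>l\<^sub>0\<close> is
  \<delta> relative to r in the preliminary step, and \<tau> bounds the measure of the ball of
  radius 3r/2 relative to r^s. \<open>step\<close> yields the gain 2^{-(s+1)}, \<open>start\<close>
  lets the preliminary step reach \<tau>, and the other three inequalities keep the loss of the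
  potential between \<open>x\<close> and a nearby point of E below \<epsilon>/2. The induction is
  strong because each step uses the bounds for all larger balls.\<close>

lemma collapse:
  assumes c: "c \<in> Rd d" and r: "0 < r" and \<epsilon>: "0 < \<epsilon>" and \<kappa>: "0 < \<kappa>" "\<kappa> \<le> 1 / 16"
    and l: "0 < l" "l \<le> 1 / 16" and l\<^sub>0: "0 < l\<^sub>0" "l\<^sub>0 \<le> 1 / 4" and \<tau>: "0 \<le> \<tau>"
    and step: "8 * C_near * l \<le> 2 powr (- (s + 1)) * \<epsilon>"
    and near: "4 * \<tau> * l powr (- s) \<le> \<epsilon> / 4"
    and start: "4 * C_near * l\<^sub>0 * \<Lambda> * 2 powr s \<le> \<tau> * \<epsilon>"
    and osc\<^sub>0: "2 * C_far * (\<kappa> / l\<^sub>0) powr \<alpha> \<le> \<epsilon> / 2"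
    and osc: "2 * C_far * (16 * \<kappa>) powr \<alpha> \<le> \<epsilon> / 4"
    and dense: "dense_in d (\<kappa> * r) (E_set d d' s \<alpha> K \<mu> \<eta> e \<epsilon> r) (rball d c (2 * r))"
  shows "measure \<mu> (rball d c r) = 0"
proof -
  let ?E = "E_set d d' s \<alpha> K \<mu> \<eta> e \<epsilon> r" and ?\<theta> = "2 powr (- (s + 1)) :: real"
  define m where "m n = measure \<mu> (rball d c (r * (1 + 1 / 2 ^ Suc n)))" for n :: nat
  have E: "x \<in> Rd d" "0 < \<delta> \<Longrightarrow> \<delta> < r \<Longrightarrow> \<epsilon> \<le> Re (V \<delta> x)" if "x \<in> ?E" for x \<delta>
    using that by (auto simp: E_set_def V_def less_imp_le)
  have m0: "m 0 \<le> \<tau> * r powr s"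
  proof -
    \<comment> \<open>The choice \<rho> = 3r/2, g = r/4 lets \<rho> + 2g end at 2r, while the points
      tested stay inside the ball where E is dense.\<close>
    have "\<epsilon> * measure \<mu> (rball d c (r * (3 / 2))) \<le> C_near * (l\<^sub>0 * r / (r / 4)) * measure \<mu> (rball d c (r * (3 / 2) + 2 * (r / 4)))"
    proof (rule growth_step[OF _ _ c _ \<epsilon>])
      show \<delta>: "0 < l\<^sub>0 * r" using l\<^sub>0 r by simp
      show "l\<^sub>0 * r \<le> r / 4" using l\<^sub>0 r mult_right_mono[of l\<^sub>0 "1/4" r] by simp
      fix x assume "x \<in> rball d c (r * (3 / 2) + r / 4)"
      then have x: "x \<in> Rd d" "x \<in> rball d c (2 * r)" using r by (auto simp: rball_def)
      obtain x' where x': "x' \<in> ?E" "vnorm d (x - x') \<le> \<kappa> * r"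
        using dense x(2) by (auto simp: dense_in_def)
      have "Re (V (l\<^sub>0 * r) x') - 2 * C_far * (vnorm d (x - x') / (l\<^sub>0 * r)) powr \<alpha> \<le> Re (V (l\<^sub>0 * r) x)"
        using C_far_pos by (intro V_oscillation kr_diff_bound \<delta> x E(1)[OF x'(1)]) auto
      moreover have "2 * C_far * (vnorm d (x - x') / (l\<^sub>0 * r)) powr \<alpha> \<le> 2 * C_far * (\<kappa> / l\<^sub>0) powr \<alpha>"
        using C_far_pos \<alpha>_pos x'(2) \<delta> r l\<^sub>0 divide_right_mono[of "vnorm d (x - x')" "\<kappa> * r" "l\<^sub>0 * r"]
        by (intro mult_left_mono powr_mono2) auto
      moreover have "l\<^sub>0 * r < r" using l\<^sub>0 r by simp
      ultimately show "\<epsilon> / 2 \<le> Re (V (l\<^sub>0 * r) x)"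
        using E(2)[OF x'(1) \<delta>] osc\<^sub>0 by linarith
    qed
    also have "\<dots> = 4 * C_near * l\<^sub>0 * measure \<mu> (rball d c (2 * r))"
      using r by (simp add: ac_simps)
    also have "\<dots> \<le> 4 * C_near * l\<^sub>0 * (\<Lambda> * (2 * r) powr s)"
      using C_near_pos l\<^sub>0 r by (intro mult_left_mono measure_rball c) auto
    also have "\<dots> = (4 * C_near * l\<^sub>0 * \<Lambda> * 2 powr s) * r powr s" by (simp add: powr_mult)
    also have "\<dots> \<le> (\<tau> * \<epsilon>) * r powr s" using start by (intro mult_right_mono) auto
    finally have "\<epsilon> * measure \<mu> (rball d c (r * (3 / 2))) \<le> \<epsilon> * (\<tau> * r powr s)" by (simp add: ac_simps)
    then show ?thesis using \<epsilon> by (simp add: m_def)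
  qed
  have m: "m n \<le> \<tau> * r powr s * ?\<theta> ^ n" for n
  proof (induction n rule: less_induct)
    case (less n')
    show ?case
    proof (cases n')
      case 0
      then show ?thesis using m0 by simp
    next
      case (Suc n)
      have IH: "m j \<le> \<tau> * r powr s * ?\<theta> ^ j" if "j \<le> n" for j using less.IH[of j] that Suc by simp
      define \<delta> where "\<delta> = l * r / 2 ^ n"
      define \<rho> where "\<rho> = r * (1 + 1 / 2 ^ Suc (Suc n))"
      \<comment> \<open>A half of the difference of successive radii, so that \<rho> + 2g is the
        previous radius and the steps chain without loss.\<close>
      define g where "g = r / 2 ^ (n + 3)"
      have \<delta>: "0 < \<delta>" using l r by (simp add: \<delta>_def)
      have pow1: "1 / (2::real) ^ n \<le> 1" by simp
      have \<rho>g: "\<rho> + g \<le> 11 / 8 * r"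
      proof -
        have "\<rho> + g = r * (1 + 3 / 8 * (1 / 2 ^ n))" by (simp add: \<rho>_def g_def power_add field_simps)
        also have "\<dots> \<le> r * (1 + 3 / 8 * 1)" using r pow1 by (intro mult_left_mono add_left_mono) auto
        finally show ?thesis by simp
      qed
      have \<delta>r: "\<delta> < r"
      proof -
        have "\<delta> = l * r * (1 / 2 ^ n)" by (simp add: \<delta>_def)
        also have "\<dots> \<le> l * r * 1" using l r pow1 by (intro mult_left_mono) auto
        also have "\<dots> < r" using l r by simp
        finally show ?thesis .
      qed
      have "\<epsilon> * measure \<mu> (rball d c \<rho>) \<le> C_near * (\<delta> / g) * measure \<mu> (rball d c (\<rho> + 2 * g))"
      proof (rule growth_step[OF \<delta> _ c _ \<epsilon>])
        show "\<delta> \<le> g" using l r mult_right_mono[of l "1/8" "r / 2 ^ n"] by (simp add: \<delta>_def g_def power_add)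
        fix x assume x: "x \<in> rball d c (\<rho> + g)"
        then have xR: "x \<in> Rd d" and xc: "vnorm d (x - c) < \<rho> + g" by (auto simp: rball_def)
        have x2: "x \<in> rball d c (2 * r)" using x rball_mono[of "\<rho> + g" "2 * r" d c] \<rho>g r by auto
        have \<kappa>r: "0 < \<kappa> * r" "\<kappa> * r \<le> r" using \<kappa> r by auto
        have ER: "?E \<subseteq> Rd d" using E(1) by blast
        obtain x' where x': "x' \<in> ?E" "vnorm d (x - x') \<le> 2 * (\<kappa> * r)"
            "vnorm d (x' - c) \<le> max (vnorm d (x - c)) (\<kappa> * r)"
          by (rule dense_inward[OF dense ER c \<kappa>r x2])
        have "r < \<rho> + g" using r by (simp add: \<rho>_def g_def add_pos_pos distrib_left)
        then have x'c: "vnorm d (x' - c) < \<rho> + g" using x'(3) xc \<kappa>r by linarith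
        \<comment> \<open>The tested points lie within 11r/8 of the centre, hence r/8 away from the
          complement of the ball of radius 3r/2, uniformly in n.\<close>
        have far: "r / 8 \<le> vnorm d (y - w)" if "y \<in> Rd d - rball d c (r * (3 / 2))" "vnorm d (w - c) < \<rho> + g" for y w
          using that \<rho>g vnorm_triangle_sub[of d y c w] by (auto simp: rball_def)
        have shell: "(\<integral>\<^sup>+y. ennreal (cmod (kr \<delta> (y - w))) * indicator (rball d c (r * (3 / 2))) y \<partial>\<mu>)
          \<le> ennreal (2 * \<tau> * l powr (- s))" if "w \<in> Rd d" "vnorm d (w - c) < \<rho> + g" for w
          unfolding \<delta>_def
          by (rule kr_shell_integral[OF c r l \<tau> IH[unfolded m_def] that(1)])
            (use that(2) in \<open>auto simp: \<rho>_def g_def\<close>)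
        have r8: "0 < r / 8" and \<tau>l: "0 \<le> 2 * \<tau> * l powr (- s)" using r \<tau> by auto
        have "Re (V \<delta> x') - (2 * (2 * \<tau> * l powr (- s)) + 2 * C_far * (vnorm d (x - x') / (r / 8)) powr \<alpha>) \<le> Re (V \<delta> x)"
          using far[OF _ xc] far[OF _ x'c]
          by (intro V_oscillation_outside[OF \<delta> xR E(1)[OF x'(1)] rball_sets r8 _ shell[OF xR xc] shell[OF E(1)[OF x'(1)] x'c] \<tau>l]) auto
        \<comment> \<open>A distance of at most 2 \<kappa> r divided by r/8 gives 16 \<kappa>. This
          term and the one from the layers cost \<epsilon>/4 each.\<close>
        moreover have "2 * C_far * (vnorm d (x - x') / (r / 8)) powr \<alpha> \<le> 2 * C_far * (16 * \<kappa>) powr \<alpha>"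
          using C_far_pos \<alpha>_pos x'(2) r
          by (intro mult_left_mono powr_mono2) (auto simp: field_simps)
        ultimately show "\<epsilon> / 2 \<le> Re (V \<delta> x)"
          using E(2)[OF x'(1) \<delta> \<delta>r] near osc by linarith
      qed
      also have "\<rho> + 2 * g = r * (1 + 1 / 2 ^ Suc n)" by (simp add: \<rho>_def g_def power_add field_simps)
      \<comment> \<open>Both \<delta> and \<open>g\<close> are proportional to 2^{-n}, hence
        \<delta> / g = 8 l in every step.\<close>
      also have "C_near * (\<delta> / g) * measure \<mu> (rball d c (r * (1 + 1 / 2 ^ Suc n))) = (8 * C_near * l) * m n"
        using r by (simp add: \<delta>_def g_def m_def power_add)
      also have "\<dots> \<le> (?\<theta> * \<epsilon>) * (\<tau> * r powr s * ?\<theta> ^ n)"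
        using \<epsilon> by (intro mult_mono[OF step IH]) (auto simp: m_def)
      finally have "\<epsilon> * measure \<mu> (rball d c \<rho>) \<le> \<epsilon> * (\<tau> * r powr s * ?\<theta> ^ n')"
        using Suc by (simp add: ac_simps)
      then show ?thesis using \<epsilon> Suc by (simp add: m_def \<rho>_def)
    qed
  qed
  have "(\<lambda>n. \<tau> * r powr s * ?\<theta> ^ n) \<longlonglongrightarrow> \<tau> * r powr s * 0"
    using powr_less_one[of 2 "- (s + 1)"] s_pos by (intro tendsto_intros LIMSEQ_realpow_zero) auto
  moreover have "measure \<mu> (rball d c r) \<le> \<tau> * r powr s * ?\<theta> ^ n" for n
  proof -
    have "measure \<mu> (rball d c r) \<le> m n"
      unfolding m_def using r emeasure_rball_finite[OF c]
      by (intro measure_mono_fmeasurable rball_mono) (auto simp: fmeasurable_def distrib_left)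
    then show ?thesis using m[of n] by linarith
  qed
  ultimately have "measure \<mu> (rball d c r) \<le> \<tau> * r powr s * 0"
    by (intro LIMSEQ_le_const) auto
  then show ?thesis using measure_nonneg[of \<mu> "rball d c r"] by simp
qed

end

text \<open>The conditions of \<open>collapse\<close> are solved in the order \<open>l\<close>,
  \<tau>, \<open>l\<^sub>0\<close>, \<kappa>: the gain forces \<open>l\<close> to be of order
  \<epsilon>, the layers force \<tau> to be of order \<epsilon>^{s+1}, the preliminary step forces
  \<open>l\<^sub>0\<close> to be of order \<epsilon> \<tau>, and continuity at that scale bounds
  \<kappa>. The arguments \<open>C\<^sub>1\<close> and \<open>C\<^sub>2\<close> stand for
  \<open>C_near\<close> and \<open>C_far\<close>.\<close>

lemma collapse_constants:
  fixes s \<alpha> \<Lambda> C\<^sub>1 C\<^sub>2 :: real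
  assumes "0 < s" "0 < \<alpha>" "0 < \<Lambda>" "0 < C\<^sub>1" "0 < C\<^sub>2"
  obtains c\<^sub>9 where "0 < c\<^sub>9"
    "\<And>\<epsilon> \<kappa>. 0 < \<epsilon> \<Longrightarrow> \<epsilon> < 1 / 2 \<Longrightarrow> 0 < \<kappa> \<Longrightarrow> \<kappa> \<le> c\<^sub>9 * \<epsilon> powr (s + 2 + 1 / \<alpha>) \<Longrightarrow>
      \<exists>l l\<^sub>0 \<tau>. \<kappa> \<le> 1 / 16 \<and> 0 < l \<and> l \<le> 1 / 16 \<and> 0 < l\<^sub>0 \<and> l\<^sub>0 \<le> 1 / 4 \<and> 0 \<le> \<tau>
        \<and> 8 * C\<^sub>1 * l \<le> 2 powr (- (s + 1)) * \<epsilon>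
        \<and> 4 * \<tau> * l powr (- s) \<le> \<epsilon> / 4
        \<and> 4 * C\<^sub>1 * l\<^sub>0 * \<Lambda> * 2 powr s \<le> \<tau> * \<epsilon>
        \<and> 2 * C\<^sub>2 * (\<kappa> / l\<^sub>0) powr \<alpha> \<le> \<epsilon> / 2
        \<and> 2 * C\<^sub>2 * (16 * \<kappa>) powr \<alpha> \<le> \<epsilon> / 4"
proof -
  define b where "b = min (1 / 16) (2 powr (- (s + 1)) / (8 * C\<^sub>1))"
  define c\<^sub>0 where "c\<^sub>0 = min (1 / 4) (b powr s / (64 * C\<^sub>1 * \<Lambda> * 2 powr s))"
  define a where "a = min 1 ((1 / (8 * C\<^sub>2)) powr (1 / \<alpha>))"
  \<comment> \<open>The factor 1/16 absorbs the 16 in \<open>16 * \<kappa>\<close>; together with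
    \<open>a \<le> 1\<close> it also yields \<open>\<kappa> \<le> 1 / 16\<close>.\<close>
  define c\<^sub>9 where "c\<^sub>9 = 1 / 16 * c\<^sub>0 * a"
  have b: "0 < b" "b \<le> 1 / 16" "8 * C\<^sub>1 * b \<le> 2 powr (- (s + 1))"
  proof -
    have "b \<le> 2 powr (- (s + 1)) / (8 * C\<^sub>1)" unfolding b_def by (rule min.cobounded2)
    then show "8 * C\<^sub>1 * b \<le> 2 powr (- (s + 1))" using assms(4) by (simp add: pos_le_divide_eq mult.commute)
    show "0 < b" using assms by (simp add: b_def)
    show "b \<le> 1 / 16" unfolding b_def by (rule min.cobounded1)
  qed
  have c0: "0 < c\<^sub>0" "c\<^sub>0 \<le> 1 / 4" "64 * C\<^sub>1 * \<Lambda> * 2 powr s * c\<^sub>0 \<le> b powr s"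
  proof -
    have "c\<^sub>0 \<le> b powr s / (64 * C\<^sub>1 * \<Lambda> * 2 powr s)" unfolding c\<^sub>0_def by (rule min.cobounded2)
    then show "64 * C\<^sub>1 * \<Lambda> * 2 powr s * c\<^sub>0 \<le> b powr s" using assms by (simp add: pos_le_divide_eq mult.commute)
    show "0 < c\<^sub>0" using assms b by (simp add: c\<^sub>0_def)
    show "c\<^sub>0 \<le> 1 / 4" unfolding c\<^sub>0_def by (rule min.cobounded1)
  qed
  have a: "0 < a" "a \<le> 1" "a \<le> (1 / (8 * C\<^sub>2)) powr (1 / \<alpha>)"
    using assms by (auto simp: a_def)
  show ?thesis
  proof (rule that)
    show "0 < c\<^sub>9" using a c0 by (simp add: c\<^sub>9_def)
    fix \<epsilon> \<kappa> :: real
    assume \<epsilon>: "0 < \<epsilon>" "\<epsilon> < 1 / 2" and \<kappa>: "0 < \<kappa>" "\<kappa> \<le> c\<^sub>9 * \<epsilon> powr (s + 2 + 1 / \<alpha>)"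
    define l where "l = b * \<epsilon>"
    \<comment> \<open>The value for which \<open>4 * \<tau> * l powr (- s)\<close> is exactly
      \<epsilon>/4.\<close>
    define \<tau> where "\<tau> = \<epsilon> * l powr s / 16"
    define l\<^sub>0 where "l\<^sub>0 = c\<^sub>0 * \<epsilon> powr (s + 2)"
    have l: "0 < l" using b \<epsilon> by (simp add: l_def)
    have \<epsilon>1: "\<epsilon> powr (s + 2) \<le> 1" using \<epsilon> assms powr_mono2[of "s + 2" \<epsilon> 1] by simp
    have l0: "0 < l\<^sub>0" "l\<^sub>0 \<le> 1 / 4"
      using c0 \<epsilon> mult_mono[OF c0(2) \<epsilon>1] by (auto simp: l\<^sub>0_def)
    \<comment> \<open>The value at which \<open>2 * C\<^sub>2 * q powr \<alpha>\<close> is exactly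
      \<epsilon>/4; both continuity conditions follow once \<open>\<kappa> / l\<^sub>0\<close> and
      \<open>16 * \<kappa>\<close> are at most \<open>q\<close>.\<close>
    define q where "q = (\<epsilon> / (8 * C\<^sub>2)) powr (1 / \<alpha>)"
    have q: "q powr \<alpha> = \<epsilon> / (8 * C\<^sub>2)" using assms \<epsilon> by (simp add: q_def powr_powr)
    have aq: "a * \<epsilon> powr (1 / \<alpha>) \<le> q" "a * \<epsilon> powr (1 / \<alpha>) \<le> 1"
    proof -
      have "a * \<epsilon> powr (1 / \<alpha>) \<le> (1 / (8 * C\<^sub>2)) powr (1 / \<alpha>) * \<epsilon> powr (1 / \<alpha>)"
        using a by (intro mult_right_mono) auto
      also have "\<dots> = q" by (simp add: q_def powr_mult[symmetric])
      finally show "a * \<epsilon> powr (1 / \<alpha>) \<le> q" .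
      have "\<epsilon> powr (1 / \<alpha>) \<le> 1" using \<epsilon> assms powr_mono2[of "1 / \<alpha>" \<epsilon> 1] by simp
      then show "a * \<epsilon> powr (1 / \<alpha>) \<le> 1" using mult_mono[OF a(2)] a by auto
    qed
    have \<kappa>': "\<kappa> \<le> 1 / 16 * (l\<^sub>0 * (a * \<epsilon> powr (1 / \<alpha>)))"
      using \<kappa>(2) by (simp add: c\<^sub>9_def l\<^sub>0_def powr_add ac_simps)
    have \<kappa>1: "\<kappa> \<le> 1 / 16 * (a * \<epsilon> powr (1 / \<alpha>))"
    proof -
      have "l\<^sub>0 * (a * \<epsilon> powr (1 / \<alpha>)) \<le> 1 * (a * \<epsilon> powr (1 / \<alpha>))"
        using l0 a by (intro mult_right_mono) auto
      then show ?thesis using \<kappa>' by linarith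
    qed
    have \<kappa>2: "\<kappa> / l\<^sub>0 \<le> q"
    proof -
      have "0 \<le> l\<^sub>0 * (a * \<epsilon> powr (1 / \<alpha>))" using l0 a by simp
      then have "\<kappa> \<le> l\<^sub>0 * (a * \<epsilon> powr (1 / \<alpha>))" using \<kappa>' by linarith
      also have "\<dots> \<le> l\<^sub>0 * q" using aq l0 by (intro mult_left_mono) auto
      finally show ?thesis using l0 by (simp add: pos_divide_le_eq mult.commute)
    qed
    have osc: "2 * C\<^sub>2 * t powr \<alpha> \<le> \<epsilon> / 4" if "0 \<le> t" "t \<le> q" for t
    proof -
      have "2 * C\<^sub>2 * t powr \<alpha> \<le> 2 * C\<^sub>2 * q powr \<alpha>"
        using assms that by (intro mult_left_mono powr_mono2) auto
      also have "\<dots> = \<epsilon> / 4" using assms by (simp add: q)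
      finally show ?thesis .
    qed
    show "\<exists>l l\<^sub>0 \<tau>. \<kappa> \<le> 1 / 16 \<and> 0 < l \<and> l \<le> 1 / 16 \<and> 0 < l\<^sub>0 \<and> l\<^sub>0 \<le> 1 / 4 \<and> 0 \<le> \<tau>
        \<and> 8 * C\<^sub>1 * l \<le> 2 powr (- (s + 1)) * \<epsilon>
        \<and> 4 * \<tau> * l powr (- s) \<le> \<epsilon> / 4
        \<and> 4 * C\<^sub>1 * l\<^sub>0 * \<Lambda> * 2 powr s \<le> \<tau> * \<epsilon>
        \<and> 2 * C\<^sub>2 * (\<kappa> / l\<^sub>0) powr \<alpha> \<le> \<epsilon> / 2
        \<and> 2 * C\<^sub>2 * (16 * \<kappa>) powr \<alpha> \<le> \<epsilon> / 4"
    proof (rule exI[of _ l], rule exI[of _ l\<^sub>0], rule exI[of _ \<tau>], intro conjI)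
      show "\<kappa> \<le> 1 / 16" using \<kappa>1 aq(2) by linarith
      show "l \<le> 1 / 16" using mult_mono[OF b(2), of \<epsilon> 1] \<epsilon> b by (simp add: l_def)
      show "0 \<le> \<tau>" using \<epsilon> by (simp add: \<tau>_def)
      show "8 * C\<^sub>1 * l \<le> 2 powr (- (s + 1)) * \<epsilon>"
        using mult_right_mono[OF b(3), of \<epsilon>] \<epsilon> by (simp add: l_def)
      have "l powr s * l powr (- s) = 1" using l by (simp add: powr_add[symmetric])
      then show "4 * \<tau> * l powr (- s) \<le> \<epsilon> / 4" by (simp add: \<tau>_def mult.assoc)
      have "\<tau> * \<epsilon> = b powr s * \<epsilon> powr (s + 2) / 16"
      proof -
        have "\<epsilon> * \<epsilon> * \<epsilon> powr s = \<epsilon> powr (s + 2)"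
          using \<epsilon> by (simp add: powr_add power2_eq_square)
        then show ?thesis unfolding \<tau>_def l_def powr_mult by (simp add: ac_simps)
      qed
      moreover have "4 * C\<^sub>1 * l\<^sub>0 * \<Lambda> * 2 powr s = (64 * C\<^sub>1 * \<Lambda> * 2 powr s * c\<^sub>0) * \<epsilon> powr (s + 2) / 16"
        by (simp add: l\<^sub>0_def)
      moreover have "(64 * C\<^sub>1 * \<Lambda> * 2 powr s * c\<^sub>0) * \<epsilon> powr (s + 2) \<le> b powr s * \<epsilon> powr (s + 2)"
        using c0(3) by (intro mult_right_mono) auto
      ultimately show "4 * C\<^sub>1 * l\<^sub>0 * \<Lambda> * 2 powr s \<le> \<tau> * \<epsilon>" by linarith
      show "2 * C\<^sub>2 * (\<kappa> / l\<^sub>0) powr \<alpha> \<le> \<epsilon> / 2"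
        using osc[of "\<kappa> / l\<^sub>0"] \<kappa>(1) l0 \<kappa>2 \<epsilon> by simp
      show "2 * C\<^sub>2 * (16 * \<kappa>) powr \<alpha> \<le> \<epsilon> / 4"
        using \<kappa>1 aq(1) \<kappa>(1) by (intro osc) auto
    qed (use l l0 in auto)
  qed
qed

text \<open>What the constants may depend on is expressed by the order of the quantifiers. The
  weight \<eta> is quantified universally, so the independence of the potential from it need not be
  presupposed.\<close>

theorem proposition6p1:
  fixes s \<alpha> :: real
  assumes "0 < s" and "0 < \<alpha>" and "\<alpha> \<le> 1"
  shows "\<exists>\<beta>>0. \<forall>(d::nat) (N::ennreal) (\<Lambda>::real). 2 \<le> d \<and> s < real d \<and> 0 < \<Lambda> \<longrightarrow>
    (\<exists>c\<^sub>9>0. \<forall>(d'::nat) (K::kernel) (\<mu>::point measure) (\<eta>::point \<Rightarrow> real)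
        (\<epsilon>::real) (e::nat \<Rightarrow> complex) (x\<^sub>0::point) (r::real) (\<kappa>::real).
      1 \<le> d' \<longrightarrow> cz_kernel d d' s \<alpha> K \<longrightarrow> kernel_seminorm d d' s \<alpha> K = N \<longrightarrow>
      rd_measure d \<mu> \<longrightarrow> nontrivial \<mu> \<longrightarrow> nice d s \<Lambda> \<mu> \<longrightarrow> reflectionless d d' s \<alpha> K \<mu> \<longrightarrow>
      normalizer d \<mu> \<eta> \<longrightarrow>
      0 < \<epsilon> \<longrightarrow> \<epsilon> < 1 / 2 \<longrightarrow> cnorm d' e = 1 \<longrightarrow> x\<^sub>0 \<in> Rd d \<longrightarrow> 0 < r \<longrightarrow>
      0 < \<kappa> \<longrightarrow> \<kappa> \<le> c\<^sub>9 * \<epsilon> powr \<beta> \<longrightarrow>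
      dense_in d (\<kappa> * r) (E_set d d' s \<alpha> K \<mu> \<eta> e \<epsilon> r) (rball d x\<^sub>0 (2 * r)) \<longrightarrow>
      emeasure \<mu> (rball d x\<^sub>0 r) = 0)"
proof (rule exI[of _ "s + 2 + 1 / \<alpha>"], intro conjI allI impI)
  show "0 < s + 2 + 1 / \<alpha>" using assms by (simp add: add_pos_pos)
  fix d :: nat and N :: ennreal and \<Lambda> :: real
  assume "2 \<le> d \<and> s < real d \<and> 0 < \<Lambda>"
  then have \<Lambda>: "0 < \<Lambda>" by simp
  \<comment> \<open>\<open>C_near\<close> and \<open>C_far\<close> belong to a locale that fixes
    \<mu> and K, but \<open>c\<^sub>9\<close> has to be found before these; hence the two values are
    written out, with \<open>N\<close> for the seminorm.\<close>
  let ?C\<^sub>1 = "2 powr (s + 1) * \<Lambda>"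
  let ?C\<^sub>2 = "(enn2real N + 1 + (s + \<alpha>)) * (2 powr (s + \<alpha>) / (1 - 2 powr (- \<alpha>))) * \<Lambda>"
  have C1: "0 < ?C\<^sub>1" using \<Lambda> by simp
  have C2: "0 < ?C\<^sub>2"
    using \<Lambda> assms powr_less_one[of 2 "- \<alpha>"] enn2real_nonneg[of N]
    by (intro mult_pos_pos divide_pos_pos add_nonneg_pos add_pos_pos) auto
  obtain c\<^sub>9 where c9: "0 < c\<^sub>9"
    and constants: "\<And>\<epsilon> \<kappa>. 0 < \<epsilon> \<Longrightarrow> \<epsilon> < 1 / 2 \<Longrightarrow> 0 < \<kappa> \<Longrightarrow> \<kappa> \<le> c\<^sub>9 * \<epsilon> powr (s + 2 + 1 / \<alpha>) \<Longrightarrow>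
      \<exists>l l\<^sub>0 \<tau>. \<kappa> \<le> 1 / 16 \<and> 0 < l \<and> l \<le> 1 / 16 \<and> 0 < l\<^sub>0 \<and> l\<^sub>0 \<le> 1 / 4 \<and> 0 \<le> \<tau>
        \<and> 8 * ?C\<^sub>1 * l \<le> 2 powr (- (s + 1)) * \<epsilon>
        \<and> 4 * \<tau> * l powr (- s) \<le> \<epsilon> / 4
        \<and> 4 * ?C\<^sub>1 * l\<^sub>0 * \<Lambda> * 2 powr s \<le> \<tau> * \<epsilon>
        \<and> 2 * ?C\<^sub>2 * (\<kappa> / l\<^sub>0) powr \<alpha> \<le> \<epsilon> / 2
        \<and> 2 * ?C\<^sub>2 * (16 * \<kappa>) powr \<alpha> \<le> \<epsilon> / 4"
    by (rule collapse_constants[OF assms(1,2) \<Lambda> C1 C2]) (rule that)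
  show "\<exists>c\<^sub>9>0. \<forall>(d'::nat) (K::kernel) (\<mu>::point measure) (\<eta>::point \<Rightarrow> real)
        (\<epsilon>::real) (e::nat \<Rightarrow> complex) (x\<^sub>0::point) (r::real) (\<kappa>::real).
      1 \<le> d' \<longrightarrow> cz_kernel d d' s \<alpha> K \<longrightarrow> kernel_seminorm d d' s \<alpha> K = N \<longrightarrow>
      rd_measure d \<mu> \<longrightarrow> nontrivial \<mu> \<longrightarrow> nice d s \<Lambda> \<mu> \<longrightarrow> reflectionless d d' s \<alpha> K \<mu> \<longrightarrow>
      normalizer d \<mu> \<eta> \<longrightarrow>
      0 < \<epsilon> \<longrightarrow> \<epsilon> < 1 / 2 \<longrightarrow> cnorm d' e = 1 \<longrightarrow> x\<^sub>0 \<in> Rd d \<longrightarrow> 0 < r \<longrightarrow>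
      0 < \<kappa> \<longrightarrow> \<kappa> \<le> c\<^sub>9 * \<epsilon> powr (s + 2 + 1 / \<alpha>) \<longrightarrow>
      dense_in d (\<kappa> * r) (E_set d d' s \<alpha> K \<mu> \<eta> e \<epsilon> r) (rball d x\<^sub>0 (2 * r)) \<longrightarrow>
      emeasure \<mu> (rball d x\<^sub>0 r) = 0"
  proof (intro exI[of _ c\<^sub>9] conjI c9 allI impI)
    fix d' K \<mu> \<eta> \<epsilon> e x\<^sub>0 r \<kappa>
    assume cz: "cz_kernel d d' s \<alpha> K" and N: "kernel_seminorm d d' s \<alpha> K = N"
      and \<mu>: "rd_measure d \<mu>" "nice d s \<Lambda> \<mu>" "reflectionless d d' s \<alpha> K \<mu>" "normalizer d \<mu> \<eta>"
      and \<epsilon>: "0 < \<epsilon>" "\<epsilon> < 1 / 2" and e: "cnorm d' e = 1" and x\<^sub>0: "x\<^sub>0 \<in> Rd d" and r: "0 < r"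
      and \<kappa>: "0 < \<kappa>" "\<kappa> \<le> c\<^sub>9 * \<epsilon> powr (s + 2 + 1 / \<alpha>)"
      and dense: "dense_in d (\<kappa> * r) (E_set d d' s \<alpha> K \<mu> \<eta> e \<epsilon> r) (rball d x\<^sub>0 (2 * r))"
    interpret reflectionless_measure d s \<Lambda> \<mu> d' \<alpha> K \<eta> e
      by unfold_locales (use assms \<Lambda> cz \<mu> e in auto)
    have C: "C_near = ?C\<^sub>1" "C_far = ?C\<^sub>2"
      unfolding C_near_def C_far_def by (simp_all only: N)
    obtain l l\<^sub>0 \<tau> where *: "\<kappa> \<le> 1 / 16" "0 < l" "l \<le> 1 / 16" "0 < l\<^sub>0" "l\<^sub>0 \<le> 1 / 4" "0 \<le> \<tau>"
        "8 * C_near * l \<le> 2 powr (- (s + 1)) * \<epsilon>" "4 * \<tau> * l powr (- s) \<le> \<epsilon> / 4"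
        "4 * C_near * l\<^sub>0 * \<Lambda> * 2 powr s \<le> \<tau> * \<epsilon>" "2 * C_far * (\<kappa> / l\<^sub>0) powr \<alpha> \<le> \<epsilon> / 2"
        "2 * C_far * (16 * \<kappa>) powr \<alpha> \<le> \<epsilon> / 4"
      using constants[OF \<epsilon> \<kappa>] unfolding C by blast
    have "measure \<mu> (rball d x\<^sub>0 r) = 0"
      by (rule collapse[OF x\<^sub>0 r \<epsilon>(1) \<kappa>(1) * dense])
    then show "emeasure \<mu> (rball d x\<^sub>0 r) = 0"
      using emeasure_rball_finite[OF x\<^sub>0, of r] by (simp add: emeasure_eq_ennreal_measure)
  qed
qed

end
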